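(* Let $d\in\{6,7\}$ and let $O$ be an equipment of the alternating group $\mathbb A_d$. The ambiguity index $a_{(\mathbb A_d,O)}$ takes the following values: (I) $a_{(\mathbb A_d,O)}=6$ if $O$ contains only elements of conjugacy classes of type (I); (II) $a_{(\mathbb A_d,O)}=2$ if $O$ contains only elements of conjugacy classes of type (I) and the elements of at least one conjugacy class of type (II); (III) $a_{(\mathbb A_d,O)}=3$ if $O$ contains only elements of conjugacy classes of type (I) and the elements of at least one conjugacy class of type (III); (II+III) $a_{(\mathbb A_d,O)}=1$ if $O$ contains the elements of at least one conjugacy class of type (II) and the elements of at least one conjugacy class of type (III).
   Context: An equipment of a finite group $G$ is a subset $O\subset G$ that is a union of conjugacy classes of $G$ and generates $G$. Ambiguity index: let $\widetilde G$ be the group generated by the letters $y_g$, $g\in O$, subject to the relations $y_{g_1}y_{g_2}=y_{g_2}y_{g_2^{-1}g_1g_2}=y_{g_1g_2g_1^{-1}}y_{g_1}$ for all $g_1,g_2\in O$, and let $\beta:\widetilde G\to G$ be the homomorphism with $\beta(y_g)=g$. The commutator subgroup $[\widetilde G,\widetilde G]$ is known to be finite, and $a_{(G,O)}$ is the order of $\ker\beta\cap[\widetilde G,\widetilde G]$. The cycle type of a permutation is the collection of lengths of its non-trivial cycles (lengths $\geq 2$). The non-trivial conjugacy classes of $\mathbb A_d$, $d=6,7$, are divided as follows according to cycle type. Type (I): classes of cycle type $(5)$, $(2,4)$ and, if $d=7$, $(7)$. Type (II): classes of cycle type $(3)$ or $(3,3)$. Type (III): classes of cycle type $(2,2)$ and,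 if $d=7$, $(2,2,3)$. In items (II) and (III), $O$ contains at least one class of the named type (II), respectively (III), and all other classes in $O$ are of type (I) or of that same type. *)

theory Defs
  imports
    "HOL-Algebra.Sym_Groups"
    "HOL-Combinatorics.Orbits"
    "HOL-Library.Multiset"
begin

section \<open>Groups given by generators and relations\<close>

text \<open>A letter \<open>(a, True)\<close> stands for the generator \<open>a\<close> and \<open>(a, False)\<close> for its formal
  inverse.\<close>

type_synonym 'a letters = "('a \<times> bool) list"

definition words :: "'a set \<Rightarrow> 'a letters set" where
  "words S = lists (S \<times> UNIV)"

inductive pres_eq :: "'a set \<Rightarrow> ('a letters \<times> 'a letters) set \<Rightarrow> 'a letters \<Rightarrow> 'a letters \<Rightarrow> bool"
  for S R where
  refl: "w \<in> words S \<Longrightarrow> pres_eq S R w w"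
| sym: "pres_eq S R v w \<Longrightarrow> pres_eq S R w v"
| trans: "pres_eq S R u v \<Longrightarrow> pres_eq S R v w \<Longrightarrow> pres_eq S R u w"
| cancel: "u \<in> words S \<Longrightarrow> v \<in> words S \<Longrightarrow> a \<in> S \<Longrightarrow>
    pres_eq S R (u @ [(a, b), (a, \<not> b)] @ v) (u @ v)"
| relation: "u \<in> words S \<Longrightarrow> v \<in> words S \<Longrightarrow> (l, r) \<in> R \<Longrightarrow>
    pres_eq S R (u @ l @ v) (u @ r @ v)"

definition pres_class :: "'a set \<Rightarrow> ('a letters \<times> 'a letters) set \<Rightarrow> 'a letters \<Rightarrow> 'a letters set" where
  "pres_class S R w = {v. pres_eq S R w v}"

text \<open>The group \<open>\<langle>S | l = r for (l, r) \<in> R\<rangle>\<close>; both sides of every relation are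
  supposed to be words over \<open>S\<close>.\<close>

definition presented_group ::
    "'a set \<Rightarrow> ('a letters \<times> 'a letters) set \<Rightarrow> 'a letters set monoid" where
  "presented_group S R =
    \<lparr>carrier = pres_class S R ` words S,
     mult = (\<lambda>X Y. \<Union>u\<in>X. \<Union>v\<in>Y. pres_class S R (u @ v)),
     one = pres_class S R []\<rparr>"

lemma words_simps [simp]:
  "[] \<in> words S"
  "u @ v \<in> words S \<longleftrightarrow> u \<in> words S \<and> v \<in> words S"
  "x # u \<in> words S \<longleftrightarrow> fst x \<in> S \<and> u \<in> words S"
  by (simp_all add: words_def mem_Times_iff)

lemma pres_eq_words:
  assumes "R \<subseteq> words S \<times> words S" "pres_eq S R u v"
  shows "u \<in> words S \<and> v \<in> words S"
  using assms(2)
proof induction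
  case (relation u v l r)
  then have "l \<in> words S" "r \<in> words S" using assms(1) by blast+
  then show ?case using relation by simp
qed simp_all

lemma pres_eq_append_left:
  assumes "pres_eq S R u v" "w \<in> words S"
  shows "pres_eq S R (w @ u) (w @ v)"
  using assms
proof (induction rule: pres_eq.induct)
  case (cancel u v a b)
  then show ?case using pres_eq.cancel[of "w @ u" S v a R b] by simp
next
  case (relation u v l r)
  then show ?case using pres_eq.relation[of "w @ u" S v l r R] by simp
next
  case (trans u v w')
  show ?case by (rule pres_eq.trans[OF trans.IH]) (fact trans.prems)+
qed (simp_all add: pres_eq.refl pres_eq.sym)

lemma pres_eq_append_right:
  assumes "pres_eq S R u v" "w \<in> words S"
  shows "pres_eq S R (u @ w) (v @ w)"
  using assms
proof (induction rule: pres_eq.induct)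
  case (cancel u v a b)
  then show ?case using pres_eq.cancel[of u S "v @ w" a R b] by simp
next
  case (relation u v l r)
  then show ?case using pres_eq.relation[of u S "v @ w" l r R] by simp
next
  case (trans u v w')
  show ?case by (rule pres_eq.trans[OF trans.IH]) (fact trans.prems)+
qed (simp_all add: pres_eq.refl pres_eq.sym)

lemma pres_eq_append:
  assumes R: "R \<subseteq> words S \<times> words S" and "pres_eq S R u u'" "pres_eq S R v v'"
  shows "pres_eq S R (u @ v) (u' @ v')"
proof (rule pres_eq.trans)
  have "v \<in> words S" "u' \<in> words S" using pres_eq_words[OF R] assms(2,3) by blast+
  then show "pres_eq S R (u @ v) (u' @ v)" "pres_eq S R (u' @ v) (u' @ v')"
    using assms(2,3) pres_eq_append_left pres_eq_append_right by blast+
qed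

lemma pres_class_eq_iff:
  assumes "u \<in> words S"
  shows "pres_class S R u = pres_class S R v \<longleftrightarrow> pres_eq S R u v"
proof
  assume "pres_class S R u = pres_class S R v"
  moreover have "u \<in> pres_class S R u" using assms by (simp add: pres_class_def pres_eq.refl)
  ultimately have "pres_eq S R v u" by (simp add: pres_class_def)
  then show "pres_eq S R u v" by (rule pres_eq.sym)
next
  assume "pres_eq S R u v"
  then have "pres_eq S R u w \<longleftrightarrow> pres_eq S R v w" for w
    by (metis pres_eq.sym pres_eq.trans)
  then show "pres_class S R u = pres_class S R v" by (simp add: pres_class_def)
qed

lemma presented_group_mult:
  assumes R: "R \<subseteq> words S \<times> words S" and "u \<in> words S" "v \<in> words S"
  shows "pres_class S R u \<otimes>\<^bsub>presented_group S R\<^esub> pres_class S R v = pres_class S R (u @ v)"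
proof -
  have "pres_class S R (u' @ v') = pres_class S R (u @ v)"
    if "u' \<in> pres_class S R u" "v' \<in> pres_class S R v" for u' v'
    using that assms pres_class_eq_iff[of "u @ v" S R "u' @ v'"] pres_eq_append[OF R]
    by (auto simp: pres_class_def)
  moreover have "u \<in> pres_class S R u" "v \<in> pres_class S R v"
    using assms by (auto simp: pres_class_def intro: pres_eq.refl)
  ultimately have "(\<Union>u'\<in>pres_class S R u. \<Union>v'\<in>pres_class S R v. pres_class S R (u' @ v')) =
      pres_class S R (u @ v)" by blast
  then show ?thesis by (simp add: presented_group_def)
qed

lemma presented_group_inverse:
  assumes "w \<in> words S"
  shows "pres_eq S R (rev (map (\<lambda>(a, b). (a, \<not> b)) w) @ w) []"
  using assms
proof (induction w)
  case (Cons x w)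
  obtain a b where x: "x = (a, b)" by (cases x)
  let ?i = "rev (map (\<lambda>(a, b). (a, \<not> b)) w)"
  have i: "?i \<in> words S" using Cons.prems by (auto simp: words_def)
  have "pres_eq S R (?i @ [(a, \<not> b), (a, \<not> \<not> b)] @ w) (?i @ w)"
    by (rule pres_eq.cancel) (use i Cons.prems x in auto)
  then show ?case using Cons x by (auto intro: pres_eq.trans)
qed (auto intro: pres_eq.refl)

lemma presented_group_group:
  assumes R: "R \<subseteq> words S \<times> words S"
  shows "group (presented_group S R)"
proof (rule groupI)
  let ?P = "presented_group S R"
  have car: "carrier ?P = pres_class S R ` words S" and one: "\<one>\<^bsub>?P\<^esub> = pres_class S R []"
    by (auto simp: presented_group_def)
  note m = presented_group_mult[OF R]
  show "x \<otimes>\<^bsub>?P\<^esub> y \<in> carrier ?P" if "x \<in> carrier ?P" "y \<in> carrier ?P" for x y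
    using that by (auto simp: car m)
  show "\<one>\<^bsub>?P\<^esub> \<in> carrier ?P" by (auto simp: car one)
  show "x \<otimes>\<^bsub>?P\<^esub> y \<otimes>\<^bsub>?P\<^esub> z = x \<otimes>\<^bsub>?P\<^esub> (y \<otimes>\<^bsub>?P\<^esub> z)"
    if "x \<in> carrier ?P" "y \<in> carrier ?P" "z \<in> carrier ?P" for x y z
    using that by (auto simp: car m)
  show "\<one>\<^bsub>?P\<^esub> \<otimes>\<^bsub>?P\<^esub> x = x" if "x \<in> carrier ?P" for x
    using that by (auto simp: car one m)
  show "\<exists>y\<in>carrier ?P. y \<otimes>\<^bsub>?P\<^esub> x = \<one>\<^bsub>?P\<^esub>" if x: "x \<in> carrier ?P" for x
  proof -
    obtain w where w: "w \<in> words S" "x = pres_class S R w" using x by (auto simp: car)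
    let ?i = "rev (map (\<lambda>(a, b). (a, \<not> b)) w)"
    have i: "?i \<in> words S" using w by (auto simp: words_def)
    have "pres_class S R ?i \<otimes>\<^bsub>?P\<^esub> x = \<one>\<^bsub>?P\<^esub>"
      using i w presented_group_inverse[OF w(1), of R] pres_class_eq_iff[of "?i @ w" S R "[]"]
      by (simp add: m one)
    then show ?thesis using i by (auto simp: car)
  qed
qed


section \<open>Equipments and the ambiguity index\<close>

definition conj_class :: "('g, 'm) monoid_scheme \<Rightarrow> 'g \<Rightarrow> 'g set" where
  "conj_class G x = {h \<otimes>\<^bsub>G\<^esub> x \<otimes>\<^bsub>G\<^esub> inv\<^bsub>G\<^esub> h | h. h \<in> carrier G}"

definition conj_classes :: "('g, 'm) monoid_scheme \<Rightarrow> 'g set set" where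
  "conj_classes G = conj_class G ` carrier G"

definition equipment :: "('g, 'm) monoid_scheme \<Rightarrow> 'g set \<Rightarrow> bool" where
  "equipment G E \<longleftrightarrow> (\<exists>\<C> \<subseteq> conj_classes G. E = \<Union>\<C>) \<and> generate G E = carrier G"

definition y_letter :: "'g \<Rightarrow> 'g \<times> bool" where
  "y_letter g = (g, True)"

definition equipment_rels :: "('g, 'm) monoid_scheme \<Rightarrow> 'g set \<Rightarrow> ('g letters \<times> 'g letters) set" where
  "equipment_rels G E =
    {([y_letter g1, y_letter g2],
      [y_letter g2, y_letter (inv\<^bsub>G\<^esub> g2 \<otimes>\<^bsub>G\<^esub> g1 \<otimes>\<^bsub>G\<^esub> g2)]) | g1 g2. g1 \<in> E \<and> g2 \<in> E} \<union>
    {([y_letter g1, y_letter g2],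
      [y_letter (g1 \<otimes>\<^bsub>G\<^esub> g2 \<otimes>\<^bsub>G\<^esub> inv\<^bsub>G\<^esub> g1), y_letter g1]) | g1 g2. g1 \<in> E \<and> g2 \<in> E}"

definition tilde_group :: "('g, 'm) monoid_scheme \<Rightarrow> 'g set \<Rightarrow> 'g letters set monoid" where
  "tilde_group G E = presented_group E (equipment_rels G E)"

definition y_gen :: "('g, 'm) monoid_scheme \<Rightarrow> 'g set \<Rightarrow> 'g \<Rightarrow> 'g letters set" where
  "y_gen G E g = pres_class E (equipment_rels G E) [y_letter g]"

fun word_value :: "('g, 'm) monoid_scheme \<Rightarrow> 'g letters \<Rightarrow> 'g" where
  "word_value G [] = \<one>\<^bsub>G\<^esub>"
| "word_value G ((g, b) # w) = (if b then g else inv\<^bsub>G\<^esub> g) \<otimes>\<^bsub>G\<^esub> word_value G w"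

text \<open>All words in an element of the group have the same value in \<open>G\<close>, see \<open>beta_class\<close>;
  \<open>beta\<close> is the homomorphism sending \<open>y\<^sub>g\<close> to \<open>g\<close>, see \<open>beta_hom\<close> and \<open>beta_y_gen\<close>.\<close>

definition beta :: "('g, 'm) monoid_scheme \<Rightarrow> 'g letters set \<Rightarrow> 'g" where
  "beta G X = the_elem (word_value G ` X)"

definition ambiguity_index :: "('g, 'm) monoid_scheme \<Rightarrow> 'g set \<Rightarrow> nat" where
  "ambiguity_index G E =
    card (kernel (tilde_group G E) G (beta G) \<inter> derived (tilde_group G E) (carrier (tilde_group G E)))"

context group
begin

lemma equipment_subset:
  assumes "equipment G E"
  shows "E \<subseteq> carrier G"
proof -
  have "C \<subseteq> carrier G" if C: "C \<in> conj_classes G" for C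
    using C unfolding conj_classes_def conj_class_def by auto
  then show ?thesis using assms unfolding equipment_def by blast
qed

lemma equipment_conj_closed:
  assumes "equipment G E" "g \<in> E" "h \<in> carrier G"
  shows "h \<otimes> g \<otimes> inv h \<in> E"
proof -
  obtain X where "X \<in> conj_classes G" "g \<in> X" "X \<subseteq> E"
    using assms(1,2) unfolding equipment_def by blast
  then obtain x where x: "x \<in> carrier G" "g \<in> conj_class G x" "conj_class G x \<subseteq> E"
    unfolding conj_classes_def by blast
  then obtain k where k: "k \<in> carrier G" "g = k \<otimes> x \<otimes> inv k" by (auto simp: conj_class_def)
  have "h \<otimes> g \<otimes> inv h = (h \<otimes> k) \<otimes> x \<otimes> inv (h \<otimes> k)"
    using assms(3) x(1) k by (simp add: inv_mult_group m_assoc)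
  then have "h \<otimes> g \<otimes> inv h \<in> conj_class G x"
    using assms(3) k(1) unfolding conj_class_def by blast
  then show ?thesis using x(3) by blast
qed

lemma equipment_rels_words:
  assumes "equipment G E"
  shows "equipment_rels G E \<subseteq> words E \<times> words E"
proof -
  have 1: "g1 \<otimes> g2 \<otimes> inv g1 \<in> E" if "g1 \<in> E" "g2 \<in> E" for g1 g2
    using that equipment_subset[OF assms] equipment_conj_closed[OF assms] by blast
  have 2: "inv g2 \<otimes> g1 \<otimes> g2 \<in> E" if g: "g1 \<in> E" "g2 \<in> E" for g1 g2
  proof -
    have "g2 \<in> carrier G" using g(2) equipment_subset[OF assms] by blast
    then show ?thesis using equipment_conj_closed[OF assms g(1), of "inv g2"] by simp
  qed
  show ?thesis unfolding equipment_rels_def y_letter_def using 1 2 by auto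
qed

lemma tilde_group_group:
  assumes "equipment G E"
  shows "group (tilde_group G E)"
  unfolding tilde_group_def by (rule presented_group_group[OF equipment_rels_words[OF assms]])

lemma word_value_closed:
  assumes "E \<subseteq> carrier G" "w \<in> words E"
  shows "word_value G w \<in> carrier G"
  using assms(2)
proof (induction w)
  case (Cons x w)
  obtain g b where x: "x = (g, b)" by (cases x)
  then have "g \<in> carrier G" using Cons.prems assms(1) by auto
  then show ?case using Cons x by simp
qed simp

lemma word_value_append:
  assumes "E \<subseteq> carrier G" "u \<in> words E" "v \<in> words E"
  shows "word_value G (u @ v) = word_value G u \<otimes> word_value G v"
  using assms(2)
proof (induction u)
  case Nil
  show ?case using word_value_closed[OF assms(1,3)] by simp
next
  case (Cons x u)
  obtain g b where x: "x = (g, b)" by (cases x)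
  then have "g \<in> carrier G" using Cons.prems assms(1) by auto
  moreover have "u \<in> words E" using Cons.prems by simp
  ultimately show ?case
    using Cons.IH x word_value_closed[OF assms(1)] assms(3) by (simp add: m_assoc)
qed

lemma word_value_pres_eq:
  assumes E: "equipment G E" and "pres_eq E (equipment_rels G E) u v"
  shows "word_value G u = word_value G v"
proof -
  have sub: "E \<subseteq> carrier G" using equipment_subset[OF E] .
  note R = equipment_rels_words[OF E]
  show ?thesis using assms(2)
  proof induction
    case (cancel u v a b)
    have "a \<in> carrier G" using cancel(3) sub by blast
    then have "word_value G [(a, b), (a, \<not> b)] = \<one>" by simp
    moreover have "[(a, b), (a, \<not> b)] \<in> words E" using cancel(3) by simp
    ultimately show ?case using cancel(1,2) word_value_closed[OF sub]
      by (simp add: word_value_append[OF sub] del: append_Cons word_value.simps)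
  next
    case (relation u v l r)
    obtain g1 g2 where g: "g1 \<in> carrier G" "g2 \<in> carrier G"
      and l: "l = [(g1, True), (g2, True)]"
      and r: "r = [(g2, True), (inv g2 \<otimes> g1 \<otimes> g2, True)] \<or>
        r = [(g1 \<otimes> g2 \<otimes> inv g1, True), (g1, True)]"
      using relation(3) sub unfolding equipment_rels_def y_letter_def by blast
    have "g2 \<otimes> (inv g2 \<otimes> g1 \<otimes> g2) = g1 \<otimes> g2"
      using g by (simp add: m_assoc[symmetric])
    moreover have "g1 \<otimes> g2 \<otimes> inv g1 \<otimes> g1 = g1 \<otimes> g2"
      using g by (simp add: m_assoc)
    ultimately have "word_value G l = word_value G r"
      using g l r by auto
    moreover have "l \<in> words E" "r \<in> words E" using R relation(3) by auto
    ultimately show ?case using relation by (simp add: word_value_append[OF sub])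
  qed auto
qed

lemma beta_class:
  assumes "equipment G E" "w \<in> words E"
  shows "beta G (pres_class E (equipment_rels G E) w) = word_value G w"
proof -
  have "word_value G ` pres_class E (equipment_rels G E) w = {word_value G w}"
    using assms word_value_pres_eq[OF assms(1)]
    by (fastforce simp: pres_class_def intro: pres_eq.refl)
  then show ?thesis by (simp add: beta_def)
qed

lemma beta_hom:
  assumes E: "equipment G E"
  shows "beta G \<in> hom (tilde_group G E) G"
proof (rule homI)
  have sub: "E \<subseteq> carrier G" using equipment_subset[OF E] .
  have car: "carrier (tilde_group G E) = pres_class E (equipment_rels G E) ` words E"
    by (simp add: tilde_group_def presented_group_def)
  show "beta G x \<in> carrier G" if "x \<in> carrier (tilde_group G E)" for x
    using that word_value_closed[OF sub] by (auto simp: car beta_class[OF E])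
  show "beta G (x \<otimes>\<^bsub>tilde_group G E\<^esub> y) = beta G x \<otimes> beta G y"
    if "x \<in> carrier (tilde_group G E)" "y \<in> carrier (tilde_group G E)" for x y
    using that unfolding car
    by (auto simp: tilde_group_def presented_group_mult[OF equipment_rels_words[OF E]]
        beta_class[OF E] word_value_append[OF sub])
qed

lemma beta_y_gen:
  assumes "equipment G E" "g \<in> E"
  shows "beta G (y_gen G E g) = g"
proof -
  have "g \<in> carrier G" using assms equipment_subset by blast
  moreover have "[y_letter g] \<in> words E" using assms(2) by (simp add: y_letter_def)
  ultimately show ?thesis
    by (simp add: y_gen_def beta_class[OF assms(1)]) (simp add: y_letter_def)
qed

end


section \<open>Cycle types and the classes of \<open>A\<^sub>6\<close> and \<open>A\<^sub>7\<close>\<close>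

definition cycle_type :: "('a \<Rightarrow> 'a) \<Rightarrow> nat multiset" where
  "cycle_type p = image_mset card (mset_set {orbit p x | x. p x \<noteq> x})"

definition alt_classes_of_type :: "nat \<Rightarrow> nat multiset set \<Rightarrow> (nat \<Rightarrow> nat) set set" where
  "alt_classes_of_type d T = {C \<in> conj_classes (alt_group d). \<forall>p\<in>C. cycle_type p \<in> T}"

definition classes_I :: "nat \<Rightarrow> (nat \<Rightarrow> nat) set set" where
  "classes_I d = alt_classes_of_type d ({{#5#}, {#2, 4#}} \<union> (if d = 7 then {{#7#}} else {}))"

definition classes_II :: "nat \<Rightarrow> (nat \<Rightarrow> nat) set set" where
  "classes_II d = alt_classes_of_type d {{#3#}, {#3, 3#}}"

definition classes_III :: "nat \<Rightarrow> (nat \<Rightarrow> nat) set set" where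
  "classes_III d = alt_classes_of_type d ({{#2, 2#}} \<union> (if d = 7 then {{#2, 2, 3#}} else {}))"

end

theory Submission
  imports
    Defs
    "HOL-Algebra.Multiplicative_Group"
    "HOL-Library.Function_Algebras"
    "HOL-Library.Numeral_Type"
begin

text \<open>
  Why the index depends on the presence of the types (II) and (III) only.

  The homomorphism \<open>beta\<close> from the group of an equipment \<open>E\<close> onto \<open>G\<close> is a central extension: an
  element of the group over \<open>h\<close> conjugates the generator \<open>y\<^sub>g\<close> to the generator of \<open>h g h\<inverse>\<close>, so the
  kernel centralizes every generator. In a central extension it depends only on \<open>g\<close> and \<open>h\<close> whether
  their lifts commute (\<open>lifts_commute\<close>). For \<open>g \<in> E\<close> the generator \<open>y\<^sub>g\<close> makes the lifts of \<open>g\<close>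
  commute with the lifts of the whole centralizer of \<open>g\<close>, and the group of \<open>E\<close> is universal among the
  central extensions with this property (\<open>lifts_commute_transfer\<close>): commuting lifts in it give
  commuting lifts in all the others.

  Let \<open>G\<close> be the alternating group of degree 6 or 7. In every central extension the intersection of
  the kernel with the derived subgroup is generated by two commutators (\<open>kernel_inter_derived\<close>): \<open>u\<close>,
  of lifts of \<open>(1 2)(3 4)\<close> and \<open>(1 3)(2 4)\<close>, with \<open>u\<^sup>2 = 1\<close>, and \<open>v\<close>, of lifts of \<open>(1 2 3)\<close> and
  \<open>(4 5 6)\<close>, with \<open>v\<^sup>3 = 1\<close>. Indeed, after dividing out \<open>u\<close> and \<open>v\<close>, lifts commute with the lifts of
  the centralizer for every 3-cycle, which yields a conjugation-equivariant choice of lifts of all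
  3-cycles. Suitably rescaled, these satisfy enough relations of the alternating group to generate a
  copy of it (\<open>kernel_derived_trivial\<close>), and this copy contains the derived subgroup. Hence the index is
  the product of the order of \<open>u\<close>, which is 1 or 2, and that of \<open>v\<close>, which is 1 or 3.

  An element of type (II) in \<open>E\<close> forces \<open>v = 1\<close>, since a disjoint 3-cycle or one of its own cycles lies
  in its centralizer, and an element of type (III) forces \<open>u = 1\<close> in the same way. To see that nothing
  else is forced, two explicit extensions are used. In a double cover built from operators of a Clifford
  algebra (\<open>spin\<close>) \<open>u \<noteq> 1\<close> but \<open>v = 1\<close>, and in a triple cover built from the Conway--Smith graph
  (\<open>triple_cover\<close>) \<open>v \<noteq> 1\<close>. The elements of type (I) generate their own centralizers, so their lifts
  always commute with the lifts of the centralizer; the elements of type (II) have order 3 and cannot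
  produce a nontrivial commutator in a kernel whose relevant part has order 2; for type (III) and the
  triple cover the argument is similar.
\<close>

section \<open>Central extensions and commuting lifts\<close>

lemma (in group) mult_inv_cancel:
  "\<lbrakk>x \<in> carrier G; y \<in> carrier G\<rbrakk> \<Longrightarrow> x \<otimes> (inv x \<otimes> y) = y"
  "\<lbrakk>x \<in> carrier G; y \<in> carrier G\<rbrakk> \<Longrightarrow> inv x \<otimes> (x \<otimes> y) = y"
  by (simp_all add: m_assoc[symmetric])

lemma (in group) conj_quotient_commutes:
  assumes "x \<in> carrier G" "y \<in> carrier G" "r \<in> carrier G"
    and "x \<otimes> r \<otimes> inv x = y \<otimes> r \<otimes> inv y"
  shows "r \<otimes> (inv y \<otimes> x) = (inv y \<otimes> x) \<otimes> r"
proof -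
  have "inv y \<otimes> (x \<otimes> r \<otimes> inv x) \<otimes> x = inv y \<otimes> (y \<otimes> r \<otimes> inv y) \<otimes> x"
    using assms(4) by simp
  then show ?thesis using assms(1-3) by (simp add: m_assoc mult_inv_cancel)
qed

text \<open>The definition asks for all lifts; in a central extension one pair of lifts decides
  (\<open>lifts_commuteI\<close>), because two lifts of an element differ by a central factor.\<close>

definition lifts_commute ::
    "('k, 'm) monoid_scheme \<Rightarrow> ('k \<Rightarrow> 'g) \<Rightarrow> 'g \<Rightarrow> 'g \<Rightarrow> bool" where
  "lifts_commute K p g h \<longleftrightarrow> (\<forall>x\<in>carrier K. \<forall>y\<in>carrier K.
     p x = g \<longrightarrow> p y = h \<longrightarrow> x \<otimes>\<^bsub>K\<^esub> y = y \<otimes>\<^bsub>K\<^esub> x)"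

lemma lifts_commute_sym: "lifts_commute K p g h \<Longrightarrow> lifts_commute K p h g"
  unfolding lifts_commute_def by metis

locale central_extension = K?: group K + G: group G
  for K (structure) and G (structure) and p +
  assumes hom: "p \<in> hom K G"
    and surjective: "p ` carrier K = carrier G"
    and kernel_central: "\<lbrakk>z \<in> carrier K; p z = \<one>\<^bsub>G\<^esub>; x \<in> carrier K\<rbrakk> \<Longrightarrow> z \<otimes> x = x \<otimes> z"
begin

sublocale p: group_hom K G p
  by (simp add: group_hom_def group_hom_axioms_def hom)

lemmas image_simps = p.hom_inv p.hom_nat_pow

lemma obtain_lift:
  assumes "g \<in> carrier G"
  obtains x where "x \<in> carrier K" "p x = g"
  using assms surjective by (metis imageE)

lemma same_image:
  assumes "x \<in> carrier K" "y \<in> carrier K" "p x = p y"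
  obtains z where "z \<in> carrier K" "p z = \<one>\<^bsub>G\<^esub>" "y = x \<otimes> z"
proof
  show "inv x \<otimes> y \<in> carrier K" using assms by simp
  show "p (inv x \<otimes> y) = \<one>\<^bsub>G\<^esub>" using assms by (simp add: image_simps)
  show "y = x \<otimes> (inv x \<otimes> y)" using assms by (simp add: m_assoc[symmetric])
qed

lemma conj_depends_on_image:
  assumes "x \<in> carrier K" "y \<in> carrier K" "p x = p y" "a \<in> carrier K"
  shows "x \<otimes> a \<otimes> inv x = y \<otimes> a \<otimes> inv y"
proof -
  obtain z where z: "z \<in> carrier K" "p z = \<one>\<^bsub>G\<^esub>" "y = x \<otimes> z"
    using same_image[OF assms(1-3)] .
  have "y \<otimes> a \<otimes> inv y = x \<otimes> (z \<otimes> a) \<otimes> (inv z \<otimes> inv x)"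
    using assms z by (simp add: m_assoc inv_mult_group)
  also have "\<dots> = x \<otimes> (a \<otimes> z) \<otimes> (inv z \<otimes> inv x)"
    using kernel_central[OF z(1,2) assms(4)] by simp
  also have "\<dots> = x \<otimes> a \<otimes> inv x"
    using assms z by (simp add: m_assoc mult_inv_cancel)
  finally show ?thesis by simp
qed

lemma lifts_commuteI:
  assumes x: "x \<in> carrier K" and y: "y \<in> carrier K" and comm: "x \<otimes> y = y \<otimes> x"
  shows "lifts_commute K p (p x) (p y)"
  unfolding lifts_commute_def
proof (intro ballI impI)
  fix x' y' assume *: "x' \<in> carrier K" "y' \<in> carrier K" "p x' = p x" "p y' = p y"
  have "x \<otimes> y \<otimes> inv x = y" using x y comm by (simp add: m_assoc)
  then have 1: "x' \<otimes> y \<otimes> inv x' = y" using conj_depends_on_image[OF x *(1) _ y] * by simp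
  then have "x' \<otimes> y = y \<otimes> x'" using x y * by (metis inv_solve_right' m_closed)
  then have "y \<otimes> x' \<otimes> inv y = x'" using y * by (metis inv_solve_right' m_closed)
  then have "y' \<otimes> x' \<otimes> inv y' = x'" using conj_depends_on_image[OF y *(2) _ *(1)] * by simp
  then show "x' \<otimes> y' = y' \<otimes> x'" using y * by (metis inv_solve_right' m_closed)
qed

lemma lifts_commute_iff:
  assumes "x \<in> carrier K" "y \<in> carrier K"
  shows "lifts_commute K p (p x) (p y) \<longleftrightarrow> x \<otimes> y = y \<otimes> x"
  using lifts_commuteI[OF assms] assms unfolding lifts_commute_def by blast

lemma lifts_commute_mult:
  assumes "g \<in> carrier G" "h \<in> carrier G" "k \<in> carrier G"
    and "lifts_commute K p g h" "lifts_commute K p g k"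
  shows "lifts_commute K p g (h \<otimes>\<^bsub>G\<^esub> k)"
proof -
  obtain x y z where *: "x \<in> carrier K" "p x = g" "y \<in> carrier K" "p y = h"
      "z \<in> carrier K" "p z = k"
    using assms(1-3) obtain_lift by metis
  have "x \<otimes> (y \<otimes> z) = (y \<otimes> z) \<otimes> x"
    using assms(4,5) * unfolding lifts_commute_def by (metis m_assoc)
  then show ?thesis using lifts_commuteI[of x "y \<otimes> z"] * by simp
qed

lemma lifts_commute_inv:
  assumes "g \<in> carrier G" "h \<in> carrier G" "lifts_commute K p g h"
  shows "lifts_commute K p g (inv\<^bsub>G\<^esub> h)"
proof -
  obtain x y where *: "x \<in> carrier K" "p x = g" "y \<in> carrier K" "p y = h"
    using assms(1-2) obtain_lift by metis
  then have "x \<otimes> y = y \<otimes> x" using assms(3) unfolding lifts_commute_def by blast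
  then have "inv y \<otimes> x = x \<otimes> inv y"
    using * by (metis inv_closed inv_solve_left' inv_solve_right m_assoc m_closed)
  then show ?thesis using lifts_commuteI[of x "inv y"] * by simp
qed

lemma lifts_commute_pow:
  assumes "g \<in> carrier G" "h \<in> carrier G" "lifts_commute K p g h"
  shows "lifts_commute K p g (h [^]\<^bsub>G\<^esub> (n::nat))"
proof (induction n)
  case 0
  obtain x where "x \<in> carrier K" "p x = g" using assms(1) obtain_lift by metis
  then show ?case using lifts_commuteI[of x \<one>] by simp
next
  case (Suc n)
  then show ?case using assms by (simp add: lifts_commute_mult)
qed

lemma lifts_commute_refl_pow:
  assumes "g \<in> carrier G"
  shows "lifts_commute K p g (g [^]\<^bsub>G\<^esub> (n::nat))"
proof -
  obtain x where "x \<in> carrier K" "p x = g" using assms(1) obtain_lift by metis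
  then have "lifts_commute K p g g" using lifts_commuteI[of x x] by simp
  then show ?thesis using assms by (simp add: lifts_commute_pow)
qed

lemma lifts_commute_conj:
  assumes "g \<in> carrier G" "h \<in> carrier G" "k \<in> carrier G" "lifts_commute K p g h"
  shows "lifts_commute K p (k \<otimes>\<^bsub>G\<^esub> g \<otimes>\<^bsub>G\<^esub> inv\<^bsub>G\<^esub> k) (k \<otimes>\<^bsub>G\<^esub> h \<otimes>\<^bsub>G\<^esub> inv\<^bsub>G\<^esub> k)"
proof -
  obtain x y z where *: "x \<in> carrier K" "p x = g" "y \<in> carrier K" "p y = h"
      "z \<in> carrier K" "p z = k"
    using assms(1-3) obtain_lift by metis
  then have c: "x \<otimes> y = y \<otimes> x" using assms(4) unfolding lifts_commute_def by blast
  have "(z \<otimes> a \<otimes> inv z) \<otimes> (z \<otimes> b \<otimes> inv z) = z \<otimes> (a \<otimes> b) \<otimes> inv z"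
    if "a \<in> carrier K" "b \<in> carrier K" for a b
    using that * by (simp add: m_assoc mult_inv_cancel)
  then have "(z \<otimes> x \<otimes> inv z) \<otimes> (z \<otimes> y \<otimes> inv z) = (z \<otimes> y \<otimes> inv z) \<otimes> (z \<otimes> x \<otimes> inv z)"
    using * c by metis
  then show ?thesis using lifts_commuteI[of "z \<otimes> x \<otimes> inv z" "z \<otimes> y \<otimes> inv z"] *
    by (simp add: image_simps)
qed

definition commutator where "commutator x y = x \<otimes> y \<otimes> inv x \<otimes> inv y"

lemma commutator_closed [simp]:
  "\<lbrakk>x \<in> carrier K; y \<in> carrier K\<rbrakk> \<Longrightarrow> commutator x y \<in> carrier K"
  by (simp add: commutator_def)

lemma commutator_swap:
  "\<lbrakk>x \<in> carrier K; y \<in> carrier K\<rbrakk> \<Longrightarrow> x \<otimes> y = commutator x y \<otimes> (y \<otimes> x)"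
  unfolding commutator_def by (simp add: m_assoc mult_inv_cancel)

lemma commutator_kernel:
  assumes "x \<in> carrier K" "y \<in> carrier K" "p x \<otimes>\<^bsub>G\<^esub> p y = p y \<otimes>\<^bsub>G\<^esub> p x"
  shows "p (commutator x y) = \<one>\<^bsub>G\<^esub>"
proof -
  have "p (commutator x y) = p y \<otimes>\<^bsub>G\<^esub> p x \<otimes>\<^bsub>G\<^esub> inv\<^bsub>G\<^esub> p x \<otimes>\<^bsub>G\<^esub> inv\<^bsub>G\<^esub> p y"
    using assms by (simp add: commutator_def image_simps)
  then show ?thesis using assms by (simp add: G.m_assoc)
qed

lemma commutator_one_iff:
  assumes "x \<in> carrier K" "y \<in> carrier K"
  shows "commutator x y = \<one> \<longleftrightarrow> x \<otimes> y = y \<otimes> x"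
proof
  assume "commutator x y = \<one>"
  then show "x \<otimes> y = y \<otimes> x" using assms commutator_swap[OF assms] by simp
next
  assume "x \<otimes> y = y \<otimes> x"
  then show "commutator x y = \<one>" using assms by (simp add: commutator_def m_assoc mult_inv_cancel)
qed

text \<open>The commutator of lifts of commuting elements lies in the kernel, hence is central, and a copy of
  it appears each time \<open>y\<close> is moved past one factor \<open>x\<close>. Consequently the order of this commutator
  divides the orders of both elements; this is how coprime orders make lifts commute.\<close>

lemma pow_commute_twist:
  assumes "x \<in> carrier K" "y \<in> carrier K" "p x \<otimes>\<^bsub>G\<^esub> p y = p y \<otimes>\<^bsub>G\<^esub> p x"
  shows "x [^] (n::nat) \<otimes> y = commutator x y [^] n \<otimes> (y \<otimes> x [^] n)"
proof (induction n)
  case 0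
  then show ?case using assms by simp
next
  case (Suc n)
  let ?c = "commutator x y"
  have c: "?c \<in> carrier K" "\<And>w. w \<in> carrier K \<Longrightarrow> ?c \<otimes> w = w \<otimes> ?c"
    using assms kernel_central commutator_kernel by auto
  have "x [^] Suc n \<otimes> y = x [^] n \<otimes> (?c \<otimes> (y \<otimes> x))"
    using assms commutator_swap[of x y] by (simp add: m_assoc)
  also have "\<dots> = ?c \<otimes> (x [^] n \<otimes> y) \<otimes> x"
    using assms c by (metis m_assoc m_closed nat_pow_closed)
  also have "\<dots> = (?c \<otimes> ?c [^] n) \<otimes> (y \<otimes> (x [^] n \<otimes> x))"
    unfolding Suc using assms(1,2) by (simp add: m_assoc)
  also have "\<dots> = ?c [^] Suc n \<otimes> (y \<otimes> x [^] Suc n)"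
    using c by simp
  finally show ?case .
qed

lemma commutator_pow:
  assumes "x \<in> carrier K" "y \<in> carrier K" "p x \<otimes>\<^bsub>G\<^esub> p y = p y \<otimes>\<^bsub>G\<^esub> p x"
    and "p x [^]\<^bsub>G\<^esub> (n::nat) = \<one>\<^bsub>G\<^esub>"
  shows "commutator x y [^] n = \<one>"
proof -
  have "p (x [^] n) = \<one>\<^bsub>G\<^esub>" using assms by (simp add: image_simps)
  then have "x [^] n \<otimes> y = y \<otimes> x [^] n" using kernel_central assms by simp
  then have "commutator x y [^] n \<otimes> (y \<otimes> x [^] n) = y \<otimes> x [^] n"
    using pow_commute_twist[OF assms(1-3), of n] by simp
  then show ?thesis using assms by (simp add: r_cancel_one)
qed

lemma lifts_commute_no_torsion:
  assumes "g \<in> carrier G" "h \<in> carrier G" "g \<otimes>\<^bsub>G\<^esub> h = h \<otimes>\<^bsub>G\<^esub> g"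
    and "g [^]\<^bsub>G\<^esub> (n::nat) = \<one>\<^bsub>G\<^esub>"
    and "\<And>x y. \<lbrakk>x \<in> carrier K; y \<in> carrier K; p (commutator x y) = \<one>\<^bsub>G\<^esub>;
            commutator x y [^] n = \<one>\<rbrakk> \<Longrightarrow> commutator x y = \<one>"
  shows "lifts_commute K p g h"
proof -
  obtain x y where *: "x \<in> carrier K" "p x = g" "y \<in> carrier K" "p y = h"
    using assms(1-2) obtain_lift by metis
  have "p (commutator x y) = \<one>\<^bsub>G\<^esub>" "commutator x y [^] n = \<one>"
    using commutator_kernel[OF *(1,3)] commutator_pow[OF *(1,3)] unfolding *(2,4)
    using assms(3,4) by blast+
  then have "commutator x y = \<one>" by (rule assms(5)[OF *(1,3)])
  then show ?thesis using * lifts_commuteI[of x y] commutator_one_iff by simp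
qed

lemma coprime_pow_one:
  assumes "c \<in> carrier K" "c [^] (m::nat) = \<one>" "c [^] (n::nat) = \<one>" "coprime m n"
  shows "c = \<one>"
proof -
  have "ord c dvd m" "ord c dvd n" using assms by (simp_all add: pow_eq_id)
  then have "ord c = 1" using assms(4) by (metis coprime_common_divisor_nat nat_dvd_1_iff_1 coprime_def)
  then show ?thesis using assms(1) by (metis nat_pow_eone pow_ord_eq_1)
qed

lemma lifts_commute_coprime:
  assumes gh: "g \<in> carrier G" "h \<in> carrier G" "g \<otimes>\<^bsub>G\<^esub> h = h \<otimes>\<^bsub>G\<^esub> g"
    and pow: "g [^]\<^bsub>G\<^esub> (m::nat) = \<one>\<^bsub>G\<^esub>" "h [^]\<^bsub>G\<^esub> (n::nat) = \<one>\<^bsub>G\<^esub>" and "coprime m n"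
  shows "lifts_commute K p g h"
proof -
  obtain x y where *: "x \<in> carrier K" "p x = g" "y \<in> carrier K" "p y = h"
    using gh obtain_lift by metis
  have c: "commutator x y \<in> carrier K" "p (commutator x y) = \<one>\<^bsub>G\<^esub>"
    using commutator_kernel[OF *(1,3)] commutator_closed[OF *(1,3)] unfolding *(2,4) using gh(3) by blast+
  have 1: "commutator x y [^] m = \<one>" using commutator_pow[OF *(1,3)] unfolding *(2,4) using gh(3) pow(1) by blast
  have "inv (commutator x y) = commutator y x"
    using * by (simp add: commutator_def inv_mult_group m_assoc mult_inv_cancel)
  then have "inv (commutator x y) [^] n = \<one>" using commutator_pow[OF *(3,1)] unfolding *(2,4) using gh(3) pow(2) by simp
  then have "commutator x y [^] n = \<one>"
    using * by (metis c(1) inv_eq_1_iff nat_pow_closed nat_pow_inv)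
  then have "commutator x y = \<one>" using 1 coprime_pow_one c assms(6) by blast
  then show ?thesis using * lifts_commuteI[of x y] commutator_one_iff by simp
qed

text \<open>Lift one representative of each class and transport the lift by conjugation. The result does not
  depend on the conjugating element, because two choices differ by an element of the centralizer.\<close>

lemma equivariant_section:
  assumes sub: "C \<subseteq> carrier G"
    and closed: "\<And>g h. \<lbrakk>g \<in> C; h \<in> carrier G\<rbrakk> \<Longrightarrow> h \<otimes>\<^bsub>G\<^esub> g \<otimes>\<^bsub>G\<^esub> inv\<^bsub>G\<^esub> h \<in> C"
    and comm: "\<And>g h. \<lbrakk>g \<in> C; h \<in> carrier G; g \<otimes>\<^bsub>G\<^esub> h = h \<otimes>\<^bsub>G\<^esub> g\<rbrakk> \<Longrightarrow> lifts_commute K p g h"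
  obtains s where "\<And>g. g \<in> C \<Longrightarrow> s g \<in> carrier K" "\<And>g. g \<in> C \<Longrightarrow> p (s g) = g"
    "\<And>g x. \<lbrakk>g \<in> C; x \<in> carrier K\<rbrakk> \<Longrightarrow> x \<otimes> s g \<otimes> inv x = s (p x \<otimes>\<^bsub>G\<^esub> g \<otimes>\<^bsub>G\<^esub> inv\<^bsub>G\<^esub> p x)"
proof -
  define rep where "rep g = (SOME r. r \<in> conj_class G g)" for g
  define lift where "lift g = (SOME x. x \<in> carrier K \<and> p x = g)" for g
  define via where
    "via g = (SOME x. x \<in> carrier K \<and> p x \<otimes>\<^bsub>G\<^esub> rep g \<otimes>\<^bsub>G\<^esub> inv\<^bsub>G\<^esub> p x = g)" for g
  define s where "s g = via g \<otimes> lift (rep g) \<otimes> inv via g" for g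
  have class_eq: "conj_class G (h \<otimes>\<^bsub>G\<^esub> g \<otimes>\<^bsub>G\<^esub> inv\<^bsub>G\<^esub> h) = conj_class G g"
    if "g \<in> carrier G" "h \<in> carrier G" for g h
  proof -
    have 1: "conj_class G (h \<otimes>\<^bsub>G\<^esub> g \<otimes>\<^bsub>G\<^esub> inv\<^bsub>G\<^esub> h) \<subseteq> conj_class G g"
      if "g \<in> carrier G" "h \<in> carrier G" for g h
    proof
      fix x assume "x \<in> conj_class G (h \<otimes>\<^bsub>G\<^esub> g \<otimes>\<^bsub>G\<^esub> inv\<^bsub>G\<^esub> h)"
      then obtain k where k: "k \<in> carrier G" "x = k \<otimes>\<^bsub>G\<^esub> (h \<otimes>\<^bsub>G\<^esub> g \<otimes>\<^bsub>G\<^esub> inv\<^bsub>G\<^esub> h) \<otimes>\<^bsub>G\<^esub> inv\<^bsub>G\<^esub> k"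
        by (auto simp: conj_class_def)
      then have "x = (k \<otimes>\<^bsub>G\<^esub> h) \<otimes>\<^bsub>G\<^esub> g \<otimes>\<^bsub>G\<^esub> inv\<^bsub>G\<^esub> (k \<otimes>\<^bsub>G\<^esub> h)"
        using that by (simp add: G.inv_mult_group G.m_assoc)
      then show "x \<in> conj_class G g" using k that unfolding conj_class_def by blast
    qed
    have "g = inv\<^bsub>G\<^esub> h \<otimes>\<^bsub>G\<^esub> (h \<otimes>\<^bsub>G\<^esub> g \<otimes>\<^bsub>G\<^esub> inv\<^bsub>G\<^esub> h) \<otimes>\<^bsub>G\<^esub> inv\<^bsub>G\<^esub> (inv\<^bsub>G\<^esub> h)"
      using that by (simp add: G.m_assoc G.mult_inv_cancel)
    then have "conj_class G g \<subseteq> conj_class G (h \<otimes>\<^bsub>G\<^esub> g \<otimes>\<^bsub>G\<^esub> inv\<^bsub>G\<^esub> h)"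
      using 1[of "h \<otimes>\<^bsub>G\<^esub> g \<otimes>\<^bsub>G\<^esub> inv\<^bsub>G\<^esub> h" "inv\<^bsub>G\<^esub> h"] that by auto
    then show ?thesis using 1 that by blast
  qed
  have rep: "\<exists>x. x \<in> carrier K \<and> p x \<otimes>\<^bsub>G\<^esub> rep g \<otimes>\<^bsub>G\<^esub> inv\<^bsub>G\<^esub> p x = g" "rep g \<in> C" if g: "g \<in> C" for g
  proof -
    have gG: "g \<in> carrier G" using g sub by blast
    then have "\<one>\<^bsub>G\<^esub> \<otimes>\<^bsub>G\<^esub> g \<otimes>\<^bsub>G\<^esub> inv\<^bsub>G\<^esub> \<one>\<^bsub>G\<^esub> \<in> conj_class G g" unfolding conj_class_def by blast
    then have "rep g \<in> conj_class G g" unfolding rep_def by (metis someI)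
    then obtain h where h: "h \<in> carrier G" "rep g = h \<otimes>\<^bsub>G\<^esub> g \<otimes>\<^bsub>G\<^esub> inv\<^bsub>G\<^esub> h"
      by (auto simp: conj_class_def)
    then show "rep g \<in> C" using closed g by simp
    have "inv\<^bsub>G\<^esub> h \<otimes>\<^bsub>G\<^esub> rep g \<otimes>\<^bsub>G\<^esub> inv\<^bsub>G\<^esub> (inv\<^bsub>G\<^esub> h) = g"
      using h gG by (simp add: G.m_assoc G.mult_inv_cancel)
    then show "\<exists>x. x \<in> carrier K \<and> p x \<otimes>\<^bsub>G\<^esub> rep g \<otimes>\<^bsub>G\<^esub> inv\<^bsub>G\<^esub> p x = g"
      using obtain_lift[of "inv\<^bsub>G\<^esub> h"] h by (metis G.inv_closed)
  qed
  have via: "via g \<in> carrier K" "p (via g) \<otimes>\<^bsub>G\<^esub> rep g \<otimes>\<^bsub>G\<^esub> inv\<^bsub>G\<^esub> p (via g) = g" if "g \<in> C" for g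
    using someI_ex[OF rep(1)[OF that]] unfolding via_def by blast+
  have lift: "lift (rep g) \<in> carrier K" "p (lift (rep g)) = rep g" if "g \<in> C" for g
  proof -
    have "\<exists>x. x \<in> carrier K \<and> p x = rep g" using rep(2)[OF that] sub obtain_lift by blast
    from someI_ex[OF this] show "lift (rep g) \<in> carrier K" "p (lift (rep g)) = rep g"
      unfolding lift_def by blast+
  qed
  have s: "s g \<in> carrier K" "p (s g) = g" if "g \<in> C" for g
    using via[OF that] lift[OF that] by (simp_all add: s_def image_simps)
  have "x \<otimes> s g \<otimes> inv x = s (p x \<otimes>\<^bsub>G\<^esub> g \<otimes>\<^bsub>G\<^esub> inv\<^bsub>G\<^esub> p x)" if g: "g \<in> C" and x: "x \<in> carrier K" for g x
  proof -
    let ?g = "p x \<otimes>\<^bsub>G\<^esub> g \<otimes>\<^bsub>G\<^esub> inv\<^bsub>G\<^esub> p x"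
    have gG: "g \<in> carrier G" using g sub by blast
    have g': "?g \<in> C" using closed g x by simp
    have r: "rep ?g = rep g" using class_eq[OF gG] x unfolding rep_def by simp
    define v where "v = inv (via ?g) \<otimes> (x \<otimes> via g)"
    have v: "v \<in> carrier K" using via(1)[OF g] via(1)[OF g'] x by (simp add: v_def)
    have rG: "rep g \<in> carrier G" using rep(2)[OF g] sub by blast
    \<comment> \<open>Two ways of conjugating the representative to the same element differ by an element of
      its centralizer, and the lifts of that element commute with the lift of the representative.\<close>
    have "p (x \<otimes> via g) \<otimes>\<^bsub>G\<^esub> rep g \<otimes>\<^bsub>G\<^esub> inv\<^bsub>G\<^esub> p (x \<otimes> via g)
        = p x \<otimes>\<^bsub>G\<^esub> (p (via g) \<otimes>\<^bsub>G\<^esub> rep g \<otimes>\<^bsub>G\<^esub> inv\<^bsub>G\<^esub> p (via g)) \<otimes>\<^bsub>G\<^esub> inv\<^bsub>G\<^esub> p x"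
      using x via(1)[OF g] rG by (simp add: G.inv_mult_group G.m_assoc)
    also have "\<dots> = p (via ?g) \<otimes>\<^bsub>G\<^esub> rep g \<otimes>\<^bsub>G\<^esub> inv\<^bsub>G\<^esub> p (via ?g)"
      unfolding via(2)[OF g] using via(2)[OF g'] unfolding r by (rule HOL.sym)
    finally have "rep g \<otimes>\<^bsub>G\<^esub> p v = p v \<otimes>\<^bsub>G\<^esub> rep g"
      using G.conj_quotient_commutes[of "p (x \<otimes> via g)" "p (via ?g)" "rep g"]
        x via(1)[OF g] via(1)[OF g'] rG unfolding v_def by simp
    then have "lifts_commute K p (rep g) (p v)"
      using comm[OF rep(2)[OF g]] v by simp
    then have c: "lift (rep g) \<otimes> v = v \<otimes> lift (rep g)"
      using lift[OF g] v unfolding lifts_commute_def by blast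
    have xv: "x \<otimes> via g = via ?g \<otimes> v"
      unfolding v_def using x via(1)[OF g] via(1)[OF g'] by (simp add: m_assoc[symmetric])
    have "x \<otimes> s g \<otimes> inv x = (x \<otimes> via g) \<otimes> lift (rep g) \<otimes> inv (x \<otimes> via g)"
      unfolding s_def using x via(1)[OF g] lift(1)[OF g] by (simp add: m_assoc inv_mult_group)
    also have "\<dots> = via ?g \<otimes> (v \<otimes> lift (rep g)) \<otimes> inv v \<otimes> inv (via ?g)"
      unfolding xv using v via(1)[OF g'] lift(1)[OF g] by (simp add: m_assoc inv_mult_group)
    also have "\<dots> = via ?g \<otimes> lift (rep g) \<otimes> inv (via ?g)"
      unfolding c[symmetric] using v via(1)[OF g'] lift(1)[OF g] by (simp add: m_assoc)
    finally show ?thesis unfolding s_def r .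
  qed
  with s show ?thesis using that by blast
qed

end

section \<open>The group of an equipment\<close>

definition word_image :: "('h, 'm) monoid_scheme \<Rightarrow> ('a \<Rightarrow> 'h) \<Rightarrow> 'a letters \<Rightarrow> 'h" where
  "word_image H s w = word_value H (map (apfst s) w)"

lemma (in group) word_image_append:
  assumes "s ` S \<subseteq> carrier G" "u \<in> words S" "v \<in> words S"
  shows "word_image G s (u @ v) = word_image G s u \<otimes> word_image G s v"
proof -
  have "map (apfst s) w \<in> words (s ` S)" if "w \<in> words S" for w
    using that by (induction w) auto
  then show ?thesis
    using word_value_append[OF assms(1)] assms(2,3) by (simp add: word_image_def)
qed

lemma (in group) word_image_closed:
  assumes "s ` S \<subseteq> carrier G" "w \<in> words S"
  shows "word_image G s w \<in> carrier G"
proof -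
  have "map (apfst s) w \<in> words (s ` S)"
    using assms(2) by (induction w) auto
  then show ?thesis using word_value_closed[OF assms(1)] by (simp add: word_image_def)
qed

lemma (in group) presented_group_universal:
  assumes R: "R \<subseteq> words S \<times> words S" and s: "s ` S \<subseteq> carrier G"
    and rels: "\<And>l r. (l, r) \<in> R \<Longrightarrow> word_image G s l = word_image G s r"
  obtains \<phi> where "\<phi> \<in> hom (presented_group S R) G"
    "\<And>w. w \<in> words S \<Longrightarrow> \<phi> (pres_class S R w) = word_image G s w"
proof -
  let ?v = "word_image G s"
  note app = word_image_append[OF s] and closed = word_image_closed[OF s]
  have eq: "?v u = ?v v" if "pres_eq S R u v" for u v
    using that
  proof induction
    case (cancel u v a b)
    have "s a \<in> carrier G" using cancel s by blast
    then have "?v [(a, b), (a, \<not> b)] = \<one>" by (simp add: word_image_def)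
    moreover have "[(a, b), (a, \<not> b)] \<in> words S" using cancel(3) by simp
    ultimately show ?case using cancel(1,2) by (simp add: app closed del: append_Cons)
  next
    case (relation u v l r)
    moreover have "l \<in> words S" "r \<in> words S" using R relation(3) by auto
    ultimately show ?case using rels[of l r] by (simp add: app)
  qed auto
  define \<phi> where "\<phi> X = the_elem (?v ` X)" for X
  have val: "\<phi> (pres_class S R w) = ?v w" if "w \<in> words S" for w
  proof -
    have "?v ` pres_class S R w = {?v w}"
      using that eq by (fastforce simp: pres_class_def intro: pres_eq.refl)
    then show ?thesis by (simp add: \<phi>_def)
  qed
  have car: "carrier (presented_group S R) = pres_class S R ` words S"
    by (simp add: presented_group_def)
  have "\<phi> \<in> hom (presented_group S R) G"
  proof (rule homI)
    show "\<phi> x \<in> carrier G" if "x \<in> carrier (presented_group S R)" for x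
      using that val closed unfolding car by auto
    show "\<phi> (x \<otimes>\<^bsub>presented_group S R\<^esub> y) = \<phi> x \<otimes> \<phi> y"
      if "x \<in> carrier (presented_group S R)" "y \<in> carrier (presented_group S R)" for x y
      using that unfolding car by (auto simp: presented_group_mult[OF R] val app)
  qed
  with val show ?thesis using that by blast
qed

locale equipped_group = group G for G (structure) +
  fixes E
  assumes equipment: "equipment G E"
begin

lemma sub: "E \<subseteq> carrier G"
  using equipment_subset[OF equipment] .

abbreviation "Y \<equiv> tilde_group G E"
abbreviation "cls w \<equiv> pres_class E (equipment_rels G E) w"

sublocale Y: group "tilde_group G E"
  by (rule tilde_group_group[OF equipment])

lemma carrier_tilde: "carrier Y = pres_class E (equipment_rels G E) ` words E"
  by (simp add: tilde_group_def presented_group_def)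

lemma cls_mult:
  "\<lbrakk>u \<in> words E; v \<in> words E\<rbrakk> \<Longrightarrow> cls u \<otimes>\<^bsub>Y\<^esub> cls v = cls (u @ v)"
  unfolding tilde_group_def by (rule presented_group_mult[OF equipment_rels_words[OF equipment]])

lemma cls_Nil: "cls [] = \<one>\<^bsub>Y\<^esub>"
  by (simp add: tilde_group_def presented_group_def)

lemma cls_closed: "w \<in> words E \<Longrightarrow> cls w \<in> carrier Y"
  by (simp add: carrier_tilde)

lemma cls_True: "cls [(g, True)] = y_gen G E g"
  by (simp add: y_gen_def y_letter_def)

lemma y_gen_closed: "g \<in> E \<Longrightarrow> y_gen G E g \<in> carrier Y"
  using cls_closed[of "[(g, True)]"] by (simp add: cls_True)

lemma cls_False:
  assumes "g \<in> E"
  shows "cls [(g, False)] = inv\<^bsub>Y\<^esub> y_gen G E g"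
proof -
  have "pres_eq E (equipment_rels G E) ([] @ [(g, False), (g, \<not> False)] @ []) ([] @ [])"
    using assms by (intro pres_eq.cancel) auto
  then have "cls [(g, False), (g, True)] = cls []"
    using assms by (simp add: pres_class_eq_iff)
  then have "cls [(g, False)] \<otimes>\<^bsub>Y\<^esub> cls [(g, True)] = \<one>\<^bsub>Y\<^esub>"
    using assms by (simp add: cls_mult cls_Nil)
  then show ?thesis
    using Y.inv_equality cls_closed[of "[(g, False)]"] y_gen_closed[OF assms] assms
    by (simp add: cls_True)
qed

lemma y_gen_relation:
  assumes "g \<in> E" "h \<in> E"
  shows "y_gen G E g \<otimes>\<^bsub>Y\<^esub> y_gen G E h = y_gen G E h \<otimes>\<^bsub>Y\<^esub> y_gen G E (inv h \<otimes> g \<otimes> h)"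
    and "y_gen G E g \<otimes>\<^bsub>Y\<^esub> y_gen G E h = y_gen G E (g \<otimes> h \<otimes> inv g) \<otimes>\<^bsub>Y\<^esub> y_gen G E g"
proof -
  have *: "cls l = cls r" if "(l, r) \<in> equipment_rels G E" for l r
  proof -
    have "l \<in> words E" using that equipment_rels_words[OF equipment] by blast
    then show ?thesis
      using pres_eq.relation[of "[]" E "[]" l r "equipment_rels G E"] that
      by (simp add: pres_class_eq_iff)
  qed
  have c1: "g \<otimes> h \<otimes> inv g \<in> E" using equipment_conj_closed[OF equipment assms(2)] assms(1) sub by blast
  have "h \<in> carrier G" using assms sub by blast
  then have c2: "inv h \<otimes> g \<otimes> h \<in> E" using equipment_conj_closed[OF equipment assms(1), of "inv h"] by simp
  have "([y_letter g, y_letter h], [y_letter h, y_letter (inv h \<otimes> g \<otimes> h)]) \<in> equipment_rels G E"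
    "([y_letter g, y_letter h], [y_letter (g \<otimes> h \<otimes> inv g), y_letter g]) \<in> equipment_rels G E"
    using assms unfolding equipment_rels_def by blast+
  note this[THEN *, unfolded y_letter_def]
  moreover have "cls [(a, True), (b, True)] = y_gen G E a \<otimes>\<^bsub>Y\<^esub> y_gen G E b"
    if "a \<in> E" "b \<in> E" for a b
    using cls_mult[of "[(a, True)]" "[(b, True)]"] that by (simp add: cls_True)
  ultimately show "y_gen G E g \<otimes>\<^bsub>Y\<^esub> y_gen G E h = y_gen G E h \<otimes>\<^bsub>Y\<^esub> y_gen G E (inv h \<otimes> g \<otimes> h)"
    "y_gen G E g \<otimes>\<^bsub>Y\<^esub> y_gen G E h = y_gen G E (g \<otimes> h \<otimes> inv g) \<otimes>\<^bsub>Y\<^esub> y_gen G E g"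
    using assms c1 c2 by simp_all
qed

lemma beta_cls: "w \<in> words E \<Longrightarrow> beta G (cls w) = word_value G w"
  by (rule beta_class[OF equipment])

sublocale b: group_hom Y G "beta G"
  using beta_hom[OF equipment] by (simp add: group_hom_def group_hom_axioms_def is_group Y.is_group)

text \<open>By induction on a word for \<open>x\<close>: the second family of relations handles a generator, the first one
  the inverse of a generator.\<close>

lemma conj_y_gen:
  assumes "x \<in> carrier Y" "g \<in> E"
  shows "x \<otimes>\<^bsub>Y\<^esub> y_gen G E g = y_gen G E (beta G x \<otimes> g \<otimes> inv beta G x) \<otimes>\<^bsub>Y\<^esub> x"
proof -
  obtain w where w: "w \<in> words E" "x = cls w" using assms(1) by (auto simp: carrier_tilde)
  have "cls w \<otimes>\<^bsub>Y\<^esub> y_gen G E g =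
      y_gen G E (word_value G w \<otimes> g \<otimes> inv word_value G w) \<otimes>\<^bsub>Y\<^esub> cls w"
    using w(1)
  proof (induction w)
    case Nil
    have "g \<in> carrier G" using assms(2) sub by blast
    then show ?case using y_gen_closed[OF assms(2)] by (simp add: cls_Nil)
  next
    case (Cons l w)
    obtain a b where l: "l = (a, b)" by (cases l)
    have a: "a \<in> E" and w: "w \<in> words E" using Cons.prems l by auto
    have aG: "a \<in> carrier G" "g \<in> carrier G" using a assms(2) sub by auto
    let ?v = "word_value G w" and ?y = "y_gen G E"
    let ?h = "?v \<otimes> g \<otimes> inv ?v"
    have v: "?v \<in> carrier G" using word_value_closed[OF sub w] .
    have h: "?h \<in> E" using equipment_conj_closed[OF equipment assms(2) v] .
    have hG: "?h \<in> carrier G" using h sub by blast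
    have split: "cls (l # w) = cls [l] \<otimes>\<^bsub>Y\<^esub> cls w"
      using cls_mult[of "[l]" w] Cons.prems w by simp
    define k where "k = (if b then a else inv a)"
    have k: "k \<in> carrier G" using aG by (simp add: k_def)
    have val: "word_value G (l # w) = k \<otimes> ?v" by (simp add: l k_def)
    have kh: "k \<otimes> ?v \<otimes> g \<otimes> inv (k \<otimes> ?v) = k \<otimes> ?h \<otimes> inv k"
      using k v aG by (simp add: inv_mult_group m_assoc)
    have khE: "k \<otimes> ?h \<otimes> inv k \<in> E" using equipment_conj_closed[OF equipment h k] .
    have lY: "cls [l] \<in> carrier Y" "cls w \<in> carrier Y"
      using Cons.prems w by (auto intro!: cls_closed)
    have step: "cls [l] \<otimes>\<^bsub>Y\<^esub> ?y ?h = ?y (k \<otimes> ?h \<otimes> inv k) \<otimes>\<^bsub>Y\<^esub> cls [l]"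
    proof (cases b)
      case True
      then show ?thesis using y_gen_relation(2)[OF a h] by (simp add: l cls_True k_def)
    next
      case False
      have "?y a \<otimes>\<^bsub>Y\<^esub> ?y (inv a \<otimes> ?h \<otimes> a) = ?y ?h \<otimes>\<^bsub>Y\<^esub> ?y a"
        using y_gen_relation(1)[OF h a] by simp
      moreover have "inv a \<otimes> ?h \<otimes> a \<in> E" using khE False aG by (simp add: k_def)
      ultimately have "?y (inv a \<otimes> ?h \<otimes> a) \<otimes>\<^bsub>Y\<^esub> inv\<^bsub>Y\<^esub> ?y a = inv\<^bsub>Y\<^esub> ?y a \<otimes>\<^bsub>Y\<^esub> ?y ?h"
        using y_gen_closed[OF a] y_gen_closed[OF h] y_gen_closed
        by (metis Y.inv_closed Y.inv_solve_left Y.inv_solve_right' Y.m_assoc Y.m_closed)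
      then show ?thesis using False a aG by (simp add: l cls_False k_def)
    qed
    have "cls (l # w) \<otimes>\<^bsub>Y\<^esub> ?y g = cls [l] \<otimes>\<^bsub>Y\<^esub> (?y ?h \<otimes>\<^bsub>Y\<^esub> cls w)"
      unfolding split using Cons.IH[OF w] lY y_gen_closed[OF assms(2)] by (simp add: Y.m_assoc)
    also have "\<dots> = (?y (k \<otimes> ?h \<otimes> inv k) \<otimes>\<^bsub>Y\<^esub> cls [l]) \<otimes>\<^bsub>Y\<^esub> cls w"
      unfolding step[symmetric] using lY y_gen_closed[OF h] by (simp add: Y.m_assoc)
    also have "\<dots> = ?y (k \<otimes> ?h \<otimes> inv k) \<otimes>\<^bsub>Y\<^esub> cls (l # w)"
      unfolding split using lY y_gen_closed[OF khE] by (simp add: Y.m_assoc)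
    finally show ?case unfolding val kh .
  qed
  then show ?thesis using w beta_cls by simp
qed

lemma commutes_with_generators_imp_central:
  assumes z: "z \<in> carrier Y" and comm: "\<And>g. g \<in> E \<Longrightarrow> z \<otimes>\<^bsub>Y\<^esub> y_gen G E g = y_gen G E g \<otimes>\<^bsub>Y\<^esub> z"
    and x: "x \<in> carrier Y"
  shows "z \<otimes>\<^bsub>Y\<^esub> x = x \<otimes>\<^bsub>Y\<^esub> z"
proof -
  obtain w where w: "w \<in> words E" "x = cls w" using x by (auto simp: carrier_tilde)
  have "z \<otimes>\<^bsub>Y\<^esub> cls w = cls w \<otimes>\<^bsub>Y\<^esub> z" using w(1)
  proof (induction w)
    case Nil
    then show ?case using z by (simp add: cls_Nil)
  next
    case (Cons l w)
    obtain a b where l: "l = (a, b)" by (cases l)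
    have a: "a \<in> E" and w: "w \<in> words E" using Cons.prems l by auto
    have lY: "cls [l] \<in> carrier Y" "cls w \<in> carrier Y"
      using Cons.prems w by (auto intro!: cls_closed)
    have "z \<otimes>\<^bsub>Y\<^esub> cls [l] = cls [l] \<otimes>\<^bsub>Y\<^esub> z"
    proof (cases b)
      case True
      then show ?thesis using comm[OF a] by (simp add: l cls_True)
    next
      case False
      have "z \<otimes>\<^bsub>Y\<^esub> inv\<^bsub>Y\<^esub> y_gen G E a = inv\<^bsub>Y\<^esub> y_gen G E a \<otimes>\<^bsub>Y\<^esub> z"
        using comm[OF a] z y_gen_closed[OF a]
        by (metis Y.inv_closed Y.inv_solve_left Y.inv_solve_right' Y.m_assoc Y.m_closed)
      then show ?thesis using False a by (simp add: l cls_False)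
    qed
    then have "z \<otimes>\<^bsub>Y\<^esub> (cls [l] \<otimes>\<^bsub>Y\<^esub> cls w) = (cls [l] \<otimes>\<^bsub>Y\<^esub> cls w) \<otimes>\<^bsub>Y\<^esub> z"
      using Cons.IH[OF w] lY z by (metis Y.m_assoc)
    then show ?case using cls_mult[of "[l]" w] Cons.prems w by simp
  qed
  then show ?thesis using w by simp
qed

text \<open>An element of the kernel conjugates each generator to itself.\<close>

sublocale b: central_extension Y G "beta G"
proof
  show "beta G \<in> hom Y G" by (rule beta_hom[OF equipment])
  have "E \<subseteq> beta G ` carrier Y"
  proof
    fix g assume "g \<in> E"
    then show "g \<in> beta G ` carrier Y"
      using beta_y_gen[OF equipment] y_gen_closed by (metis imageI)
  qed
  then have "generate G E \<subseteq> beta G ` carrier Y"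
    by (rule generate_subgroup_incl) (rule b.img_is_subgroup)
  then show "beta G ` carrier Y = carrier G"
    using equipment unfolding equipment_def by auto
next
  fix z x assume z: "z \<in> carrier Y" "beta G z = \<one>" and x: "x \<in> carrier Y"
  have "z \<otimes>\<^bsub>Y\<^esub> y_gen G E g = y_gen G E g \<otimes>\<^bsub>Y\<^esub> z" if "g \<in> E" for g
  proof -
    have "g \<in> carrier G" using that sub by blast
    then show ?thesis using conj_y_gen[OF z(1) that] z(2) by simp
  qed
  then show "z \<otimes>\<^bsub>Y\<^esub> x = x \<otimes>\<^bsub>Y\<^esub> z"
    by (rule commutes_with_generators_imp_central[OF z(1) _ x])
qed

lemma tilde_lifts_commute:
  assumes "g \<in> E" "h \<in> carrier G" "g \<otimes> h = h \<otimes> g"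
  shows "lifts_commute Y (beta G) g h"
proof -
  obtain x where x: "x \<in> carrier Y" "beta G x = h" using b.obtain_lift[OF assms(2)] .
  have "g \<in> carrier G" using assms(1) sub by blast
  then have "h \<otimes> g \<otimes> inv h = g" using assms(2,3) by (metis inv_solve_right' m_closed)
  then have "x \<otimes>\<^bsub>Y\<^esub> y_gen G E g = y_gen G E g \<otimes>\<^bsub>Y\<^esub> x"
    using conj_y_gen[OF x(1) assms(1)] x(2) by simp
  then show ?thesis
    using b.lifts_commuteI[OF y_gen_closed[OF assms(1)] x(1)] beta_y_gen[OF equipment assms(1)] x(2)
    by simp
qed

text \<open>Universality of the group of an equipment. The hypothesis on \<open>L\<close> provides an equivariant lift of \<open>E\<close>
  to \<open>L\<close>; equivariance is exactly what the defining relations ask for, so it induces a homomorphism to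
  \<open>L\<close> over \<open>G\<close>, and this carries commuting lifts to commuting lifts.\<close>

lemma lifts_commute_transfer:
  assumes L: "central_extension L G q"
    and comm: "\<And>g h. \<lbrakk>g \<in> E; h \<in> carrier G; g \<otimes> h = h \<otimes> g\<rbrakk> \<Longrightarrow> lifts_commute L q g h"
    and gh: "g \<in> carrier G" "h \<in> carrier G" "lifts_commute Y (beta G) g h"
  shows "lifts_commute L q g h"
proof -
  interpret L: central_extension L G q by (rule L)
  obtain s where s: "\<And>g. g \<in> E \<Longrightarrow> s g \<in> carrier L" "\<And>g. g \<in> E \<Longrightarrow> q (s g) = g"
    "\<And>g x. \<lbrakk>g \<in> E; x \<in> carrier L\<rbrakk> \<Longrightarrow> x \<otimes>\<^bsub>L\<^esub> s g \<otimes>\<^bsub>L\<^esub> inv\<^bsub>L\<^esub> x = s (q x \<otimes> g \<otimes> inv q x)"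
    using L.equivariant_section[OF sub equipment_conj_closed[OF equipment] comm] by blast
  have s': "s ` E \<subseteq> carrier L" using s(1) by blast
  have rels: "word_image L s l = word_image L s r" if lr: "(l, r) \<in> equipment_rels G E" for l r
  proof -
    obtain g h where g: "g \<in> E" "h \<in> E" and l: "l = [(g, True), (h, True)]"
      and r: "r = [(h, True), (inv h \<otimes> g \<otimes> h, True)] \<or> r = [(g \<otimes> h \<otimes> inv g, True), (g, True)]"
      using lr unfolding equipment_rels_def y_letter_def by blast
    have gG: "g \<in> carrier G" "h \<in> carrier G" using g sub by auto
    note sc = s(1)[OF g(1)] s(1)[OF g(2)]
    have "inv\<^bsub>L\<^esub> s h \<otimes>\<^bsub>L\<^esub> s g \<otimes>\<^bsub>L\<^esub> s h = s (inv h \<otimes> g \<otimes> h)"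
      using s(3)[OF g(1), of "inv\<^bsub>L\<^esub> s h"] sc s(2)[OF g(2)] gG by (simp add: L.image_simps)
    moreover have "s g \<otimes>\<^bsub>L\<^esub> s h \<otimes>\<^bsub>L\<^esub> inv\<^bsub>L\<^esub> s g = s (g \<otimes> h \<otimes> inv g)"
      using s(3)[OF g(2), of "s g"] sc s(2)[OF g(1)] by simp
    ultimately show ?thesis
      using r sc unfolding l
      by (auto simp: word_image_def L.m_assoc L.mult_inv_cancel simp flip: \<open>inv\<^bsub>L\<^esub> s h \<otimes>\<^bsub>L\<^esub> s g \<otimes>\<^bsub>L\<^esub> s h = _\<close> \<open>s g \<otimes>\<^bsub>L\<^esub> s h \<otimes>\<^bsub>L\<^esub> inv\<^bsub>L\<^esub> s g = _\<close>)
  qed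
  obtain \<phi> where \<phi>: "\<phi> \<in> hom Y L" "\<And>w. w \<in> words E \<Longrightarrow> \<phi> (cls w) = word_image L s w"
    using L.presented_group_universal[OF equipment_rels_words[OF equipment] s' rels]
    unfolding tilde_group_def by blast
  have q: "q (word_image L s w) = word_value G w" if "w \<in> words E" for w
    using that
  proof (induction w)
    case (Cons l w)
    obtain a b where l: "l = (a, b)" by (cases l)
    have a: "a \<in> E" and w: "w \<in> words E" using Cons.prems l by auto
    have "word_value L (map (apfst s) w) \<in> carrier L"
      using L.word_image_closed[OF s' w] by (simp add: word_image_def)
    then show ?case using Cons.IH[OF w] s(1,2)[OF a] l by (simp add: word_image_def L.image_simps)
  qed (simp add: word_image_def)
  have q\<phi>: "q (\<phi> x) = beta G x" if "x \<in> carrier Y" for x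
    using that by (auto simp: carrier_tilde \<phi>(2) q beta_cls)
  obtain x y where *: "x \<in> carrier Y" "beta G x = g" "y \<in> carrier Y" "beta G y = h"
    using gh(1,2) b.obtain_lift by metis
  then have "x \<otimes>\<^bsub>Y\<^esub> y = y \<otimes>\<^bsub>Y\<^esub> x" using gh(3) unfolding lifts_commute_def by blast
  then have "\<phi> x \<otimes>\<^bsub>L\<^esub> \<phi> y = \<phi> y \<otimes>\<^bsub>L\<^esub> \<phi> x" using hom_mult[OF \<phi>(1)] * by metis
  then show ?thesis
    using L.lifts_commuteI[of "\<phi> x" "\<phi> y"] * q\<phi> hom_in_carrier[OF \<phi>(1)] by auto
qed

end

section \<open>Even permutations\<close>

text \<open>The 3-cycle that sends \<open>a\<close> to \<open>b\<close>, \<open>b\<close> to \<open>c\<close> and \<open>c\<close> to \<open>a\<close>, written so that its values are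
  computed by rewriting.\<close>

definition cyc3 :: "nat \<Rightarrow> nat \<Rightarrow> nat \<Rightarrow> nat \<Rightarrow> nat" where
  "cyc3 a b c x = (if x = a then b else if x = b then c else if x = c then a else x)"

lemma alt_comp: "\<lbrakk>g \<in> carrier (alt_group d); h \<in> carrier (alt_group d)\<rbrakk> \<Longrightarrow> g \<circ> h \<in> carrier (alt_group d)"
  using group.is_monoid[OF alt_group_is_group] monoid.m_closed by (fastforce simp: alt_group_mult)

lemma transpose_comp_alt:
  "\<lbrakk>a \<noteq> b; c \<noteq> e; {a, b, c, e} \<subseteq> {1..d}\<rbrakk> \<Longrightarrow> transpose a b \<circ> transpose c e \<in> carrier (alt_group d)"
  unfolding alt_group_carrier
  by (auto intro!: permutes_compose permutes_swap_id simp: evenperm_comp permutation_swap_id evenperm_swap)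

lemma cyc3_eq_transpose:
  "distinct [a, b, c] \<Longrightarrow> cyc3 a b c = transpose a b \<circ> transpose b c"
  by (auto simp: fun_eq_iff cyc3_def transpose_def)

lemma cyc3_alt:
  "\<lbrakk>distinct [a, b, c]; {a, b, c} \<subseteq> {1..d}\<rbrakk> \<Longrightarrow> cyc3 a b c \<in> carrier (alt_group d)"
  by (simp add: cyc3_eq_transpose transpose_comp_alt)

lemma cyc3_conj:
  assumes "bij h"
  shows "h \<circ> cyc3 a b c \<circ> inv' h = cyc3 (h a) (h b) (h c)"
proof
  fix x
  obtain y where y: "x = h y" using assms by (metis bij_pointE)
  have "inv' h (h y) = y" "\<And>u v. h u = h v \<longleftrightarrow> u = v"
    using assms by (simp_all add: bij_is_inj inj_eq)
  then show "(h \<circ> cyc3 a b c \<circ> inv' h) x = cyc3 (h a) (h b) (h c) x"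
    by (simp add: y cyc3_def)
qed

lemma alt_bij: "h \<in> carrier (alt_group d) \<Longrightarrow> bij h"
  using alt_group_carrier permutes_bij by blast

lemma alt_conj_cyc3:
  "h \<in> carrier (alt_group d) \<Longrightarrow>
    h \<otimes>\<^bsub>alt_group d\<^esub> cyc3 a b c \<otimes>\<^bsub>alt_group d\<^esub> inv\<^bsub>alt_group d\<^esub> h = cyc3 (h a) (h b) (h c)"
  by (simp add: alt_group_mult alt_group_inv_equality cyc3_conj alt_bij)

lemma alt_conj_transposes:
  "h \<in> carrier (alt_group d) \<Longrightarrow>
    h \<otimes>\<^bsub>alt_group d\<^esub> (transpose a b \<circ> transpose c e) \<otimes>\<^bsub>alt_group d\<^esub> inv\<^bsub>alt_group d\<^esub> h =
      transpose (h a) (h b) \<circ> transpose (h c) (h e)"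
proof -
  assume h: "h \<in> carrier (alt_group d)"
  then have b: "bij h" by (rule alt_bij)
  show ?thesis
  proof
    fix x
    obtain y where y: "x = h y" using b by (metis bij_pointE)
    have "inv' h (h y) = y" "\<And>u v. h u = h v \<longleftrightarrow> u = v"
      using b by (simp_all add: bij_is_inj inj_eq)
    then show "(h \<otimes>\<^bsub>alt_group d\<^esub> (transpose a b \<circ> transpose c e) \<otimes>\<^bsub>alt_group d\<^esub> inv\<^bsub>alt_group d\<^esub> h) x =
        (transpose (h a) (h b) \<circ> transpose (h c) (h e)) x"
      using h by (simp add: y transpose_def alt_group_mult alt_group_inv_equality)
  qed
qed

lemma permutes_prescribed:
  assumes "length xs = length ys" "distinct xs" "distinct ys" "set xs \<subseteq> S" "set ys \<subseteq> S"
  shows "\<exists>h. h permutes S \<and> map h xs = ys"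
  using assms
proof (induction xs ys rule: list_induct2)
  case Nil
  show ?case using permutes_id by fastforce
next
  case (Cons x xs y ys)
  then obtain h where h: "h permutes S" "map h xs = ys" by auto
  let ?h = "transpose (h x) y \<circ> h"
  have "h x \<in> S" using h(1) Cons.prems by (simp add: permutes_in_image)
  then have "?h permutes S" using h(1) Cons.prems by (auto intro!: permutes_compose permutes_swap_id)
  have "h x \<notin> set ys" using h Cons.prems(1) by (auto simp: permutes_inj inj_eq simp flip: h(2))
  moreover have "map ?h xs = map (transpose (h x) y) ys" by (simp flip: h(2))
  ultimately have "map ?h xs = ys" "?h x = y"
    using Cons.prems(2) by (auto simp: transpose_def intro!: map_idI)
  with \<open>?h permutes S\<close> show ?case by auto
qed

text \<open>Two points outside the prescribed values leave room for a transposition that corrects the parity.\<close>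

lemma alt_prescribed:
  assumes "length xs = length ys" "distinct xs" "distinct ys" "set xs \<subseteq> {1..d}" "set ys \<subseteq> {1..d}"
    and len: "length ys + 2 \<le> d"
  obtains h where "h \<in> carrier (alt_group d)" "map h xs = ys"
proof -
  obtain h where h: "h permutes {1..d}" "map h xs = ys"
    using permutes_prescribed[OF assms(1-5)] by blast
  show ?thesis
  proof (cases "evenperm h")
    case True
    then show ?thesis using h that by (simp add: alt_group_carrier)
  next
    case False
    have "card ({1..d} - set ys) \<ge> 2"
      using assms len by (simp add: card_Diff_subset distinct_card)
    then obtain u v where uv: "u \<in> {1..d} - set ys" "v \<in> {1..d} - set ys" "u \<noteq> v"
      by (metis card_2_iff obtain_subset_with_card_n insert_subset)
    let ?h = "transpose u v \<circ> h"
    have "permutation h" using h(1) permutation_permutes by blast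
    then have "evenperm ?h"
      using False uv by (simp add: evenperm_comp permutation_swap_id evenperm_swap)
    moreover have "?h permutes {1..d}" using h(1) uv by (auto intro!: permutes_compose permutes_swap_id)
    moreover have "map ?h xs = map (transpose u v) ys" by (simp flip: h(2))
    then have "map ?h xs = ys" using uv by (auto simp: transpose_def intro!: map_idI)
    ultimately show ?thesis using that[of ?h] by (simp add: alt_group_carrier)
  qed
qed

text \<open>A point that is not mapped back after two steps starts a cycle of length at least 3, and a cycle of
  length 4 is odd.\<close>

lemma even_on_four_points:
  assumes w: "w permutes B" "evenperm w" and B: "finite B" "card B \<le> 4"
  shows "w \<circ> w = id \<or> (\<exists>e f g. distinct [e, f, g] \<and> {e, f, g} \<subseteq> B \<and> w = cyc3 e f g)"
proof (cases "w \<circ> w = id")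
  case False
  then obtain e where e: "w (w e) \<noteq> e" by (auto simp: fun_eq_iff)
  define f g where "f = w e" and "g = w f"
  have inj: "\<And>x y. w x = w y \<longleftrightarrow> x = y" using permutes_inj[OF w(1)] by (simp add: inj_eq)
  have in_B: "\<And>x. w x \<in> B \<longleftrightarrow> x \<in> B" using permutes_in_image[OF w(1)] .
  have out: "\<And>x. x \<notin> B \<Longrightarrow> w x = x" using w(1) by (simp add: permutes_def)
  have dist: "distinct [e, f, g]" using e inj unfolding f_def g_def by auto
  have eB: "e \<in> B" using e out by metis
  then have sub: "{e, f, g} \<subseteq> B" using in_B unfolding f_def g_def by simp
  have "w g = e"
  proof (rule ccontr)
    assume ne: "w g \<noteq> e"
    define q where "q = w g"
    have d4: "distinct [e, f, g, q]" using dist ne inj unfolding q_def f_def g_def by auto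
    have "{e, f, g, q} \<subseteq> B" using sub in_B unfolding q_def by simp
    moreover have "card {e, f, g, q} = 4" using d4 by simp
    ultimately have B4: "B = {e, f, g, q}" using B by (metis card_seteq)
    have "w q \<in> B" using in_B B4 by simp
    moreover have "w e = f" "w f = g" "w g = q" by (simp_all add: f_def g_def q_def)
    then have "w q \<noteq> f" "w q \<noteq> g" "w q \<noteq> q"
      using d4 inj[of q e] inj[of q f] inj[of q g] by auto
    ultimately have "w q = e" using B4 by simp
    have "w x = (transpose e f \<circ> transpose f g \<circ> transpose g q) x" for x
    proof (cases "x \<in> B")
      case True
      then show ?thesis using B4 d4 \<open>w q = e\<close> f_def g_def q_def by (auto simp: transpose_def)
    next
      case False
      then show ?thesis using B4 out by (auto simp: transpose_def)
    qed
    then have "w = transpose e f \<circ> transpose f g \<circ> transpose g q" by blast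
    then have "\<not> evenperm w"
      using d4 by (simp add: evenperm_comp permutation_compose permutation_swap_id evenperm_swap)
    then show False using w by simp
  qed
  have "w x = cyc3 e f g x" for x
  proof (cases "x \<in> {e, f, g}")
    case True
    then show ?thesis using \<open>w g = e\<close> dist by (auto simp: cyc3_def f_def g_def)
  next
    case False
    have "w x = x"
    proof (rule ccontr)
      assume ne: "w x \<noteq> x"
      then have xB: "x \<in> B" using out by metis
      moreover have "w x \<notin> {e, f, g}" using False inj \<open>w g = e\<close> unfolding f_def g_def by auto
      ultimately have "{e, f, g, x, w x} \<subseteq> B" "distinct [e, f, g, x, w x]"
        using sub in_B dist False ne by auto
      then have "card {e, f, g, x, w x} = 5" "card {e, f, g, x, w x} \<le> card B"
        using card_mono[OF B(1)] by (simp, blast)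
      then show False using B by simp
    qed
    then show ?thesis using False by (simp add: cyc3_def)
  qed
  then have "w = cyc3 e f g" by blast
  then show ?thesis using dist sub by blast
qed simp

text \<open>An element of the centralizer acts on the three points like a power of the 3-cycle; what remains
  after splitting off this power is an even permutation of the at most four other points.\<close>

lemma centralizer_cyc3:
  assumes abc: "distinct [a, b, c]" "{a, b, c} \<subseteq> {1..d}" and d: "d \<le> 7"
    and h: "h \<in> carrier (alt_group d)" and comm: "h \<circ> cyc3 a b c = cyc3 a b c \<circ> h"
  obtains n w where "h = cyc3 a b c [^]\<^bsub>alt_group d\<^esub> (n::nat) \<circ> w" "w \<in> carrier (alt_group d)"
    "w a = a" "w b = b" "w c = c"
    "w \<circ> w = id \<or> (\<exists>e f g. distinct [a, b, c, e, f, g] \<and> {e, f, g} \<subseteq> {1..d} \<and> w = cyc3 e f g)"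
proof -
  interpret A: group "alt_group d" by (rule alt_group_is_group)
  let ?t = "cyc3 a b c"
  have t: "?t \<in> carrier (alt_group d)" using cyc3_alt[OF abc] .
  have ht: "h (?t x) = ?t (h x)" for x using comm by (metis comp_apply)
  have inj: "\<And>x y. h x = h y \<longleftrightarrow> x = y" using alt_bij[OF h] by (simp add: bij_is_inj inj_eq)
  have hb: "h b = ?t (h a)" "h c = ?t (h b)" using ht[of a] ht[of b] abc(1) by (auto simp: cyc3_def)
  have ha: "h a \<in> {a, b, c}"
  proof (rule ccontr)
    assume "h a \<notin> {a, b, c}"
    then have "?t (h a) = h a" by (simp add: cyc3_def)
    then show False using hb(1) inj abc(1) by simp
  qed
  have "\<exists>n::nat. n < 3 \<and> (?t [^]\<^bsub>alt_group d\<^esub> n) a = h a"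
  proof -
    consider "h a = a" | "h a = b" | "h a = c" using ha by blast
    then show ?thesis
    proof cases
      case 1
      then show ?thesis by (intro exI[of _ 0]) (simp add: alt_group_one)
    next
      case 2
      then show ?thesis using t by (intro exI[of _ 1]) (simp add: cyc3_def)
    next
      case 3
      then show ?thesis using t abc(1)
        by (intro exI[of _ 2]) (simp add: numeral_2_eq_2 alt_group_mult alt_group_one cyc3_def)
    qed
  qed
  then obtain n where n: "(?t [^]\<^bsub>alt_group d\<^esub> (n::nat)) a = h a" by blast
  define s where "s = ?t [^]\<^bsub>alt_group d\<^esub> n"
  have s: "s \<in> carrier (alt_group d)" using t by (simp add: s_def)
  have st: "s (?t x) = ?t (s x)" for x
  proof -
    have "s \<otimes>\<^bsub>alt_group d\<^esub> ?t = ?t \<otimes>\<^bsub>alt_group d\<^esub> s"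
      unfolding s_def by (metis A.nat_pow_Suc A.nat_pow_Suc2 t)
    then show ?thesis unfolding alt_group_mult by (metis comp_apply)
  qed
  define w where "w = inv\<^bsub>alt_group d\<^esub> s \<circ> h"
  have w: "w \<in> carrier (alt_group d)" unfolding w_def using s h by (intro alt_comp) auto
  have hw: "h = s \<circ> w"
    using A.mult_inv_cancel(1)[OF s h] unfolding w_def by (simp add: alt_group_mult comp_assoc)
  have injs: "\<And>x y. s x = s y \<longleftrightarrow> x = y" using alt_bij[OF s] by (simp add: bij_is_inj inj_eq)
  have "s a = h a" "s b = h b" "s c = h c"
    using n hb st[of a] st[of b] abc(1) by (auto simp: s_def cyc3_def)
  then have fixed: "w a = a" "w b = b" "w c = c" using hw injs by (metis comp_apply)+
  have wp: "w permutes {1..d}" "evenperm w" using w by (auto simp: alt_group_carrier)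
  have "w permutes ({1..d} - {a, b, c})"
    using wp(1) fixed by (auto simp: permutes_def)
  moreover have "card ({1..d} - {a, b, c}) \<le> 4"
    using abc d by (simp add: card_Diff_subset)
  ultimately have "w \<circ> w = id \<or> (\<exists>e f g. distinct [e, f, g] \<and> {e, f, g} \<subseteq> {1..d} - {a, b, c} \<and> w = cyc3 e f g)"
    using even_on_four_points wp(2) by blast
  moreover have "distinct [a, b, c, e, f, g] \<and> {e, f, g} \<subseteq> {1..d}"
    if "distinct [e, f, g]" "{e, f, g} \<subseteq> {1..d} - {a, b, c}" for e f g
    using that abc(1) by auto
  ultimately have "w \<circ> w = id \<or> (\<exists>e f g. distinct [a, b, c, e, f, g] \<and> {e, f, g} \<subseteq> {1..d} \<and> w = cyc3 e f g)"
    by blast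
  then show ?thesis using that hw w fixed unfolding s_def by blast
qed

section \<open>Lifts of three-cycles\<close>

text \<open>With \<open>e\<close> central of order 2 the relations define the binary tetrahedral group, the preimage of the
  alternating group of degree 4 in its double cover. There \<open>v = a b\<close> and its conjugate \<open>w\<close> are two
  quaternion units. If they commute, then \<open>(v w)\<^sup>2 = v\<^sup>2 w\<^sup>2 = e\<^sup>2\<close>, whereas the other relations
  give \<open>v w = b a\<close> and \<open>(b a)\<^sup>2 = e\<close>.\<close>

lemma (in group) binary_tetrahedral_collapse:
  assumes car: "a \<in> carrier G" "b \<in> carrier G" "e \<in> carrier G"
    and e: "e \<otimes> a = a \<otimes> e" "e \<otimes> b = b \<otimes> e"
    and rels: "a \<otimes> a \<otimes> a = e" "b \<otimes> b \<otimes> b = e" "a \<otimes> b \<otimes> (a \<otimes> b) = e"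
    and comm: "(a \<otimes> b) \<otimes> (a \<otimes> (a \<otimes> b) \<otimes> inv a) = (a \<otimes> (a \<otimes> b) \<otimes> inv a) \<otimes> (a \<otimes> b)"
  shows "e = \<one>"
proof -
  define v w d where "v = a \<otimes> b" and "w = a \<otimes> v \<otimes> inv a" and "d = a \<otimes> b \<otimes> a"
  have c: "v \<in> carrier G" "w \<in> carrier G" "d \<in> carrier G"
    using car by (simp_all add: v_def w_def d_def)
  have vv: "v \<otimes> v = e" using rels(3) by (simp add: v_def)
  have db: "d \<otimes> b = e" using vv car by (simp add: v_def d_def m_assoc)
  have "a \<otimes> (b \<otimes> d) = a \<otimes> e"
    using vv e car by (simp add: v_def d_def m_assoc[symmetric])
  then have bd: "b \<otimes> d = e" using car c by simp
  have "d \<otimes> d \<otimes> (b \<otimes> b) = e \<otimes> e"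
  proof -
    have "d \<otimes> d \<otimes> (b \<otimes> b) = d \<otimes> (d \<otimes> b) \<otimes> b" using c car by (simp add: m_assoc)
    also have "\<dots> = d \<otimes> (b \<otimes> e)" unfolding db using c car e(2) by (simp add: m_assoc)
    also have "\<dots> = d \<otimes> b \<otimes> e" using c car by (simp add: m_assoc)
    finally show ?thesis by (simp add: db)
  qed
  moreover have "e \<otimes> b \<otimes> (b \<otimes> b) = e \<otimes> e" using rels(2) car by (simp add: m_assoc)
  ultimately have dd: "d \<otimes> d = e \<otimes> b"
    using c car by (metis m_closed right_cancel)
  have "v \<otimes> w \<otimes> (a \<otimes> a) = d \<otimes> d"
    using car by (simp add: v_def w_def d_def m_assoc mult_inv_cancel)
  also have "\<dots> = b \<otimes> a \<otimes> (a \<otimes> a)"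
    using rels(1) e car by (simp add: dd m_assoc)
  finally have vw: "v \<otimes> w = b \<otimes> a" using c car by (metis m_closed right_cancel)
  have "w \<otimes> w = a \<otimes> (v \<otimes> v) \<otimes> inv a"
    using car c by (simp add: w_def m_assoc mult_inv_cancel)
  then have ww: "w \<otimes> w = e" unfolding vv using car e(1) by (metis inv_solve_right' m_closed)
  have "v \<otimes> w \<otimes> (v \<otimes> w) = v \<otimes> (w \<otimes> v) \<otimes> w" using c by (simp add: m_assoc)
  also have "\<dots> = v \<otimes> (v \<otimes> w) \<otimes> w" using comm by (simp add: v_def w_def)
  also have "\<dots> = (v \<otimes> v) \<otimes> (w \<otimes> w)" using c by (simp add: m_assoc)
  finally have "v \<otimes> w \<otimes> (v \<otimes> w) = e \<otimes> e" using vv ww by simp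
  moreover have "v \<otimes> w \<otimes> (v \<otimes> w) = b \<otimes> d" unfolding vw using car by (simp add: d_def m_assoc)
  ultimately have "e \<otimes> e = e" using bd by simp
  then show ?thesis using car by (simp add: r_cancel_one)
qed

lemma (in group) tetrahedral_conj:
  assumes car: "a \<in> carrier G" "b \<in> carrier G"
    and rels: "b \<otimes> b \<otimes> b = \<one>" "a \<otimes> b \<otimes> (a \<otimes> b) = \<one>"
  shows "b \<otimes> a \<otimes> inv b = inv a \<otimes> b"
proof -
  have "a \<otimes> (b \<otimes> a \<otimes> inv b) \<otimes> (b \<otimes> b) = \<one>"
    using rels(2) car by (simp add: m_assoc mult_inv_cancel)
  moreover have "b \<otimes> (b \<otimes> b) = \<one>" using rels(1) car by (simp add: m_assoc)
  ultimately have "a \<otimes> (b \<otimes> a \<otimes> inv b) = b"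
    using car by (metis inv_closed m_closed right_cancel)
  then show ?thesis using car by (metis inv_closed inv_solve_left m_closed)
qed

lemma cyc3_cubed:
  assumes "distinct [a, b, c]"
  shows "cyc3 a b c [^]\<^bsub>alt_group d\<^esub> (3::nat) = \<one>\<^bsub>alt_group d\<^esub>"
proof
  fix x
  have "cyc3 a b c (cyc3 a b c (cyc3 a b c x)) = x" using assms by (simp add: cyc3_def)
  then show "(cyc3 a b c [^]\<^bsub>alt_group d\<^esub> (3::nat)) x = \<one>\<^bsub>alt_group d\<^esub> x"
    by (simp add: numeral_3_eq_3 alt_group_mult alt_group_one)
qed

lemma cyc3_rotate: "distinct [a, b, c] \<Longrightarrow> cyc3 a b c = cyc3 b c a"
  by (intro ext) (simp add: cyc3_def)

lemma cyc3_inverse: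
  assumes "distinct [a, b, c]" "{a, b, c} \<subseteq> {1..d}"
  shows "inv\<^bsub>alt_group d\<^esub> (cyc3 a b c) = cyc3 b a c"
proof -
  interpret A: group "alt_group d" by (rule alt_group_is_group)
  have "cyc3 b a c \<otimes>\<^bsub>alt_group d\<^esub> cyc3 a b c = \<one>\<^bsub>alt_group d\<^esub>"
    using assms(1) by (auto simp: alt_group_mult alt_group_one fun_eq_iff cyc3_def)
  moreover have "distinct [b, a, c]" "{b, a, c} \<subseteq> {1..d}" using assms by auto
  ultimately show ?thesis using A.inv_equality cyc3_alt assms by metis
qed

locale alt_extension = central_extension K "alt_group d" p for K (structure) and d p +
  assumes d: "6 \<le> d" "d \<le> 7"
begin

abbreviation "A \<equiv> alt_group d"

text \<open>All ordered pairs of disjoint 3-cycles are conjugate up to inverting the first one.\<close>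

lemma comm_cyc3_transfer:
  assumes xs: "distinct [a, b, c, e, f, g]" "{a, b, c, e, f, g} \<subseteq> {1..d}"
    and ys: "distinct [a', b', c', e', f', g']" "{a', b', c', e', f', g'} \<subseteq> {1..d}"
    and comm: "lifts_commute K p (cyc3 a b c) (cyc3 e f g)"
  shows "lifts_commute K p (cyc3 a' b' c') (cyc3 e' f' g')"
proof -
  have in_A: "cyc3 a b c \<in> carrier A" "cyc3 e f g \<in> carrier A"
      "cyc3 b' a' c' \<in> carrier A" "cyc3 e' f' g' \<in> carrier A"
    using xs ys by (auto intro!: cyc3_alt)
  obtain h where h: "h permutes {1..d}" "map h [a, b, c, e, f, g] = [a', b', c', e', f', g']"
    using permutes_prescribed[of "[a, b, c, e, f, g]" "[a', b', c', e', f', g']" "{1..d}"] xs ys by auto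
  show ?thesis
  proof (cases "evenperm h")
    case True
    then have "h \<in> carrier A" using h by (simp add: alt_group_carrier)
    then show ?thesis using lifts_commute_conj[OF in_A(1,2) _ comm, of h] h(2)
      by (simp add: alt_conj_cyc3)
  next
    case False
    \<comment> \<open>An odd permutation is corrected by a transposition inside the first cycle, which
      inverts that cycle.\<close>
    let ?h = "h \<circ> transpose a b"
    have "permutation h" using h(1) permutation_permutes by blast
    then have "evenperm ?h"
      using False xs by (simp add: evenperm_comp permutation_swap_id evenperm_swap)
    moreover have "?h permutes {1..d}" 
      using permutes_compose[OF permutes_swap_id[of a "{1..d}" b] h(1)] xs by simp
    ultimately have hA: "?h \<in> carrier A" by (simp add: alt_group_carrier)
    have "?h a = b'" "?h b = a'" "?h c = c'" "?h e = e'" "?h f = f'" "?h g = g'"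
      using h(2) xs(1) by (auto simp: transpose_def)
    then have "lifts_commute K p (cyc3 b' a' c') (cyc3 e' f' g')"
      using lifts_commute_conj[OF in_A(1,2) hA comm] unfolding alt_conj_cyc3[OF hA] by simp
    then have "lifts_commute K p (cyc3 e' f' g') (inv\<^bsub>A\<^esub> (cyc3 b' a' c'))"
      by (rule lifts_commute_inv[OF in_A(4,3) lifts_commute_sym])
    moreover have "inv\<^bsub>A\<^esub> (cyc3 b' a' c') = cyc3 a' b' c'"
      using cyc3_inverse[of b' a' c' d] ys by auto
    ultimately have "lifts_commute K p (cyc3 e' f' g') (cyc3 a' b' c')" by simp
    then show ?thesis by (rule lifts_commute_sym)
  qed
qed

lemma comm_transposes_transfer:
  assumes xs: "distinct [a, b, c, e]" "{a, b, c, e} \<subseteq> {1..d}"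
    and ys: "distinct [a', b', c', e']" "{a', b', c', e'} \<subseteq> {1..d}"
    and comm: "lifts_commute K p (transpose a b \<circ> transpose c e) (transpose a c \<circ> transpose b e)"
  shows "lifts_commute K p (transpose a' b' \<circ> transpose c' e') (transpose a' c' \<circ> transpose b' e')"
proof -
  obtain h where h: "h \<in> carrier A" "map h [a, b, c, e] = [a', b', c', e']"
    using alt_prescribed[of "[a, b, c, e]" "[a', b', c', e']" d] xs ys d by auto
  have "transpose a b \<circ> transpose c e \<in> carrier A" "transpose a c \<circ> transpose b e \<in> carrier A"
    using xs by (auto intro!: transpose_comp_alt)
  from lifts_commute_conj[OF this h(1) comm] show ?thesis
    using h by (simp add: alt_conj_transposes)
qed

text \<open>The centralizer of a 3-cycle is generated by the 3-cycle, by involutions, whose order is coprime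
  to 3, and by 3-cycles disjoint from it.\<close>

lemma cyc3_centralizer_lifts:
  assumes V: "lifts_commute K p (cyc3 1 2 3) (cyc3 4 5 6)"
    and abc: "distinct [a, b, c]" "{a, b, c} \<subseteq> {1..d}"
    and h: "h \<in> carrier A" "cyc3 a b c \<otimes>\<^bsub>A\<^esub> h = h \<otimes>\<^bsub>A\<^esub> cyc3 a b c"
  shows "lifts_commute K p (cyc3 a b c) h"
proof -
  let ?t = "cyc3 a b c"
  have t: "?t \<in> carrier A" using cyc3_alt[OF abc] .
  have "h \<circ> ?t = ?t \<circ> h" using h(2) by (simp add: alt_group_mult)
  then obtain n w where n: "h = ?t [^]\<^bsub>A\<^esub> (n::nat) \<circ> w" "w \<in> carrier A" "w a = a" "w b = b" "w c = c"
    and w: "w \<circ> w = id \<or> (\<exists>e f g. distinct [a, b, c, e, f, g] \<and> {e, f, g} \<subseteq> {1..d} \<and> w = cyc3 e f g)"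
    using centralizer_cyc3[OF abc d(2) h(1)] by metis
  have "lifts_commute K p ?t w"
  proof (cases "w \<circ> w = id")
    case True
    have "w \<otimes>\<^bsub>A\<^esub> ?t \<otimes>\<^bsub>A\<^esub> inv\<^bsub>A\<^esub> w = ?t" using n by (simp add: alt_conj_cyc3)
    then have "?t \<otimes>\<^bsub>A\<^esub> w = w \<otimes>\<^bsub>A\<^esub> ?t" using n(2) t by (metis G.inv_solve_right' G.m_closed)
    moreover have "w [^]\<^bsub>A\<^esub> (2::nat) = \<one>\<^bsub>A\<^esub>"
      using True by (simp add: numeral_2_eq_2 alt_group_mult alt_group_one)
    moreover have "coprime (3::nat) 2" by simp
    ultimately show ?thesis using lifts_commute_coprime[OF t n(2)] cyc3_cubed[OF abc(1)] by blast
  next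
    case False
    then obtain e f g where "distinct [a, b, c, e, f, g]" "{e, f, g} \<subseteq> {1..d}" "w = cyc3 e f g"
      using w by blast
    then show ?thesis using comm_cyc3_transfer[OF _ _ _ _ V] abc d by simp
  qed
  then have "lifts_commute K p ?t (?t [^]\<^bsub>A\<^esub> n \<otimes>\<^bsub>A\<^esub> w)"
    using lifts_commute_mult[OF t _ n(2) lifts_commute_refl_pow[OF t]] t by simp
  then show ?thesis using n(1) by (simp add: alt_group_mult)
qed

lemma equivariant_cyc3_lifts:
  assumes V: "lifts_commute K p (cyc3 1 2 3) (cyc3 4 5 6)"
  obtains t where
    "\<And>a b c. \<lbrakk>distinct [a, b, c]; {a, b, c} \<subseteq> {1..d}\<rbrakk> \<Longrightarrow>
        t (cyc3 a b c) \<in> carrier K \<and> p (t (cyc3 a b c)) = cyc3 a b c"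
    "\<And>a b c x. \<lbrakk>distinct [a, b, c]; {a, b, c} \<subseteq> {1..d}; x \<in> carrier K\<rbrakk> \<Longrightarrow>
        x \<otimes> t (cyc3 a b c) \<otimes> inv x = t (cyc3 (p x a) (p x b) (p x c))"
proof -
  define C where "C = {cyc3 a b c | a b c. distinct [a, b, c] \<and> {a, b, c} \<subseteq> {1..d}}"
  have C_I: "cyc3 a b c \<in> C" if "distinct [a, b, c]" "{a, b, c} \<subseteq> {1..d}" for a b c
    using that unfolding C_def by blast
  have C_E: "\<exists>a b c. g = cyc3 a b c \<and> distinct [a, b, c] \<and> {a, b, c} \<subseteq> {1..d}" if "g \<in> C" for g
    using that unfolding C_def by blast
  have C_sub: "C \<subseteq> carrier A" using cyc3_alt unfolding C_def by blast
  have C_closed: "h \<otimes>\<^bsub>A\<^esub> g \<otimes>\<^bsub>A\<^esub> inv\<^bsub>A\<^esub> h \<in> C" if g: "g \<in> C" and h: "h \<in> carrier A" for g h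
  proof -
    obtain a b c where g: "g = cyc3 a b c" "distinct [a, b, c]" "{a, b, c} \<subseteq> {1..d}" using C_E[OF g] by blast
    have "h permutes {1..d}" using h by (simp add: alt_group_carrier)
    then have "distinct [h a, h b, h c]" "{h a, h b, h c} \<subseteq> {1..d}"
      using g(2,3) permutes_inj[of h] by (auto simp: inj_eq permutes_in_image simp del: atLeastAtMost_iff)
    then show ?thesis using alt_conj_cyc3[OF h] g(1) C_I by simp
  qed
  have C_comm: "lifts_commute K p g h"
    if g: "g \<in> C" and h: "h \<in> carrier A" "g \<otimes>\<^bsub>A\<^esub> h = h \<otimes>\<^bsub>A\<^esub> g" for g h
    using C_E[OF g] h cyc3_centralizer_lifts[OF V] by blast
  obtain s where s: "\<And>g. g \<in> C \<Longrightarrow> s g \<in> carrier K" "\<And>g. g \<in> C \<Longrightarrow> p (s g) = g"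
    "\<And>g x. \<lbrakk>g \<in> C; x \<in> carrier K\<rbrakk> \<Longrightarrow> x \<otimes> s g \<otimes> inv x = s (p x \<otimes>\<^bsub>A\<^esub> g \<otimes>\<^bsub>A\<^esub> inv\<^bsub>A\<^esub> p x)"
    using equivariant_section[OF C_sub C_closed C_comm] by blast
  show ?thesis
  proof (rule that[of s])
    fix a b c x assume abc: "distinct [a, b, c]" "{a, b, c} \<subseteq> {1..d}"
    then have C: "cyc3 a b c \<in> C" by (rule C_I)
    then show "s (cyc3 a b c) \<in> carrier K \<and> p (s (cyc3 a b c)) = cyc3 a b c"
      using s(1,2) by blast
    assume x: "x \<in> carrier K"
    then show "x \<otimes> s (cyc3 a b c) \<otimes> inv x = s (cyc3 (p x a) (p x b) (p x c))"
      using s(3)[OF C x] alt_conj_cyc3[of "p x"] by simp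
  qed
qed

end

lemma (in group) conj_mult:
  "\<lbrakk>x \<in> carrier G; a \<in> carrier G; b \<in> carrier G\<rbrakk> \<Longrightarrow>
    x \<otimes> (a \<otimes> b) \<otimes> inv x = (x \<otimes> a \<otimes> inv x) \<otimes> (x \<otimes> b \<otimes> inv x)"
  by (simp add: m_assoc mult_inv_cancel)

context alt_extension
begin

text \<open>Equivariant lifts \<open>r\<close> of the 3-cycles have a common cube \<open>z\<close> and, because the alternating group
  acts transitively on quadruples of points, a common value \<open>w\<close> of \<open>(r a b c \<cdot> r a b e)\<^sup>2\<close>. Multiplying
  all lifts by \<open>z w\<inverse>\<close> makes both values equal, and then they are trivial by
  \<open>binary_tetrahedral_collapse\<close>.\<close>

lemma cyc3_lifts_with_relations:
  assumes U: "lifts_commute K p (transpose 1 2 \<circ> transpose 3 4) (transpose 1 3 \<circ> transpose 2 4)"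
    and V: "lifts_commute K p (cyc3 1 2 3) (cyc3 4 5 6)"
  obtains t where
    "\<And>a b c. \<lbrakk>distinct [a, b, c]; {a, b, c} \<subseteq> {1..d}\<rbrakk> \<Longrightarrow> t a b c \<in> carrier K"
    "\<And>a b c. \<lbrakk>distinct [a, b, c]; {a, b, c} \<subseteq> {1..d}\<rbrakk> \<Longrightarrow> p (t a b c) = cyc3 a b c"
    "\<And>a b c x. \<lbrakk>distinct [a, b, c]; {a, b, c} \<subseteq> {1..d}; x \<in> carrier K\<rbrakk> \<Longrightarrow>
        x \<otimes> t a b c \<otimes> inv x = t (p x a) (p x b) (p x c)"
    "\<And>a b c. distinct [a, b, c] \<Longrightarrow> t a b c = t b c a"
    "\<And>a b c. \<lbrakk>distinct [a, b, c]; {a, b, c} \<subseteq> {1..d}\<rbrakk> \<Longrightarrow> t a b c \<otimes> t a b c \<otimes> t a b c = \<one>"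
    "\<And>a b c e. \<lbrakk>distinct [a, b, c, e]; {a, b, c, e} \<subseteq> {1..d}\<rbrakk> \<Longrightarrow>
        t a b c \<otimes> t a b e \<otimes> (t a b c \<otimes> t a b e) = \<one>"
proof -
  obtain s where s: "\<And>a b c. \<lbrakk>distinct [a, b, c]; {a, b, c} \<subseteq> {1..d}\<rbrakk> \<Longrightarrow>
        s (cyc3 a b c) \<in> carrier K \<and> p (s (cyc3 a b c)) = cyc3 a b c"
    "\<And>a b c x. \<lbrakk>distinct [a, b, c]; {a, b, c} \<subseteq> {1..d}; x \<in> carrier K\<rbrakk> \<Longrightarrow>
        x \<otimes> s (cyc3 a b c) \<otimes> inv x = s (cyc3 (p x a) (p x b) (p x c))"
    using equivariant_cyc3_lifts[OF V] by blast
  define r where "r a b c = s (cyc3 a b c)" for a b c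
  have r: "r a b c \<in> carrier K" "p (r a b c) = cyc3 a b c"
    if "distinct [a, b, c]" "{a, b, c} \<subseteq> {1..d}" for a b c
    using s(1)[OF that] by (simp_all add: r_def)
  have r_conj: "x \<otimes> r a b c \<otimes> inv x = r (p x a) (p x b) (p x c)"
    if "distinct [a, b, c]" "{a, b, c} \<subseteq> {1..d}" "x \<in> carrier K" for a b c x
    using s(2)[OF that] by (simp add: r_def)
  define cube where "cube a b c = r a b c \<otimes> r a b c \<otimes> r a b c" for a b c
  define sq where "sq a b c e = r a b c \<otimes> r a b e \<otimes> (r a b c \<otimes> r a b e)" for a b c e
  define z w where "z = cube 1 2 3" and "w = sq 1 2 3 4"
  have in_d: "{1, 2, 3} \<subseteq> {1..d}" "{1, 2, 4} \<subseteq> {1..d}" "{1, 2, 3, 4} \<subseteq> {1..d}" using d by auto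
  have z: "z \<in> carrier K" "p z = \<one>\<^bsub>A\<^esub>"
  proof -
    have "p z = cyc3 1 2 3 \<circ> cyc3 1 2 3 \<circ> cyc3 1 2 3"
      using r[of 1 2 3] in_d by (simp add: z_def cube_def alt_group_mult)
    also have "\<dots> = id" by (intro ext) (simp add: cyc3_def)
    finally show "p z = \<one>\<^bsub>A\<^esub>" by (simp add: alt_group_one)
  qed (use r[of 1 2 3] in_d in \<open>simp add: z_def cube_def\<close>)
  have w: "w \<in> carrier K" "p w = \<one>\<^bsub>A\<^esub>"
  proof -
    have "p w = (cyc3 1 2 3 \<circ> cyc3 1 2 4) \<circ> (cyc3 1 2 3 \<circ> cyc3 1 2 4)"
      using r[of 1 2 3] r[of 1 2 4] in_d by (simp add: w_def sq_def alt_group_mult)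
    also have "\<dots> = id" by (intro ext) (simp add: cyc3_def)
    finally show "p w = \<one>\<^bsub>A\<^esub>" by (simp add: alt_group_one)
  qed (use r[of 1 2 3] r[of 1 2 4] in_d in \<open>simp add: w_def sq_def\<close>)
  have central: "x \<otimes> u \<otimes> inv x = u" if "u \<in> carrier K" "p u = \<one>\<^bsub>A\<^esub>" "x \<in> carrier K" for u x
    using kernel_central[OF that] that by (metis inv_solve_right' m_closed)
  have cube: "cube a b c = z" if abc: "distinct [a, b, c]" "{a, b, c} \<subseteq> {1..d}" for a b c
  proof -
    obtain h where h: "h \<in> carrier A" "map h [1, 2, 3] = [a, b, c]"
      using alt_prescribed[of "[1, 2, 3]" "[a, b, c]" d] abc d by auto
    obtain x where x: "x \<in> carrier K" "p x = h" using obtain_lift[OF h(1)] .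
    have "x \<otimes> z \<otimes> inv x = cube a b c"
      using r_conj[of 1 2 3 x] in_d x h(2) r[of 1 2 3] by (simp add: z_def cube_def conj_mult)
    then show ?thesis using central[OF z x(1)] by simp
  qed
  have sq: "sq a b c e = w" if abc: "distinct [a, b, c, e]" "{a, b, c, e} \<subseteq> {1..d}" for a b c e
  proof -
    obtain h where h: "h \<in> carrier A" "map h [1, 2, 3, 4] = [a, b, c, e]"
      using alt_prescribed[of "[1, 2, 3, 4]" "[a, b, c, e]" d] abc d by auto
    obtain x where x: "x \<in> carrier K" "p x = h" using obtain_lift[OF h(1)] .
    have "x \<otimes> w \<otimes> inv x = sq a b c e"
      using r_conj[of 1 2 3 x] r_conj[of 1 2 4 x] in_d x h(2) r[of 1 2 3] r[of 1 2 4]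
      by (simp add: w_def sq_def conj_mult)
    then show ?thesis using central[OF w x(1)] by simp
  qed
  \<comment> \<open>With this factor the common cube and the common square of the rescaled lifts coincide.\<close>
  define k where "k = z \<otimes> inv w"
  have k: "k \<in> carrier K" "p k = \<one>\<^bsub>A\<^esub>" using z w by (simp_all add: k_def image_simps)
  have kc: "u \<otimes> k = k \<otimes> u" if "u \<in> carrier K" for u using kernel_central[OF k that] by simp
  have klc: "u \<otimes> (k \<otimes> v) = k \<otimes> (u \<otimes> v)" if "u \<in> carrier K" "v \<in> carrier K" for u v
    using kc[OF that(1)] that k by (metis m_assoc)
  define e where "e = k \<otimes> (k \<otimes> (k \<otimes> z))"
  define t where "t a b c = k \<otimes> r a b c" for a b c
  have e: "e \<in> carrier K" "p e = \<one>\<^bsub>A\<^esub>" using k z by (simp_all add: e_def)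
  have e': "e = k \<otimes> (k \<otimes> (k \<otimes> (k \<otimes> w)))"
    unfolding e_def using z w by (simp add: k_def m_assoc)
  have t: "t a b c \<in> carrier K" "p (t a b c) = cyc3 a b c"
    if "distinct [a, b, c]" "{a, b, c} \<subseteq> {1..d}" for a b c
    using r[OF that] k by (simp_all add: t_def cyc3_alt[OF that])
  have t_conj: "x \<otimes> t a b c \<otimes> inv x = t (p x a) (p x b) (p x c)"
    if abc: "distinct [a, b, c]" "{a, b, c} \<subseteq> {1..d}" and x: "x \<in> carrier K" for a b c x
  proof -
    have "x \<otimes> t a b c \<otimes> inv x = (x \<otimes> k \<otimes> inv x) \<otimes> (x \<otimes> r a b c \<otimes> inv x)"
      using x k r[OF abc] by (simp add: t_def conj_mult)
    then show ?thesis using central[OF k x] r_conj[OF abc x] by (simp add: t_def)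
  qed
  have t_cube: "t a b c \<otimes> t a b c \<otimes> t a b c = e"
    if abc: "distinct [a, b, c]" "{a, b, c} \<subseteq> {1..d}" for a b c
  proof -
    have r': "r a b c \<in> carrier K" using r[OF abc] by simp
    have "t a b c \<otimes> t a b c \<otimes> t a b c = k \<otimes> (k \<otimes> (k \<otimes> cube a b c))"
      unfolding t_def cube_def using r' k by (simp add: m_assoc klc[OF r'])
    then show ?thesis using cube[OF abc] by (simp add: e_def)
  qed
  have t_sq: "t a b c \<otimes> t a b f \<otimes> (t a b c \<otimes> t a b f) = e"
    if abc: "distinct [a, b, c, f]" "{a, b, c, f} \<subseteq> {1..d}" for a b c f
  proof -
    have r': "r a b c \<in> carrier K" "r a b f \<in> carrier K" using r[of a b c] r[of a b f] abc by auto
    have "t a b c \<otimes> t a b f \<otimes> (t a b c \<otimes> t a b f) = k \<otimes> (k \<otimes> (k \<otimes> (k \<otimes> sq a b c f)))"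
      unfolding t_def sq_def using r' k by (simp add: m_assoc klc[OF r'(1)] klc[OF r'(2)])
    then show ?thesis using sq[OF abc] by (simp add: e')
  qed
  have "e = \<one>"
  proof (rule binary_tetrahedral_collapse[of "t 1 2 3" "t 1 2 4" e])
    have tK: "t 1 2 3 \<in> carrier K" "t 1 2 4 \<in> carrier K" using t[of 1 2 3] t[of 1 2 4] in_d by auto
    have tp: "p (t 1 2 3) = cyc3 1 2 3" "p (t 1 2 4) = cyc3 1 2 4" using t[of 1 2 3] t[of 1 2 4] in_d by auto
    let ?x = "t 1 2 3 \<otimes> t 1 2 4"
    let ?y = "t 1 2 3 \<otimes> ?x \<otimes> inv (t 1 2 3)"
    have x: "p ?x = transpose 1 3 \<circ> transpose 2 4"
    proof -
      have "p ?x = cyc3 1 2 3 \<circ> cyc3 1 2 4" using tK tp by (simp add: alt_group_mult)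
      also have "\<dots> = transpose 1 3 \<circ> transpose 2 4" by (intro ext) (simp add: cyc3_def transpose_def)
      finally show ?thesis .
    qed
    have "p ?y = cyc3 1 2 3 \<otimes>\<^bsub>A\<^esub> p ?x \<otimes>\<^bsub>A\<^esub> inv\<^bsub>A\<^esub> cyc3 1 2 3"
      using tK tp by (simp add: image_simps)
    also have "\<dots> = transpose 2 1 \<circ> transpose 3 4"
      unfolding x using alt_conj_transposes[OF cyc3_alt[of 1 2 3 d], of 1 3 2 4] in_d
      by (simp add: cyc3_def)
    finally have y: "p ?y = transpose 1 2 \<circ> transpose 3 4" by (simp add: transpose_commute)
    have xy: "?x \<in> carrier K" "?y \<in> carrier K" using tK by simp_all
    show "?x \<otimes> ?y = ?y \<otimes> ?x"
      using lifts_commute_iff[OF xy(2,1)] U unfolding x y by simp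
    show "t 1 2 3 \<in> carrier K" "t 1 2 4 \<in> carrier K" by fact+
    show "e \<otimes> t 1 2 3 = t 1 2 3 \<otimes> e" "e \<otimes> t 1 2 4 = t 1 2 4 \<otimes> e"
      using kernel_central[OF e] tK by auto
    show "t 1 2 3 \<otimes> t 1 2 3 \<otimes> t 1 2 3 = e" "t 1 2 4 \<otimes> t 1 2 4 \<otimes> t 1 2 4 = e" "?x \<otimes> ?x = e"
      using t_cube[of 1 2 3] t_cube[of 1 2 4] t_sq[of 1 2 3 4] in_d by auto
  qed (rule e)
  moreover have "t a b c = t b c a" if "distinct [a, b, c]" for a b c
    using cyc3_rotate[OF that] by (simp add: t_def r_def)
  ultimately show ?thesis using that[of t] t t_conj t_cube t_sq by blast
qed

end

section \<open>A section over the derived subgroup\<close>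

lemma (in group) generate_right_invariant:
  assumes "g \<in> generate G T" "T \<subseteq> carrier G" "C \<subseteq> carrier G"
    and "\<And>x. x \<in> T \<Longrightarrow> inv x \<in> T"
    and "\<And>c x. \<lbrakk>c \<in> C; x \<in> T\<rbrakk> \<Longrightarrow> c \<otimes> x \<in> C"
  shows "\<forall>c\<in>C. c \<otimes> g \<in> C"
  using assms(1)
proof induction
  case one
  then show ?case using assms(3) by auto
next
  case (incl h)
  then show ?case using assms(5) by blast
next
  case (inv h)
  then show ?case using assms(4,5) by blast
next
  case (eng g h)
  have "g \<in> carrier G" "h \<in> carrier G"
    using eng.hyps assms(2) generate_in_carrier by blast+
  then show ?case using eng.IH assms(3) by (metis m_assoc subsetD)
qed

context alt_extension
begin

text \<open>Commutators in a central extension depend only on the images of their arguments, so they can be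
  computed inside \<open>H\<close>.\<close>

lemma derived_subset_of_section:
  assumes H: "subgroup H K" and surj: "\<And>g. g \<in> carrier A \<Longrightarrow> \<exists>h\<in>H. p h = g"
  shows "derived K (carrier K) \<subseteq> H"
proof -
  have "derived_set K (carrier K) \<subseteq> H"
  proof
    fix c assume "c \<in> derived_set K (carrier K)"
    then obtain x y where c: "c = x \<otimes> y \<otimes> inv x \<otimes> inv y" and xy: "x \<in> carrier K" "y \<in> carrier K"
      by auto
    obtain h k where hk: "h \<in> H" "p h = p x" "k \<in> H" "p k = p y"
      using surj xy by (metis p.hom_closed)
    have hkK: "h \<in> carrier K" "k \<in> carrier K" using hk subgroup.mem_carrier[OF H] by auto
    have "c = h \<otimes> y \<otimes> inv h \<otimes> inv y"
      using conj_depends_on_image[OF xy(1) hkK(1) _ xy(2)] hk(2) c by simp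
    also have "\<dots> = h \<otimes> (y \<otimes> inv h \<otimes> inv y)" using hkK xy by (simp add: m_assoc)
    also have "\<dots> = h \<otimes> (k \<otimes> inv h \<otimes> inv k)"
      using conj_depends_on_image[OF xy(2) hkK(2), of "inv h"] hk(4) hkK by simp
    finally show "c \<in> H"
      using hk by (simp add: subgroup.m_closed[OF H] subgroup.m_inv_closed[OF H])
  qed
  then show ?thesis unfolding derived_def using H by (rule generate_subgroup_incl)
qed

text \<open>Let \<open>H m\<close> be generated by the lifts of the 3-cycles on \<open>{1..m}\<close>. Each element of \<open>H (m + 1)\<close> lies in
  \<open>H m\<close> or in one of the cosets of the lifts of \<open>(m + 1  k  j)\<close>, and the latter move the point \<open>j\<close> to
  \<open>m + 1\<close>. So an element of \<open>H (m + 1)\<close> over the identity lies in \<open>H m\<close>, and by induction it is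
  trivial. Thus \<open>H d\<close> is a section of the extension, and it contains the derived subgroup.\<close>

lemma kernel_derived_trivial:
  assumes U: "lifts_commute K p (transpose 1 2 \<circ> transpose 3 4) (transpose 1 3 \<circ> transpose 2 4)"
    and V: "lifts_commute K p (cyc3 1 2 3) (cyc3 4 5 6)"
    and x: "x \<in> derived K (carrier K)" "p x = \<one>\<^bsub>A\<^esub>"
  shows "x = \<one>"
proof -
  obtain t where
    t_car: "\<And>a b c. \<lbrakk>distinct [a, b, c]; {a, b, c} \<subseteq> {1..d}\<rbrakk> \<Longrightarrow> t a b c \<in> carrier K" and
    t_im: "\<And>a b c. \<lbrakk>distinct [a, b, c]; {a, b, c} \<subseteq> {1..d}\<rbrakk> \<Longrightarrow> p (t a b c) = cyc3 a b c" and
    t_conj: "\<And>a b c x. \<lbrakk>distinct [a, b, c]; {a, b, c} \<subseteq> {1..d}; x \<in> carrier K\<rbrakk> \<Longrightarrow>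
        x \<otimes> t a b c \<otimes> inv x = t (p x a) (p x b) (p x c)" and
    t_rot: "\<And>a b c. distinct [a, b, c] \<Longrightarrow> t a b c = t b c a" and
    t_cube: "\<And>a b c. \<lbrakk>distinct [a, b, c]; {a, b, c} \<subseteq> {1..d}\<rbrakk> \<Longrightarrow> t a b c \<otimes> t a b c \<otimes> t a b c = \<one>" and
    t_sq: "\<And>a b c e. \<lbrakk>distinct [a, b, c, e]; {a, b, c, e} \<subseteq> {1..d}\<rbrakk> \<Longrightarrow>
        t a b c \<otimes> t a b e \<otimes> (t a b c \<otimes> t a b e) = \<one>"
    by (rule cyc3_lifts_with_relations[OF U V]) blast
  have quot: "inv (t a b c) \<otimes> t a b e = t b e c"
    if abc: "distinct [a, b, c, e]" "{a, b, c, e} \<subseteq> {1..d}" for a b c e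
  proof -
    have 1: "distinct [a, b, c]" "{a, b, c} \<subseteq> {1..d}" "distinct [a, b, e]" "{a, b, e} \<subseteq> {1..d}"
      using abc by auto
    have "inv (t a b c) \<otimes> t a b e = t a b e \<otimes> t a b c \<otimes> inv (t a b e)"
      using tetrahedral_conj[OF t_car[OF 1(1,2)] t_car[OF 1(3,4)] t_cube[OF 1(3,4)] t_sq[OF abc]]
      by simp
    also have "\<dots> = t b e c"
      using t_conj[OF 1(1,2) t_car[OF 1(3,4)]] t_im[OF 1(3,4)] abc(1) by (auto simp: cyc3_def)
    finally show ?thesis .
  qed
  have t_inv: "inv (t a b c) = t a c b"
    if abc: "distinct [a, b, c]" "{a, b, c} \<subseteq> {1..d}" for a b c
  proof -
    have "card {a, b, c} \<noteq> card {1..d}" using abc(1) d by simp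
    then have "{a, b, c} \<noteq> {1..d}" by metis
    then obtain f where f: "f \<in> {1..d}" "f \<notin> {a, b, c}"
      using abc(2) by blast
    have 1: "t f a c \<in> carrier K" "t f a b \<in> carrier K" using abc f by (auto intro!: t_car)
    have "t a b c = inv (t f a c) \<otimes> t f a b" "t a c b = inv (t f a b) \<otimes> t f a c"
      using quot[of f a c b] quot[of f a b c] abc f by auto
    then show ?thesis using 1 by (simp add: inv_mult_group)
  qed
  define T where "T m = {t a b c | a b c. distinct [a, b, c] \<and> {a, b, c} \<subseteq> {1..m}}" for m :: nat
  define H where "H m = generate K (T m)" for m :: nat
  have T_I: "t a b c \<in> T m" if "distinct [a, b, c]" "{a, b, c} \<subseteq> {1..m}" for a b c m
    using that unfolding T_def by blast
  have T_E: "\<exists>a b c. g = t a b c \<and> distinct [a, b, c] \<and> {a, b, c} \<subseteq> {1..m}" if "g \<in> T m" for g m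
    using that unfolding T_def by blast
  have T_car: "T m \<subseteq> carrier K" if "m \<le> d" for m
  proof
    fix g assume "g \<in> T m"
    then obtain a b c where g: "g = t a b c" "distinct [a, b, c]" "{a, b, c} \<subseteq> {1..m}" using T_E by blast
    then show "g \<in> carrier K" using t_car[of a b c] that by auto
  qed
  have T_inv: "inv g \<in> T m" if gT: "g \<in> T m" and "m \<le> d" for g m
  proof -
    obtain a b c where g: "g = t a b c" "distinct [a, b, c]" "{a, b, c} \<subseteq> {1..m}" using T_E[OF gT] by blast
    then have "inv g = t a c b" using t_inv[of a b c] that by auto
    then show ?thesis using g T_I[of a c b m] by auto
  qed
  have H_sub: "subgroup (H m) K" if "m \<le> d" for m
    unfolding H_def by (rule generate_is_subgroup[OF T_car[OF that]])
  have H_t: "t a b c \<in> H m" if "distinct [a, b, c]" "{a, b, c} \<subseteq> {1..m}" for a b c m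
    unfolding H_def using T_I[OF that] by (rule generate.incl)
  have H_fixes: "p h i = i" if "h \<in> H m" "m < i" "i \<le> d" for h m i
    using that(1) unfolding H_def
  proof induction
    case one
    show ?case by (simp add: alt_group_one)
  next
    case (incl g)
    then obtain a b c where g: "g = t a b c" "distinct [a, b, c]" "{a, b, c} \<subseteq> {1..m}" using T_E by blast
    then have "p g = cyc3 a b c" using t_im[of a b c] that by auto
    then show ?case using g that by (auto simp: cyc3_def)
  next
    case (inv g)
    then have "inv g \<in> T m" using T_inv that by simp
    then obtain a b c where g: "inv g = t a b c" "distinct [a, b, c]" "{a, b, c} \<subseteq> {1..m}" using T_E by blast
    then have "p (inv g) = cyc3 a b c" using t_im[of a b c] that by auto
    then show ?case using g that by (auto simp: cyc3_def)
  next
    case (eng g h)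
    have "g \<in> carrier K" "h \<in> carrier K"
      using eng.hyps T_car[of m] that generate_in_carrier by auto
    then show ?case using eng.IH by (simp add: alt_group_mult)
  qed
  have coset: "h \<in> H m \<or> (\<exists>y\<in>H m. \<exists>k j. k \<noteq> j \<and> {k, j} \<subseteq> {1..m} \<and> h = y \<otimes> t (Suc m) k j)"
    if h: "h \<in> H (Suc m)" and m: "Suc m \<le> d" for h m
  proof -
    let ?n = "Suc m"
    note Hm = H_sub[OF Suc_leD[OF m]]
    note Hm_car = subgroup.mem_carrier[OF Hm] and Hm_mult = subgroup.m_closed[OF Hm]
    define C where "C = H m \<union> {y \<otimes> t ?n k j | y k j. y \<in> H m \<and> k \<noteq> j \<and> {k, j} \<subseteq> {1..m}}"
    have C1: "y \<in> C" if "y \<in> H m" for y using that by (simp add: C_def)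
    have C2: "y \<otimes> t ?n k j \<in> C" if "y \<in> H m" "k \<noteq> j" "{k, j} \<subseteq> {1..m}" for y k j
      using that unfolding C_def by blast
    have nkj: "distinct [?n, k, j]" "{?n, k, j} \<subseteq> {1..d}" if "k \<noteq> j" "{k, j} \<subseteq> {1..m}" for k j
      using that m by auto
    have small: "{a, b, c} \<subseteq> {1..d}" if "{a, b, c} \<subseteq> {1..m}" for a b c using that m by auto
    have C_car: "C \<subseteq> carrier K"
      using Hm_car t_car[OF nkj] unfolding C_def by auto
    have step_new: "c \<otimes> t ?n a b \<in> C" if c: "c \<in> C" and ab: "a \<noteq> b" "{a, b} \<subseteq> {1..m}" for c a b
    proof -
      consider "c \<in> H m" | y k j where "y \<in> H m" "k \<noteq> j" "{k, j} \<subseteq> {1..m}" "c = y \<otimes> t ?n k j"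
        using c unfolding C_def by blast
      then show ?thesis
      proof cases
        case 1
        then show ?thesis using C2 ab by blast
      next
        case (2 y k j)
        have y: "y \<in> carrier K" using Hm_car 2(1) .
        note tk = t_car[OF nkj[OF 2(2,3)]] and ta = t_car[OF nkj[OF ab]]
        have assoc: "c \<otimes> t ?n a b = y \<otimes> (t ?n k j \<otimes> t ?n a b)"
          using 2(4) y tk ta by (simp add: m_assoc)
        \<comment> \<open>The coset of \<open>t n k j\<close> depends on \<open>j\<close> alone.\<close>
        have change: "t ?n k j = t j i k \<otimes> t ?n i j" if "i \<noteq> j" "i \<noteq> k" "i \<in> {1..m}" for i
        proof -
          have d4: "distinct [?n, j, k, i]" "{?n, j, k, i} \<subseteq> {1..d}" using nkj[OF 2(2,3)] that 2 m by auto
          have 3: "t ?n j k \<in> carrier K" "t ?n j i \<in> carrier K" "t ?n i j \<in> carrier K"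
            using d4 by (auto intro!: t_car)
          have "t ?n k j = inv (t ?n j k)" "t ?n i j = inv (t ?n j i)"
            using t_inv[of ?n j k] t_inv[of ?n j i] d4 by auto
          then show ?thesis using quot[OF d4] 3 by (simp add: m_assoc flip: quot[OF d4])
        qed
        consider "j \<noteq> a" "j \<noteq> b" | "j = b" "a = k" | "j = b" "a \<noteq> k" | "j = a" "b = k" | "j = a" "b \<noteq> k"
          by blast
        then show ?thesis
        proof cases
          case 1
          let ?c = "cyc3 ?n k j"
          have "t ?n k j \<otimes> t ?n a b \<otimes> inv (t ?n k j) = t (?c ?n) (?c a) (?c b)"
            using t_conj[OF nkj[OF ab] tk] t_im[OF nkj[OF 2(2,3)]] by simp
          moreover have im: "distinct [?c ?n, ?c a, ?c b]" "{?c ?n, ?c a, ?c b} \<subseteq> {1..m}"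
            using 1 ab 2 by (auto simp: cyc3_def)
          ultimately have "t ?n k j \<otimes> t ?n a b = t (?c ?n) (?c a) (?c b) \<otimes> t ?n k j"
            using tk ta t_car[OF im(1) small[OF im(2)]] by (metis inv_solve_right' m_closed)
          then have "c \<otimes> t ?n a b = (y \<otimes> t (?c ?n) (?c a) (?c b)) \<otimes> t ?n k j"
            unfolding assoc using y tk t_car[OF im(1) small[OF im(2)]] by (simp add: m_assoc)
          then show ?thesis using C2 Hm_mult[OF 2(1) H_t[OF im]] 2 by simp
        next
          case 2
          have "t ?n k j \<otimes> t ?n k j = inv (t ?n k j)"
            using t_cube[OF nkj[OF \<open>k \<noteq> j\<close> \<open>{k, j} \<subseteq> {1..m}\<close>]] tk by (metis inv_equality m_closed)
          then have "c \<otimes> t ?n a b = y \<otimes> t ?n j k"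
            unfolding assoc using 2 t_inv[OF nkj[OF \<open>k \<noteq> j\<close> \<open>{k, j} \<subseteq> {1..m}\<close>]] by simp
          then show ?thesis using C2 \<open>y \<in> H m\<close> \<open>k \<noteq> j\<close> \<open>{k, j} \<subseteq> {1..m}\<close> by auto
        next
          case 3
          have im: "distinct [j, a, k]" "{j, a, k} \<subseteq> {1..m}" using 3 2 ab by auto
          have tj: "t j a k \<in> carrier K" using t_car[OF im(1) small[OF im(2)]] .
          have "t ?n a j \<otimes> t ?n a j = inv (t ?n a j)"
            using t_cube[OF nkj[OF ab]] ta 3 by (metis inv_equality m_closed)
          then have sq: "t ?n a j \<otimes> t ?n a j = t ?n j a" using t_inv[OF nkj[OF ab]] 3 by simp
          have "t ?n k j \<otimes> t ?n a b = t j a k \<otimes> (t ?n a j \<otimes> t ?n a j)"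
            using change[of a] 3 ab ta tj by (simp add: m_assoc)
          then have "c \<otimes> t ?n a b = (y \<otimes> t j a k) \<otimes> t ?n j a"
            unfolding assoc sq using y tj nkj[of j a] ab 3 by (simp add: m_assoc t_car)
          then show ?thesis using C2[OF Hm_mult[OF 2(1) H_t[OF im]], of j a] ab 3 by auto
        next
          case 4
          have "t ?n j k = inv (t ?n k j)"
            using t_inv[OF nkj[OF \<open>k \<noteq> j\<close> \<open>{k, j} \<subseteq> {1..m}\<close>]] by simp
          then have "c \<otimes> t ?n a b = y" unfolding assoc using 4 y tk by simp
          then show ?thesis using C1 \<open>y \<in> H m\<close> by simp
        next
          case 5
          have im: "distinct [j, b, k]" "{j, b, k} \<subseteq> {1..m}" using 5 2 ab by auto
          have tj: "t j b k \<in> carrier K" using t_car[OF im(1) small[OF im(2)]] .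
          have bj: "b \<noteq> j" "{b, j} \<subseteq> {1..m}" using ab 5 by auto
          have "t ?n j b = inv (t ?n b j)" using t_inv[OF nkj[OF bj]] by simp
          then have "t ?n k j \<otimes> t ?n a b = t j b k"
            using change[of b] 5 ab tj t_car[OF nkj[OF bj]] by (simp add: m_assoc)
          then have "c \<otimes> t ?n a b = y \<otimes> t j b k" unfolding assoc by simp
          then show ?thesis using C1 Hm_mult[OF 2(1) H_t[OF im]] by simp
        qed
      qed
    qed
    have step_old: "c \<otimes> t a b e \<in> C" if c: "c \<in> C" and abe: "distinct [a, b, e]" "{a, b, e} \<subseteq> {1..m}" for c a b e
    proof -
      consider "c \<in> H m" | y k j where "y \<in> H m" "k \<noteq> j" "{k, j} \<subseteq> {1..m}" "c = y \<otimes> t ?n k j"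
        using c unfolding C_def by blast
      then show ?thesis
      proof cases
        case 1
        then show ?thesis using C1 Hm_mult H_t[OF abe] by blast
      next
        case (2 y k j)
        let ?g = "t a b e"
        have g: "?g \<in> carrier K" using t_car[OF abe(1) small[OF abe(2)]] .
        have y: "y \<in> carrier K" using Hm_car 2(1) .
        note tk = t_car[OF nkj[OF 2(2,3)]]
        let ?q = "p (inv ?g)"
        have aeb: "distinct [a, e, b]" "{a, e, b} \<subseteq> {1..m}" using abe by auto
        have q: "?q = cyc3 a e b"
          using t_inv[OF abe(1) small[OF abe(2)]] t_im[OF aeb(1) small[OF aeb(2)]] by simp
        have "inv ?g \<otimes> t ?n k j \<otimes> ?g = t (?q ?n) (?q k) (?q j)"
          using t_conj[OF nkj[OF 2(2,3)], of "inv ?g"] g by simp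
        moreover have "?q ?n = ?n" using abe unfolding q by (auto simp: cyc3_def)
        ultimately have "t ?n k j \<otimes> ?g = ?g \<otimes> t ?n (?q k) (?q j)"
          using g tk by (metis inv_closed inv_solve_left m_assoc m_closed mult_inv_cancel(1))
        moreover have kj: "?q k \<noteq> ?q j" "{?q k, ?q j} \<subseteq> {1..m}"
          using abe 2 unfolding q by (auto simp: cyc3_def)
        ultimately have "c \<otimes> ?g = (y \<otimes> ?g) \<otimes> t ?n (?q k) (?q j)"
          using 2(4) y g tk t_car[OF nkj[OF kj]] by (simp add: m_assoc)
        then show ?thesis using C2[OF Hm_mult[OF 2(1) H_t[OF abe]] kj] by simp
      qed
    qed
    have step: "c \<otimes> g \<in> C" if c: "c \<in> C" and g: "g \<in> T ?n" for c g
    proof -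
      obtain a b e where g: "g = t a b e" "distinct [a, b, e]" "{a, b, e} \<subseteq> {1..?n}" using T_E[OF g] by blast
      have rot: "t a b e = t b e a" "t a b e = t e a b" using t_rot[of a b e] t_rot[of b e a] g(2) by auto
      consider "{a, b, e} \<subseteq> {1..m}" | "a = ?n" "{b, e} \<subseteq> {1..m}" | "b = ?n" "{e, a} \<subseteq> {1..m}"
        | "e = ?n" "{a, b} \<subseteq> {1..m}"
        using g(2,3) by (force simp: le_Suc_eq)
      then show ?thesis
      proof cases
        case 1
        then show ?thesis using step_old[OF c] g by simp
      next
        case 2
        then show ?thesis using step_new[OF c, of b e] g by simp
      next
        case 3
        then show ?thesis using step_new[OF c, of e a] g rot by simp
      next
        case 4
        then show ?thesis using step_new[OF c, of a b] g rot by simp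
      qed
    qed
    have "\<one> \<in> C" using C1 subgroup.one_closed[OF Hm] .
    moreover have "\<forall>c\<in>C. c \<otimes> h \<in> C"
      using generate_right_invariant[OF h[unfolded H_def] T_car[OF m] C_car T_inv[OF _ m] step] .
    moreover have "h \<in> carrier K" using subgroup.mem_carrier[OF H_sub[OF m] h] .
    ultimately have "h \<in> C" by force
    then show ?thesis unfolding C_def by blast
  qed
  have inj: "h = \<one>" if "h \<in> H m" "m \<le> d" "p h = \<one>\<^bsub>A\<^esub>" for h m
    using that
  proof (induction m arbitrary: h)
    case 0
    have "T 0 = {}" using T_E[of _ 0] by fastforce
    then show ?case using 0 by (simp add: H_def generate_empty)
  next
    case (Suc m)
    have "h \<in> H m"
    proof (rule ccontr)
      assume "h \<notin> H m"
      then obtain y k j where y: "y \<in> H m" "k \<noteq> j" "{k, j} \<subseteq> {1..m}" "h = y \<otimes> t (Suc m) k j"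
        using coset[OF Suc.prems(1,2)] by blast
      have nkj: "distinct [Suc m, k, j]" "{Suc m, k, j} \<subseteq> {1..d}" using y Suc.prems by auto
      have "y \<in> carrier K" using subgroup.mem_carrier[OF H_sub y(1)] Suc.prems by simp
      then have "p h j = p y (cyc3 (Suc m) k j j)"
        using y(4) t_car[OF nkj] t_im[OF nkj] by (simp add: alt_group_mult)
      also have "\<dots> = Suc m" using H_fixes[OF y(1), of "Suc m"] Suc.prems nkj by (simp add: cyc3_def)
      finally have "j = Suc m" using Suc.prems(3) by (simp add: alt_group_one)
      then show False using nkj by simp
    qed
    then show ?case using Suc by simp
  qed
  have onto: "\<exists>h\<in>H d. p h = g" if g: "g \<in> carrier A" for g
    using g unfolding alt_group_carrier_as_three_cycles
  proof induction
    case one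
    show ?case using subgroup.one_closed[OF H_sub[of d]] by (intro bexI[of _ \<one>]) auto
  next
    case (incl g)
    then obtain cs where cs: "g = cycle_of_list cs" "distinct cs" "length cs = 3" "set cs \<subseteq> {1..d}" by blast
    obtain a b c where abc: "cs = [a, b, c]" using stupid_lemma[OF cs(3)] by blast
    have g: "g = cyc3 a b c" using cs abc by (simp add: cyc3_eq_transpose)
    have 1: "distinct [a, b, c]" "{a, b, c} \<subseteq> {1..d}" using cs abc by auto
    show ?case using H_t[OF 1] t_im[OF 1] g by blast
  next
    case (inv g)
    then obtain cs where cs: "g = cycle_of_list cs" "distinct cs" "length cs = 3" "set cs \<subseteq> {1..d}" by blast
    obtain a b c where abc: "cs = [a, b, c]" using stupid_lemma[OF cs(3)] by blast
    have g: "g = cyc3 a b c" using cs abc by (simp add: cyc3_eq_transpose)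
    have 1: "distinct [a, b, c]" "{a, b, c} \<subseteq> {1..d}" using cs abc by auto
    show ?case using subgroup.m_inv_closed[OF H_sub[OF order_refl] H_t[OF 1]] t_im[OF 1] t_car[OF 1] g
      by (intro bexI[of _ "inv (t a b c)"]) (auto simp: image_simps)
  next
    case (eng g1 g2)
    then obtain h1 h2 where h: "h1 \<in> H d" "p h1 = g1" "h2 \<in> H d" "p h2 = g2" by blast
    then have "h1 \<in> carrier K" "h2 \<in> carrier K" using subgroup.mem_carrier[OF H_sub[OF order_refl]] by auto
    then show ?case using h subgroup.m_closed[OF H_sub[OF order_refl] h(1,3)] by (metis p.hom_mult)
  qed
  have "x \<in> H d" using derived_subset_of_section[OF H_sub[OF order_refl] onto] x(1) by blast
  then show ?thesis using inj x(2) by blast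
qed

end

section \<open>The two generators of the kernel\<close>

lemma (in group) pow_reduce:
  assumes "x \<in> carrier G" "x [^] (n::nat) = \<one>"
  shows "x [^] (i::nat) = x [^] (i mod n)"
proof -
  have "x [^] i = x [^] (n * (i div n) + i mod n)" by simp
  also have "\<dots> = (x [^] n) [^] (i div n) \<otimes> x [^] (i mod n)"
    using assms(1) by (simp only: nat_pow_mult nat_pow_pow nat_pow_closed)
  finally show ?thesis using assms by simp
qed

lemma (in central_extension) kernel_subgroup_normal:
  assumes N: "subgroup N K" and N_ker: "\<And>z. z \<in> N \<Longrightarrow> p z = \<one>\<^bsub>G\<^esub>"
  shows "N \<lhd> K"
  unfolding normal_inv_iff
proof (intro conjI N ballI)
  fix x h assume x: "x \<in> carrier K" and h: "h \<in> N"
  then have "h \<in> carrier K" using subgroup.mem_carrier[OF N] by blast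
  then have "x \<otimes> h \<otimes> inv x = h"
    using kernel_central[OF _ N_ker[OF h] x] x by (metis inv_solve_right' m_closed)
  then show "x \<otimes> h \<otimes> inv x \<in> N" using h by simp
qed

lemma (in central_extension) quotient_by_kernel_subgroup:
  assumes N: "subgroup N K" and N_ker: "\<And>z. z \<in> N \<Longrightarrow> p z = \<one>\<^bsub>G\<^esub>"
  obtains q where "central_extension (K Mod N) G q"
    "\<And>x. x \<in> carrier K \<Longrightarrow> q (N #> x) = p x"
proof -
  have N_car: "N \<subseteq> carrier K" using subgroup.subset[OF N] .
  interpret N: normal N K by (rule kernel_subgroup_normal[OF N N_ker])
  have Q: "group (K Mod N)" by (rule N.factorgroup_is_group)
  have car: "carrier (K Mod N) = (\<lambda>x. N #> x) ` carrier K"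
    by (auto simp: FactGroup_def RCOSETS_def)
  have mult: "(N #> x) \<otimes>\<^bsub>K Mod N\<^esub> (N #> y) = N #> (x \<otimes> y)" if "x \<in> carrier K" "y \<in> carrier K" for x y
    using that by (simp add: FactGroup_def N.rcos_sum)
  define q where "q X = the_elem (p ` X)" for X
  have q: "q (N #> x) = p x" if "x \<in> carrier K" for x
  proof -
    have "p ` (N #> x) = {p x}"
    proof -
      have "p (h \<otimes> x) = p x" if "h \<in> N" for h using that N_ker N_car \<open>x \<in> carrier K\<close> by auto
      moreover have "x \<in> N #> x" using rcos_self[OF that N] .
      ultimately show ?thesis unfolding r_coset_def by blast
    qed
    then show ?thesis by (simp add: q_def)
  qed
  have "q \<in> hom (K Mod N) G" by (rule homI) (auto simp: car mult q N.rcos_sum)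
  moreover have "q ` carrier (K Mod N) = carrier G"
    unfolding car image_image using surjective q by (auto simp: image_iff)
  moreover have "z \<otimes>\<^bsub>K Mod N\<^esub> x = x \<otimes>\<^bsub>K Mod N\<^esub> z"
    if z: "z \<in> carrier (K Mod N)" "q z = \<one>\<^bsub>G\<^esub>" "x \<in> carrier (K Mod N)" for z x
  proof -
    obtain a b where "a \<in> carrier K" "z = N #> a" "b \<in> carrier K" "x = N #> b"
      using z(1,3) unfolding car by blast
    then show ?thesis using kernel_central[of a b] z(2) q mult by metis
  qed
  ultimately have "central_extension (K Mod N) G q"
    using Q G.is_group unfolding central_extension_def central_extension_axioms_def by blast
  then show ?thesis using that q by blast
qed

lemma two_by_three:
  "{f i j | i j. i < (2::nat) \<and> j < (3::nat)} = {f 0 0, f 0 1, f 0 2, f 1 0, f 1 1, f 1 2}"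
proof -
  have "{f i j | i j. i < (2::nat) \<and> j < (3::nat)} = (\<lambda>(i, j). f i j) ` ({..<2} \<times> {..<3})"
    by (auto simp: image_iff)
  moreover have "{..<2::nat} = {0, 1}" "{..<3::nat} = {0, 1, 2}" by auto
  ultimately show ?thesis by simp
qed

context alt_extension
begin

text \<open>The two conditions that decide the index; see \<open>card_kernel_inter_derived\<close>.\<close>

definition klein_lifts_commute where
  "klein_lifts_commute \<longleftrightarrow> lifts_commute K p (transpose 1 2 \<circ> transpose 3 4) (transpose 1 3 \<circ> transpose 2 4)"

definition cyc3_lifts_commute where
  "cyc3_lifts_commute \<longleftrightarrow> lifts_commute K p (cyc3 1 2 3) (cyc3 4 5 6)"

text \<open>After dividing out the subgroup generated by \<open>u\<close> and \<open>v\<close>, the hypotheses of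
  \<open>kernel_derived_trivial\<close> hold.\<close>

lemma kernel_inter_derived:
  obtains u v where "u \<in> carrier K" "v \<in> carrier K" "u \<otimes> v = v \<otimes> u"
    "u [^] (2::nat) = \<one>" "v [^] (3::nat) = \<one>" "u = \<one> \<longleftrightarrow> klein_lifts_commute" "v = \<one> \<longleftrightarrow> cyc3_lifts_commute"
    "kernel K A p \<inter> derived K (carrier K) = {u [^] i \<otimes> v [^] j | i j. i < (2::nat) \<and> j < (3::nat)}"
proof -
  have in_A: "transpose 1 2 \<circ> transpose 3 4 \<in> carrier A" "transpose 1 3 \<circ> transpose 2 4 \<in> carrier A"
    "cyc3 1 2 3 \<in> carrier A" "cyc3 4 5 6 \<in> carrier A"
    using d by (auto intro!: transpose_comp_alt cyc3_alt)
  obtain x1 x2 where x: "x1 \<in> carrier K" "p x1 = transpose 1 2 \<circ> transpose 3 4"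
      "x2 \<in> carrier K" "p x2 = transpose 1 3 \<circ> transpose 2 4"
    using obtain_lift[OF in_A(1)] obtain_lift[OF in_A(2)] by metis
  obtain y1 y2 where y: "y1 \<in> carrier K" "p y1 = cyc3 1 2 3" "y2 \<in> carrier K" "p y2 = cyc3 4 5 6"
    using obtain_lift[OF in_A(3)] obtain_lift[OF in_A(4)] by metis
  define u v where "u = commutator x1 x2" and "v = commutator y1 y2"
  have comm: "p x1 \<otimes>\<^bsub>A\<^esub> p x2 = p x2 \<otimes>\<^bsub>A\<^esub> p x1" "p y1 \<otimes>\<^bsub>A\<^esub> p y2 = p y2 \<otimes>\<^bsub>A\<^esub> p y1"
    unfolding x y alt_group_mult by (auto simp: fun_eq_iff transpose_def cyc3_def)
  have u: "u \<in> carrier K" "p u = \<one>\<^bsub>A\<^esub>" and v: "v \<in> carrier K" "p v = \<one>\<^bsub>A\<^esub>"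
    using x y comm commutator_kernel by (auto simp: u_def v_def)
  have "p x1 [^]\<^bsub>A\<^esub> (2::nat) = \<one>\<^bsub>A\<^esub>"
    unfolding x by (auto simp: numeral_2_eq_2 alt_group_mult alt_group_one fun_eq_iff transpose_def)
  then have u2: "u [^] (2::nat) = \<one>" unfolding u_def by (rule commutator_pow[OF x(1,3) comm(1)])
  have "p y1 [^]\<^bsub>A\<^esub> (3::nat) = \<one>\<^bsub>A\<^esub>" unfolding y by (rule cyc3_cubed) simp
  then have v3: "v [^] (3::nat) = \<one>" unfolding v_def by (rule commutator_pow[OF y(1,3) comm(2)])
  have uv: "u \<otimes> v = v \<otimes> u" using kernel_central[OF u v(1)] .
  have uU: "u = \<one> \<longleftrightarrow> klein_lifts_commute"
    using commutator_one_iff[OF x(1,3)] lifts_commute_iff[OF x(1,3)] unfolding u_def klein_lifts_commute_def x by simp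
  have vV: "v = \<one> \<longleftrightarrow> cyc3_lifts_commute"
    using commutator_one_iff[OF y(1,3)] lifts_commute_iff[OF y(1,3)] unfolding v_def cyc3_lifts_commute_def y by simp
  define N where "N = {u [^] i \<otimes> v [^] j | i j. i < (2::nat) \<and> j < (3::nat)}"
  have N_E: "\<exists>i j. z = u [^] i \<otimes> v [^] j \<and> i < (2::nat) \<and> j < (3::nat)" if "z \<in> N" for z
    using that unfolding N_def by blast
  have N_I: "u [^] i \<otimes> v [^] j \<in> N" for i j :: nat
  proof -
    have "u [^] i = u [^] (i mod 2)" "v [^] j = v [^] (j mod 3)"
      using pow_reduce[OF u(1) u2] pow_reduce[OF v(1) v3] by auto
    then show ?thesis unfolding N_def by (intro CollectI exI[of _ "i mod 2"] exI[of _ "j mod 3"]) simp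
  qed
  have u_N: "u \<in> N" and v_N: "v \<in> N"
    using N_I[of 1 0] N_I[of 0 1] u v by simp_all
  have prod: "(u [^] i \<otimes> v [^] j) \<otimes> (u [^] k \<otimes> v [^] l) = u [^] (i + k) \<otimes> v [^] (j + l)" for i j k l :: nat
  proof -
    have "v [^] j \<otimes> u [^] k = u [^] k \<otimes> v [^] j"
      using kernel_central[of "v [^] j" "u [^] k"] u v by (simp add: image_simps)
    then have "v [^] j \<otimes> (u [^] k \<otimes> v [^] l) = u [^] k \<otimes> (v [^] j \<otimes> v [^] l)"
      using u v by (metis m_assoc nat_pow_closed)
    then show ?thesis using u v by (simp add: m_assoc nat_pow_mult[symmetric])
  qed
  have N: "subgroup N K"
  proof (rule subgroupI)
    show "N \<subseteq> carrier K" using N_E u v by fastforce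
    show "N \<noteq> {}" using u_N by blast
    show "inv a \<in> N" if "a \<in> N" for a
    proof -
      obtain i j where a: "a = u [^] i \<otimes> v [^] (j::nat)" "i < (2::nat)" using N_E[OF \<open>a \<in> N\<close>] by blast
      have "u [^] (i + i) = \<one>" "v [^] (2 * j + j) = \<one>"
        using pow_reduce[OF u(1) u2, of "i + i"] pow_reduce[OF v(1) v3, of "2 * j + j"]
        by (simp_all flip: mult_2 mult_Suc)
      then have "(u [^] i \<otimes> v [^] (2 * j)) \<otimes> a = \<one>" unfolding a prod by simp
      then have "inv a = u [^] i \<otimes> v [^] (2 * j)" using a u v by (simp add: inv_equality)
      then show ?thesis using N_I by simp
    qed
    show "a \<otimes> b \<in> N" if "a \<in> N" "b \<in> N" for a b
    proof -
      obtain i j :: nat where a: "a = u [^] i \<otimes> v [^] j" using N_E[OF \<open>a \<in> N\<close>] by blast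
      obtain k l :: nat where b: "b = u [^] k \<otimes> v [^] l" using N_E[OF \<open>b \<in> N\<close>] by blast
      show ?thesis unfolding a b prod by (rule N_I)
    qed
  qed
  have N_ker: "p z = \<one>\<^bsub>A\<^esub>" if z: "z \<in> N" for z
  proof -
    obtain i j :: nat where "z = u [^] i \<otimes> v [^] j" using N_E[OF z] by blast
    then show ?thesis using u v by (simp add: image_simps)
  qed
  obtain q where "central_extension (K Mod N) A q" and q: "\<And>x. x \<in> carrier K \<Longrightarrow> q (N #> x) = p x"
    using quotient_by_kernel_subgroup[OF N N_ker] by blast
  then interpret Q: alt_extension "K Mod N" d q
    using d by (simp add: alt_extension_def alt_extension_axioms_def)
  interpret N: normal N K by (rule kernel_subgroup_normal[OF N N_ker])
  have mult: "(N #> x) \<otimes>\<^bsub>K Mod N\<^esub> (N #> y) = N #> (x \<otimes> y)" if "x \<in> carrier K" "y \<in> carrier K" for x y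
    using that by (simp add: FactGroup_def N.rcos_sum)
  have car: "carrier (K Mod N) = (\<lambda>x. N #> x) ` carrier K"
    by (auto simp: FactGroup_def RCOSETS_def)
  have collapse: "lifts_commute (K Mod N) q (p a) (p b)"
    if ab: "a \<in> carrier K" "b \<in> carrier K" and c: "commutator a b \<in> N" for a b
  proof -
    have "N #> (a \<otimes> b) = (N #> commutator a b) #> (b \<otimes> a)"
      using commutator_swap[OF ab] ab by (simp add: coset_mult_assoc N.subset)
    also have "N #> commutator a b = N" using coset_join2[OF _ N c] ab by simp
    finally have "N #> (a \<otimes> b) = N #> (b \<otimes> a)" .
    then show ?thesis
      using Q.lifts_commuteI[of "N #> a" "N #> b"] ab by (simp add: mult q car N.rcos_sum)
  qed
  have QU: "lifts_commute (K Mod N) q (transpose 1 2 \<circ> transpose 3 4) (transpose 1 3 \<circ> transpose 2 4)"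
    using collapse[OF x(1,3)] u_N unfolding u_def x by simp
  have QV: "lifts_commute (K Mod N) q (cyc3 1 2 3) (cyc3 4 5 6)"
    using collapse[OF y(1,3)] v_N unfolding v_def y by simp
  have "kernel K A p \<inter> derived K (carrier K) = N"
  proof
    show "kernel K A p \<inter> derived K (carrier K) \<subseteq> N"
    proof
      fix x assume x: "x \<in> kernel K A p \<inter> derived K (carrier K)"
      then have xK: "x \<in> carrier K" "p x = \<one>\<^bsub>A\<^esub>" "x \<in> derived K (carrier K)" by (auto simp: kernel_def)
      interpret r: group_hom K "K Mod N" "\<lambda>x. N #> x"
        using N.r_coset_hom_Mod N.factorgroup_is_group is_group
        by (simp add: group_hom_def group_hom_axioms_def)
      have "derived (K Mod N) (carrier (K Mod N)) = (\<lambda>x. N #> x) ` derived K (carrier K)"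
        unfolding car by (rule r.derived_img) simp
      then have "N #> x \<in> derived (K Mod N) (carrier (K Mod N))" using xK by blast
      then have "N #> x = \<one>\<^bsub>K Mod N\<^esub>"
        using Q.kernel_derived_trivial[OF QU QV] q[OF xK(1)] xK(2) by simp
      then show "x \<in> N" using xK(1) rcos_self[OF xK(1) N] by (simp add: FactGroup_def)
    qed
    have D: "subgroup (derived K (carrier K)) K" by (rule derived_is_subgroup) simp
    have "u \<in> derived K (carrier K)" "v \<in> derived K (carrier K)"
      using x y unfolding derived_def u_def v_def commutator_def by (blast intro: generate.incl)+
    moreover have "a [^] i \<in> derived K (carrier K)" if "a \<in> derived K (carrier K)" for a and i :: nat
      using that by (induction i) (simp_all add: subgroup.one_closed[OF D] subgroup.m_closed[OF D])
    ultimately have "u [^] i \<otimes> v [^] j \<in> derived K (carrier K)" for i j :: nat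
      by (simp add: subgroup.m_closed[OF D])
    then have "N \<subseteq> derived K (carrier K)" using N_E by blast
    then show "N \<subseteq> kernel K A p \<inter> derived K (carrier K)"
      using N_ker subgroup.mem_carrier[OF N] by (auto simp: kernel_def)
  qed
  then show ?thesis using that[OF u(1) v(1) uv u2 v3 uU vV] unfolding N_def by blast
qed

theorem card_kernel_inter_derived:
  "card (kernel K A p \<inter> derived K (carrier K)) = (if klein_lifts_commute then 1 else 2) * (if cyc3_lifts_commute then 1 else 3)"
proof -
  obtain u v where u: "u \<in> carrier K" "u [^] (2::nat) = \<one>" "u = \<one> \<longleftrightarrow> klein_lifts_commute"
    and v: "v \<in> carrier K" "v [^] (3::nat) = \<one>" "v = \<one> \<longleftrightarrow> cyc3_lifts_commute"
    and uv: "u \<otimes> v = v \<otimes> u"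
    and eq: "kernel K A p \<inter> derived K (carrier K) = {u [^] i \<otimes> v [^] j | i j. i < (2::nat) \<and> j < (3::nat)}"
    by (rule kernel_inter_derived) blast
  have vv: "v \<otimes> v \<otimes> v = \<one>" using v by (simp add: numeral_3_eq_3)
  have uu: "u \<otimes> u = \<one>" using u by (simp add: numeral_2_eq_2)
  have set: "{u [^] i \<otimes> v [^] j | i j. i < (2::nat) \<and> j < (3::nat)} =
      {\<one>, v, v \<otimes> v, u, u \<otimes> v, u \<otimes> (v \<otimes> v)}"
  proof -
    note two_by_three[of "\<lambda>i j. u [^] i \<otimes> v [^] j"]
    then show ?thesis using u(1) v(1) by (simp add: numeral_2_eq_2)
  qed
  show ?thesis
  proof (cases cyc3_lifts_commute)
    case True
    then have v1: "v = \<one>" using v by simp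
    show ?thesis unfolding eq set using True u by (auto simp: v1)
  next
    case cyc3_lifts_commute: False
    then have v1: "v \<noteq> \<one>" using v by simp
    have vv1: "v \<otimes> v \<noteq> \<one>" using vv v1 v by auto
    have vvv: "v \<otimes> v \<noteq> v" using v1 v by simp
    show ?thesis
    proof (cases klein_lifts_commute)
      case True
      then have "u = \<one>" using u by simp
      then have "{\<one>, v, v \<otimes> v, u, u \<otimes> v, u \<otimes> (v \<otimes> v)} = {\<one>, v, v \<otimes> v}" using v by auto
      moreover have "card {\<one>, v, v \<otimes> v} = 3" using v(1) v1 vv1 vvv[symmetric] by (simp add: card_insert_if)
      ultimately show ?thesis unfolding eq set using True cyc3_lifts_commute by simp
    next
      case False
      then have u1: "u \<noteq> \<one>" using u by simp
      \<comment> \<open>The power \<open>v\<close> has order 3, so no power of \<open>v\<close> equals \<open>u\<close>, which has order 2.\<close>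
      have uv1: "u \<noteq> v" using uu vv1 by auto
      have uv2: "u \<noteq> v \<otimes> v"
      proof
        assume "u = v \<otimes> v"
        then have "(v \<otimes> v) \<otimes> (v \<otimes> v) = \<one>" using uu by simp
        then have "(v \<otimes> v \<otimes> v) \<otimes> v = \<one>" using v by (simp add: m_assoc)
        then show False using vv v v1 by simp
      qed
      have uw: "u \<otimes> a = b \<Longrightarrow> u \<otimes> b = a" if "a \<in> carrier K" for a b
        using uu u that by (metis l_one m_assoc)
      have n1: "u \<otimes> v \<noteq> \<one>" "u \<otimes> v \<noteq> v \<otimes> v" "u \<otimes> (v \<otimes> v) \<noteq> \<one>" "u \<otimes> (v \<otimes> v) \<noteq> v"
      proof -
        show "u \<otimes> v \<noteq> \<one>" using uw[of v \<one>] uv1 u v by auto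
        show "u \<otimes> v \<noteq> v \<otimes> v" using uv1 u v by simp
        show "u \<otimes> (v \<otimes> v) \<noteq> \<one>" using uw[of "v \<otimes> v" \<one>] uv2 u v by auto
        show "u \<otimes> (v \<otimes> v) \<noteq> v"
        proof
          assume "u \<otimes> (v \<otimes> v) = v"
          then have "(u \<otimes> v) \<otimes> v = \<one> \<otimes> v" using u v by (simp add: m_assoc)
          then have "u \<otimes> v = \<one>" using u v by (metis m_closed one_closed right_cancel)
          then show False using \<open>u \<otimes> v \<noteq> \<one>\<close> by simp
        qed
      qed
      have "card {\<one>, v, v \<otimes> v, u, u \<otimes> v, u \<otimes> (v \<otimes> v)} = 6"
        using u v v1 u1 vv1 vvv uv1 uv2 n1 by (auto simp: card_insert_if)
      then show ?thesis unfolding eq set using False cyc3_lifts_commute by simp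
    qed
  qed
qed

end

section \<open>A double cover from the Clifford algebra\<close>

type_synonym spinor = "nat set \<Rightarrow> real"

text \<open>The action of the \<open>i\<close>-th generator of a Clifford algebra on functions on sets of naturals: it
  toggles membership of \<open>i\<close>, with the sign that is usual for the sum of a fermionic creation and
  annihilation operator. This sign makes different generators anticommute.\<close>

definition cliff :: "nat \<Rightarrow> spinor \<Rightarrow> spinor" where
  "cliff i v S = (-1) ^ card {j \<in> S. j < i} * v (if i \<in> S then S - {i} else insert i S)"

lemma cliff_diff: "cliff i (v - w) = cliff i v - cliff i w"
  by (rule ext) (simp add: cliff_def algebra_simps)

lemma cliff_square [simp]: "cliff i (cliff i v) = v"
proof
  fix S
  have "{j \<in> S - {i}. j < i} = {j \<in> S. j < i}" "{j \<in> insert i S. j < i} = {j \<in> S. j < i}"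
    by auto
  then show "cliff i (cliff i v) S = v S"
    by (cases "i \<in> S") (simp_all add: cliff_def insert_absorb)
qed

lemma cliff_anticommute:
  assumes "i \<noteq> j"
  shows "cliff i (cliff j v) = - cliff j (cliff i v)"
proof -
  have *: "cliff i (cliff j v) S = - cliff j (cliff i v) S" if "i < j" for i j S
  proof -
    let ?f = "\<lambda>i S. if i \<in> S then S - {i} else insert i S"
    have fin: "finite {k \<in> S. k < n}" for n :: nat by (rule finite_subset[of _ "{..<n}"]) auto
    have "{k \<in> ?f j S. k < i} = {k \<in> S. k < i}" using that by auto
    moreover have "{k \<in> ?f i S. k < j} = (if i \<in> S then {k \<in> S. k < j} - {i} else insert i {k \<in> S. k < j})"
      using that by auto
    then have "(-1::real) ^ card {k \<in> ?f i S. k < j} = - ((-1) ^ card {k \<in> S. k < j})"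
    proof (cases "i \<in> S")
      case True
      then have "card {k \<in> S. k < j} = Suc (card ({k \<in> S. k < j} - {i}))"
        using fin that by (intro card.remove) auto
      then show ?thesis using True \<open>{k \<in> ?f i S. k < j} = _\<close> by simp
    next
      case False
      then show ?thesis using fin \<open>{k \<in> ?f i S. k < j} = _\<close> by simp
    qed
    moreover have "?f j (?f i S) = ?f i (?f j S)" using that by auto
    ultimately show ?thesis unfolding cliff_def by (simp only: mult.assoc) (simp add: mult.left_commute)
  qed
  show ?thesis
  proof
    fix S
    show "cliff i (cliff j v) S = (- cliff j (cliff i v)) S"
    proof (cases "i < j")
      case False
      then have "j < i" using assms by simp
      then show ?thesis using *[of j i S] by simp
    qed (simp add: *)
  qed
qed

text \<open>Conjugation by the vector \<open>e\<^sub>i - e\<^sub>j\<close> is, up to sign, the reflection that exchanges \<open>e\<^sub>i\<close> and \<open>e\<^sub>j\<close>,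
  so that products of two such vectors realize products of two transpositions.\<close>

definition root_op :: "nat \<Rightarrow> nat \<Rightarrow> spinor \<Rightarrow> spinor" where
  "root_op i j v = cliff i v - cliff j v"

lemma root_op_cliff:
  assumes "i \<noteq> j"
  shows "root_op i j (cliff k v) = - cliff (transpose i j k) (root_op i j v)"
proof -
  consider "k = i" | "k = j" | "k \<noteq> i" "k \<noteq> j" by blast
  then show ?thesis
  proof cases
    case 1
    then show ?thesis using assms cliff_anticommute[OF assms, of v]
      by (simp add: root_op_def cliff_diff)
  next
    case 2
    then show ?thesis using assms cliff_anticommute[OF assms, of v]
      by (simp add: root_op_def cliff_diff)
  next
    case 3
    then show ?thesis using cliff_anticommute[of i k v] cliff_anticommute[of j k v]
      by (simp add: root_op_def cliff_diff)
  qed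
qed

lemma root_op_square:
  "i \<noteq> j \<Longrightarrow> root_op i j (root_op i j v) = v + v"
  using cliff_anticommute[of i j v] by (simp add: root_op_def cliff_diff algebra_simps)

lemma root_op_anticommute:
  assumes "{i, j} \<inter> {k, l} = {}" "i \<noteq> j"
  shows "root_op i j (root_op k l v) = - root_op k l (root_op i j v)"
proof -
  have "root_op i j (v - w) = root_op i j v - root_op i j w" for v w
    by (simp add: root_op_def cliff_diff)
  then show ?thesis
    using assms root_op_cliff[OF assms(2), of k v] root_op_cliff[OF assms(2), of l v]
    by (simp add: root_op_def[of k l])
qed

text \<open>Additivity, in the form in which it applies to \<open>root_op\<close>.\<close>

definition difference_preserving :: "(spinor \<Rightarrow> spinor) \<Rightarrow> bool" where
  "difference_preserving L \<longleftrightarrow> (\<forall>v w. L (v - w) = L v - L w)"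

lemma difference_preservingD: "difference_preserving L \<Longrightarrow> L (v - w) = L v - L w"
  by (simp add: difference_preserving_def)

lemma difference_preserving_minus: "difference_preserving L \<Longrightarrow> L (- v) = - L v"
  using difference_preservingD[of L 0 v] difference_preservingD[of L 0 0] by simp

lemma root_op_diff: "difference_preserving (root_op i j)"
  by (simp add: difference_preserving_def root_op_def cliff_diff)

lemma bij_root_op:
  assumes "i \<noteq> j"
  shows "bij (root_op i j)"
proof (rule bijI)
  show "inj (root_op i j)"
  proof (rule injI)
    fix v w assume "root_op i j v = root_op i j w"
    then have "v + v = w + w" using root_op_square[OF assms] by metis
    then have "v S + v S = w S + w S" for S by (metis plus_fun_apply)
    then show "v = w" by (intro ext) (metis field_sum_of_halves mult_2 mult_cancel_left zero_neq_numeral)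
  qed
  show "surj (root_op i j)"
  proof (rule surjI)
    fix v :: spinor
    let ?h = "\<lambda>S. v S / 2"
    have "root_op i j (root_op i j ?h) = v" unfolding root_op_square[OF assms] by (rule ext) simp
    then show "root_op i j (root_op i j (\<lambda>S. v S / 2)) = v" .
  qed
qed

definition commutant :: "(spinor \<Rightarrow> spinor) set" where
  "commutant = {M. difference_preserving M \<and> (\<forall>i v. M (cliff i v) = cliff i (M v))}"

text \<open>An operator \<open>L\<close> lies over \<open>\<pi>\<close> if conjugation by \<open>L\<close> permutes the Clifford generators like \<open>\<pi>\<close>.
  The last condition, that \<open>L\<close> commutes with the commutant of the Clifford action, takes the role of
  membership in the algebra: an operator over the identity belongs to the commutant, so the kernel is
  central. The kernel contains the nonzero rational scalars; only the commutators in it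
  matter.\<close>

definition spin :: "nat \<Rightarrow> ((nat \<Rightarrow> nat) \<times> (spinor \<Rightarrow> spinor)) monoid" where
  "spin d = \<lparr>carrier = {(\<pi>, L). \<pi> \<in> carrier (alt_group d) \<and> bij L \<and> difference_preserving L \<and>
        (\<forall>i v. L (cliff i v) = cliff (\<pi> i) (L v)) \<and> (\<forall>M\<in>commutant. L \<circ> M = M \<circ> L)},
     mult = (\<lambda>(\<pi>, L) (\<sigma>, M). (\<pi> \<circ> \<sigma>, L \<circ> M)),
     one = (id, id)\<rparr>"

lemma spin_carrier:
  "(\<pi>, L) \<in> carrier (spin d) \<longleftrightarrow> \<pi> \<in> carrier (alt_group d) \<and> bij L \<and> difference_preserving L \<and>
        (\<forall>i v. L (cliff i v) = cliff (\<pi> i) (L v)) \<and> (\<forall>M\<in>commutant. L \<circ> M = M \<circ> L)"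
  by (simp add: spin_def)

lemma spin_mult: "(\<pi>, L) \<otimes>\<^bsub>spin d\<^esub> (\<sigma>, M) = (\<pi> \<circ> \<sigma>, L \<circ> M)"
  by (simp add: spin_def)

lemma spin_one: "\<one>\<^bsub>spin d\<^esub> = (id, id)"
  by (simp add: spin_def)

lemma spin_group: "group (spin d)"
proof (rule groupI)
  interpret A: group "alt_group d" by (rule alt_group_is_group)
  fix x y z assume "x \<in> carrier (spin d)" "y \<in> carrier (spin d)" "z \<in> carrier (spin d)"
  moreover obtain \<pi> L \<sigma> M \<tau> N where *: "x = (\<pi>, L)" "y = (\<sigma>, M)" "z = (\<tau>, N)" by (metis surj_pair)
  ultimately have x: "(\<pi>, L) \<in> carrier (spin d)" and y: "(\<sigma>, M) \<in> carrier (spin d)" by auto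
  have "L \<circ> M \<circ> C = C \<circ> (L \<circ> M)" if "C \<in> commutant" for C
  proof -
    have LC: "L \<circ> C = C \<circ> L" and MC: "M \<circ> C = C \<circ> M"
      using x y that unfolding spin_carrier by auto
    have "L \<circ> M \<circ> C = L \<circ> C \<circ> M" unfolding comp_assoc MC ..
    then show ?thesis unfolding LC comp_assoc .
  qed
  then show "x \<otimes>\<^bsub>spin d\<^esub> y \<in> carrier (spin d)"
    using x y unfolding * spin_mult unfolding spin_carrier
    by (auto simp: alt_comp bij_comp difference_preserving_def)
  show "x \<otimes>\<^bsub>spin d\<^esub> y \<otimes>\<^bsub>spin d\<^esub> z = x \<otimes>\<^bsub>spin d\<^esub> (y \<otimes>\<^bsub>spin d\<^esub> z)"
    unfolding * spin_mult by (simp add: comp_assoc)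
  show "\<one>\<^bsub>spin d\<^esub> \<otimes>\<^bsub>spin d\<^esub> x = x" unfolding * spin_one spin_mult by simp
  have \<pi>: "\<pi> \<in> carrier (alt_group d)" and L: "bij L" "difference_preserving L"
    "\<And>i v. L (cliff i v) = cliff (\<pi> i) (L v)" "\<And>C. C \<in> commutant \<Longrightarrow> L \<circ> C = C \<circ> L"
    using x unfolding spin_carrier by auto
  have inv_L: "L (inv' L v) = v" "inv' L (L v) = v" for v
    using L(1) by (simp_all add: bij_is_surj surj_f_inv_f bij_is_inj)
  have inv_\<pi>: "\<pi> (inv' \<pi> i) = i" for i using alt_bij[OF \<pi>] by (simp add: bij_is_surj surj_f_inv_f)
  have "difference_preserving (inv' L)"
    unfolding difference_preserving_def using L(2) inv_L by (metis difference_preservingD)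
  moreover have "inv' L (cliff i v) = cliff (inv' \<pi> i) (inv' L v)" for i v
    using L(3)[of "inv' \<pi> i" "inv' L v"] inv_L inv_\<pi> by metis
  moreover have "inv' L \<circ> C = C \<circ> inv' L" if "C \<in> commutant" for C
  proof
    fix v
    have "L (C (inv' L v)) = C v" using L(4)[OF that] inv_L by (metis comp_apply)
    then show "(inv' L \<circ> C) v = (C \<circ> inv' L) v" using inv_L by (metis comp_apply)
  qed
  ultimately have "(inv' \<pi>, inv' L) \<in> carrier (spin d)"
    unfolding spin_carrier using L(1) alt_group_inv_closed[OF \<pi>] by (simp add: bij_imp_bij_inv)
  moreover have "(inv' \<pi>, inv' L) \<otimes>\<^bsub>spin d\<^esub> x = \<one>\<^bsub>spin d\<^esub>"
    unfolding * spin_mult spin_one using L(1) alt_bij[OF \<pi>] by (simp add: bij_is_inj)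
  ultimately show "\<exists>y\<in>carrier (spin d). y \<otimes>\<^bsub>spin d\<^esub> x = \<one>\<^bsub>spin d\<^esub>" by blast
next
  show "\<one>\<^bsub>spin d\<^esub> \<in> carrier (spin d)"
    unfolding spin_one spin_carrier by (simp add: alt_group_carrier permutes_id difference_preserving_def)
qed

lemma spin_root_op:
  assumes "(\<pi>, L) \<in> carrier (spin d)"
  shows "L (root_op i j v) = root_op (\<pi> i) (\<pi> j) (L v)"
proof -
  have L: "difference_preserving L" "\<And>i. L (cliff i v) = cliff (\<pi> i) (L v)"
    using assms unfolding spin_carrier by auto
  show ?thesis unfolding root_op_def difference_preservingD[OF L(1)] L(2) ..
qed

lemma root_ops_in_spin:
  assumes "a \<noteq> b" "c \<noteq> e" "{a, b, c, e} \<subseteq> {1..d}"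
  shows "(transpose a b \<circ> transpose c e, root_op a b \<circ> root_op c e) \<in> carrier (spin d)"
proof -
  have comm: "root_op i j (C v) = C (root_op i j v)" if "C \<in> commutant" for C i j v
  proof -
    have C: "difference_preserving C" "\<And>i. C (cliff i v) = cliff i (C v)"
      using that unfolding commutant_def by auto
    show ?thesis unfolding root_op_def difference_preservingD[OF C(1)] C(2) ..
  qed
  have "root_op a b \<circ> root_op c e \<circ> C = C \<circ> (root_op a b \<circ> root_op c e)" if "C \<in> commutant" for C
    by (rule ext) (simp add: comm[OF that])
  moreover have "difference_preserving (root_op a b \<circ> root_op c e)"
    unfolding difference_preserving_def comp_apply difference_preservingD[OF root_op_diff] by blast
  moreover have "(root_op a b \<circ> root_op c e) (cliff i v) =
      cliff ((transpose a b \<circ> transpose c e) i) ((root_op a b \<circ> root_op c e) v)" for i v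
    unfolding comp_apply root_op_cliff[OF assms(2)] difference_preserving_minus[OF root_op_diff]
      root_op_cliff[OF assms(1)] by simp
  ultimately show ?thesis
    unfolding spin_carrier
    using transpose_comp_alt[OF assms] bij_comp[OF bij_root_op[OF assms(2)] bij_root_op[OF assms(1)]]
    by blast
qed

lemma spin_extension: "central_extension (spin d) (alt_group d) fst"
proof -
  interpret A: group "alt_group d" by (rule alt_group_is_group)
  interpret S: group "spin d" by (rule spin_group)
  have hom: "fst \<in> hom (spin d) (alt_group d)"
    by (rule homI) (auto simp: spin_carrier spin_mult alt_group_mult)
  interpret h: group_hom "spin d" "alt_group d" fst by unfold_locales (rule hom)
  have "three_cycles d \<subseteq> fst ` carrier (spin d)"
  proof
    fix g assume "g \<in> three_cycles d"
    then obtain cs where cs: "g = cycle_of_list cs" "distinct cs" "length cs = 3" "set cs \<subseteq> {1..d}" by blast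
    obtain a b c where abc: "cs = [a, b, c]" using stupid_lemma[OF cs(3)] by blast
    then have "(g, root_op a b \<circ> root_op b c) \<in> carrier (spin d)"
      using root_ops_in_spin[of a b b c d] cs by simp
    then show "g \<in> fst ` carrier (spin d)" by force
  qed
  then have "generate (alt_group d) (three_cycles d) \<subseteq> fst ` carrier (spin d)"
    by (rule A.generate_subgroup_incl) (rule h.img_is_subgroup)
  then have "fst ` carrier (spin d) = carrier (alt_group d)"
    using hom_carrier[OF hom] unfolding alt_group_carrier_as_three_cycles by blast
  moreover have "z \<otimes>\<^bsub>spin d\<^esub> x = x \<otimes>\<^bsub>spin d\<^esub> z"
    if "z \<in> carrier (spin d)" "fst z = \<one>\<^bsub>alt_group d\<^esub>" "x \<in> carrier (spin d)" for z x
  proof -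
    obtain L \<pi> M where zx: "z = (id, L)" "x = (\<pi>, M)"
      using \<open>fst z = _\<close> by (metis alt_group_one prod.collapse)
    have "L \<in> commutant" using that(1) unfolding zx spin_carrier commutant_def by simp
    then show ?thesis using that(3) unfolding zx spin_carrier spin_mult by simp
  qed
  ultimately show ?thesis
    using S.is_group A.is_group hom unfolding central_extension_def central_extension_axioms_def by blast
qed

lemma spin_alt_extension:
  assumes "6 \<le> d" "d \<le> 7"
  shows "alt_extension (spin d) d fst"
  using spin_extension assms by (simp add: alt_extension_def alt_extension_axioms_def)

text \<open>Conjugating \<open>(e\<^sub>1 - e\<^sub>3)(e\<^sub>2 - e\<^sub>4)\<close> by a lift of \<open>(1 2)(3 4)\<close> exchanges the two factors, and these
  anticommute.\<close>

lemma spin_klein_lifts_not_commute: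
  assumes "6 \<le> d" "d \<le> 7"
  shows "\<not> alt_extension.klein_lifts_commute (spin d) fst"
proof
  interpret alt_extension "spin d" d fst by (rule spin_alt_extension[OF assms])
  let ?x = "(transpose 1 2 \<circ> transpose 3 4, root_op 1 2 \<circ> root_op 3 4)"
  let ?y = "(transpose 1 3 \<circ> transpose 2 4, root_op 1 3 \<circ> root_op 2 4)"
  have x: "?x \<in> carrier (spin d)" and y: "?y \<in> carrier (spin d)"
    using d by (auto intro!: root_ops_in_spin)
  assume klein_lifts_commute
  then have "?x \<otimes>\<^bsub>spin d\<^esub> ?y = ?y \<otimes>\<^bsub>spin d\<^esub> ?x"
    using x y unfolding klein_lifts_commute_def lifts_commute_def by (metis fst_conv)
  let ?L = "root_op 1 2 \<circ> root_op 3 4" and ?M = "root_op 1 3 \<circ> root_op 2 4"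
  from \<open>?x \<otimes>\<^bsub>spin d\<^esub> ?y = ?y \<otimes>\<^bsub>spin d\<^esub> ?x\<close> have LM: "?L (?M v) = ?M (?L v)" for v
    unfolding spin_mult by (metis comp_apply snd_conv)
  have bij: "bij (?M \<circ> ?L)" by (intro bij_comp bij_root_op) auto
  then obtain v where v: "(?M \<circ> ?L) v = (\<lambda>S. 1)" by (metis bij_pointE)
  have "?L (?M v) = root_op 2 4 (root_op 1 3 (?L v))"
    using spin_root_op[OF x, of 1 3] spin_root_op[OF x, of 2 4] by (simp add: transpose_def)
  also have "\<dots> = - ?M (?L v)"
    using root_op_anticommute[of 2 4 1 3] by simp
  finally have "?M (?L v) = - ?M (?L v)" using LM by simp
  then have "?M (?L v) {} = - (?M (?L v) {})" by (metis uminus_apply)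
  moreover have "?M (?L v) {} = 1" using fun_cong[OF v, of "{}"] by simp
  ultimately show False by simp
qed

lemma spin_cyc3_lifts_commute:
  assumes "6 \<le> d" "d \<le> 7"
  shows "alt_extension.cyc3_lifts_commute (spin d) fst"
proof -
  interpret alt_extension "spin d" d fst by (rule spin_alt_extension[OF assms])
  let ?x = "(transpose 1 2 \<circ> transpose 2 3, root_op 1 2 \<circ> root_op 2 3)"
  let ?y = "(transpose 4 5 \<circ> transpose 5 6, root_op 4 5 \<circ> root_op 5 6)"
  have x: "?x \<in> carrier (spin d)" and y: "?y \<in> carrier (spin d)"
    using d by (auto intro!: root_ops_in_spin)
  have "(root_op 1 2 \<circ> root_op 2 3) (root_op i j v) = root_op i j ((root_op 1 2 \<circ> root_op 2 3) v)"
    if "i > 3" "j > 3" for i j v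
    using spin_root_op[OF x, of i j v] that by (simp add: transpose_def)
  note L = this[unfolded comp_apply]
  have "(root_op 1 2 \<circ> root_op 2 3) \<circ> (root_op 4 5 \<circ> root_op 5 6) =
      (root_op 4 5 \<circ> root_op 5 6) \<circ> (root_op 1 2 \<circ> root_op 2 3)"
    by (rule ext) (simp add: L del: One_nat_def)
  moreover have "(transpose 1 2 \<circ> transpose 2 3) \<circ> (transpose 4 5 \<circ> transpose 5 6) =
      (transpose 4 5 \<circ> transpose 5 6) \<circ> (transpose 1 2 \<circ> transpose 2 (3::nat))"
    by (rule ext) (simp add: transpose_def)
  ultimately have "?x \<otimes>\<^bsub>spin d\<^esub> ?y = ?y \<otimes>\<^bsub>spin d\<^esub> ?x" unfolding spin_mult by simp
  then have "lifts_commute (spin d) fst (fst ?x) (fst ?y)" by (rule lifts_commuteI[OF x y])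
  then show ?thesis by (simp add: cyc3_lifts_commute_def cyc3_eq_transpose)
qed

section \<open>A triple cover from the Conway--Smith graph\<close>

text \<open>A function on the ordered pairs of disjoint duads \<open>{i, j}\<close> and \<open>{k, l}\<close> of seven points: the sign of
  the representative of least absolute value of \<open>(k + l - i - j)(i - j)\<^sup>2\<close> modulo 7. Read modulo 3 it is
  a voltage assignment on the Kneser graph of the 21 duads, and the associated 3-fold covering graph
  on 63 vertices is the Conway--Smith graph, on which a triple cover of the alternating group of
  degree 7 acts.\<close>

definition voltage :: "nat \<Rightarrow> nat \<Rightarrow> nat \<Rightarrow> nat \<Rightarrow> int" where
  "voltage i j k l =
    (let t = (int k + int l - int i - int j) * (int i - int j)^2 mod 7
     in if t = 0 then 0 else if t \<le> 3 then 1 else - 1)"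

text \<open>A pair of \<open>\<pi>\<close> and \<open>\<phi>\<close> with this property is an automorphism of the covering graph over \<open>\<pi>\<close>, which
  moves the fibre over \<open>{i, j}\<close> to the fibre over \<open>{\<pi> i, \<pi> j}\<close> and shifts it by \<open>\<phi> i j\<close>. The last
  clause only fixes the values of \<open>\<phi>\<close> at pairs that are no duads.\<close>

definition compatible :: "(nat \<Rightarrow> nat) \<Rightarrow> (nat \<Rightarrow> nat \<Rightarrow> 3) \<Rightarrow> bool" where
  "compatible \<pi> \<phi> \<longleftrightarrow>
    (\<forall>i j k l. distinct [i, j, k, l] \<longrightarrow> {i, j, k, l} \<subseteq> {1..7} \<longrightarrow>
       of_int (voltage (\<pi> i) (\<pi> j) (\<pi> k) (\<pi> l)) = of_int (voltage i j k l) + \<phi> i j - \<phi> k l) \<and>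
    (\<forall>i j. i = j \<or> \<not> {i, j} \<subseteq> {1..7} \<longrightarrow> \<phi> i j = 0)"

lemma compatibleD:
  assumes "compatible \<pi> \<phi>"
  shows "\<lbrakk>distinct [i, j, k, l]; {i, j, k, l} \<subseteq> {1..7}\<rbrakk> \<Longrightarrow>
      of_int (voltage (\<pi> i) (\<pi> j) (\<pi> k) (\<pi> l)) = of_int (voltage i j k l) + \<phi> i j - \<phi> k l"
    "i = j \<or> \<not> {i, j} \<subseteq> {1..7} \<Longrightarrow> \<phi> i j = 0"
  using assms unfolding compatible_def by blast+

lemma permutes_quadruple:
  assumes "\<pi> permutes S"
  shows "distinct [\<pi> i, \<pi> j, \<pi> k, \<pi> l] \<longleftrightarrow> distinct [i, j, k, l]"
    "{\<pi> i, \<pi> j, \<pi> k, \<pi> l} \<subseteq> S \<longleftrightarrow> {i, j, k, l} \<subseteq> S"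
    "\<pi> i = \<pi> j \<longleftrightarrow> i = j" "{\<pi> i, \<pi> j} \<subseteq> S \<longleftrightarrow> {i, j} \<subseteq> S"
  using permutes_inj[OF assms] permutes_in_image[OF assms] by (simp_all add: inj_eq)

lemma compatible_comp:
  assumes c: "compatible \<pi> \<phi>" "compatible \<sigma> \<psi>" and \<sigma>: "\<sigma> permutes {1..7}"
  shows "compatible (\<pi> \<circ> \<sigma>) (\<lambda>i j. \<phi> (\<sigma> i) (\<sigma> j) + \<psi> i j)"
  unfolding compatible_def
proof (intro conjI allI impI)
  fix i j k l assume "distinct [i, j, k, l]" "{i, j, k, l} \<subseteq> {1..7::nat}"
  then show "of_int (voltage ((\<pi> \<circ> \<sigma>) i) ((\<pi> \<circ> \<sigma>) j) ((\<pi> \<circ> \<sigma>) k) ((\<pi> \<circ> \<sigma>) l)) =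
      of_int (voltage i j k l) + (\<phi> (\<sigma> i) (\<sigma> j) + \<psi> i j) - (\<phi> (\<sigma> k) (\<sigma> l) + \<psi> k l)"
    using compatibleD(1)[OF c(1), of "\<sigma> i" "\<sigma> j" "\<sigma> k" "\<sigma> l"] compatibleD(1)[OF c(2), of i j k l]
    unfolding permutes_quadruple[OF \<sigma>] by simp
next
  fix i j assume "i = j \<or> \<not> {i, j} \<subseteq> {1..7::nat}"
  then show "\<phi> (\<sigma> i) (\<sigma> j) + \<psi> i j = 0"
    using compatibleD(2)[OF c(1), of "\<sigma> i" "\<sigma> j"] compatibleD(2)[OF c(2), of i j]
    unfolding permutes_quadruple[OF \<sigma>] by simp
qed

lemma compatible_inverse:
  assumes c: "compatible \<pi> \<phi>" and \<pi>: "\<pi> permutes {1..7}"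
  shows "compatible (inv' \<pi>) (\<lambda>i j. - \<phi> (inv' \<pi> i) (inv' \<pi> j))"
  unfolding compatible_def
proof (intro conjI allI impI)
  note \<pi>' = permutes_inv[OF \<pi>]
  have \<pi>\<pi>': "\<pi> (inv' \<pi> i) = i" for i using permutes_inverses(1)[OF \<pi>] .
  fix i j k l assume "distinct [i, j, k, l]" "{i, j, k, l} \<subseteq> {1..7::nat}"
  then show "of_int (voltage (inv' \<pi> i) (inv' \<pi> j) (inv' \<pi> k) (inv' \<pi> l)) =
      of_int (voltage i j k l) + - \<phi> (inv' \<pi> i) (inv' \<pi> j) - - \<phi> (inv' \<pi> k) (inv' \<pi> l)"
    using compatibleD(1)[OF c, of "inv' \<pi> i" "inv' \<pi> j" "inv' \<pi> k" "inv' \<pi> l"]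
    unfolding permutes_quadruple[OF \<pi>'] \<pi>\<pi>' by simp
next
  note \<pi>' = permutes_inv[OF \<pi>]
  fix i j assume "i = j \<or> \<not> {i, j} \<subseteq> {1..7::nat}"
  then show "- \<phi> (inv' \<pi> i) (inv' \<pi> j) = 0"
    using compatibleD(2)[OF c, of "inv' \<pi> i" "inv' \<pi> j"] unfolding permutes_quadruple[OF \<pi>'] by simp
qed

text \<open>The shifts of an automorphism over \<open>(1 2 3)\<close>, normalized to be 0 at \<open>{1, 2}\<close>; they are found by
  solving the condition of \<open>compatible\<close> along paths of disjoint duads.\<close>

definition duad_table :: "int list list" where
  "duad_table =
   [[0, 0, 0, 2, 2, 0, 2],
    [0, 0, 0, 2, 0, 2, 2],
    [0, 0, 0, 2, 1, 1, 2],
    [2, 2, 2, 0, 0, 1, 2],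
    [2, 0, 1, 0, 0, 2, 1],
    [0, 2, 1, 1, 2, 0, 0],
    [2, 2, 2, 2, 1, 0, 0]]"

definition shift1 :: "nat \<Rightarrow> nat \<Rightarrow> int" where
  "shift1 i j = duad_table ! (i - 1) ! (j - 1)"

text \<open>The shifts over \<open>(4 5 6)\<close>, which is the conjugate of \<open>(1 2 3)\<close> by the third power of the 7-cycle
  \<open>(1 2 3 4 5 6 7)\<close>. The voltage is invariant under this 7-cycle, so its shifts vanish and the table
  is merely translated.\<close>

definition shift2 :: "nat \<Rightarrow> nat \<Rightarrow> int" where
  "shift2 i j = shift1 ((i + 3) mod 7 + 1) ((j + 3) mod 7 + 1)"

definition rot7 :: "nat \<Rightarrow> nat" where
  "rot7 = cyc3 1 2 3 \<circ> cyc3 3 4 5 \<circ> cyc3 5 6 7"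

definition compatible_check :: "(nat \<Rightarrow> nat) \<Rightarrow> (nat \<Rightarrow> nat \<Rightarrow> int) \<Rightarrow> bool" where
  "compatible_check \<pi> \<phi> \<longleftrightarrow>
    list_all (\<lambda>i. list_all (\<lambda>j. i = j \<or>
      list_all (\<lambda>k. i = k \<or> j = k \<or> list_all (\<lambda>l. i = l \<or> j = l \<or> k = l \<or>
        (voltage (\<pi> i) (\<pi> j) (\<pi> k) (\<pi> l) - voltage i j k l - \<phi> i j + \<phi> k l) mod 3 = 0)
        [1, 2, 3, 4, 5, 6, 7]) [1, 2, 3, 4, 5, 6, 7]) [1, 2, 3, 4, 5, 6, 7]) [1, 2, 3, 4, 5, 6, 7]"

lemma of_int_mod3: "(x::int) mod 3 = 0 \<Longrightarrow> of_int x = (0 :: 3)"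
proof -
  assume "x mod 3 = 0"
  then obtain k where "x = 3 * k" by (auto elim: dvdE simp: mod_eq_0_iff_dvd)
  then have "(of_int x :: 3) = 3 * of_int k" by simp
  moreover have "(3 :: 3) = 0" by (simp flip: iszero_def)
  ultimately show "of_int x = (0 :: 3)" by simp
qed

lemma compatible_checked:
  assumes "compatible_check \<pi> \<phi>"
  shows "compatible \<pi> (\<lambda>i j. if i = j \<or> \<not> {i, j} \<subseteq> {1..7} then 0 else of_int (\<phi> i j))"
  unfolding compatible_def
proof (intro conjI allI impI)
  fix i j k l assume ijkl: "distinct [i, j, k, l]" "{i, j, k, l} \<subseteq> {1..7::nat}"
  have set7: "x \<in> {1..7::nat} \<longleftrightarrow> x \<in> set [1, 2, 3, 4, 5, 6, 7]" for x by auto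
  have "(voltage (\<pi> i) (\<pi> j) (\<pi> k) (\<pi> l) - voltage i j k l - \<phi> i j + \<phi> k l) mod 3 = 0"
    using assms ijkl unfolding compatible_check_def list_all_iff insert_subset set7 by (metis distinct_length_2_or_more)
  from of_int_mod3[OF this]
  have "(of_int (voltage (\<pi> i) (\<pi> j) (\<pi> k) (\<pi> l)) :: 3) = of_int (voltage i j k l) + of_int (\<phi> i j) - of_int (\<phi> k l)"
    by (simp add: algebra_simps)
  then show "of_int (voltage (\<pi> i) (\<pi> j) (\<pi> k) (\<pi> l)) = of_int (voltage i j k l) +
      (if i = j \<or> \<not> {i, j} \<subseteq> {1..7} then 0 else of_int (\<phi> i j)) -
      ((if k = l \<or> \<not> {k, l} \<subseteq> {1..7} then 0 else of_int (\<phi> k l)) :: 3)"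
    using ijkl by auto
qed auto

lemma check_rot7: "compatible_check rot7 (\<lambda>i j. 0)"
  by code_simp

lemma check_shift1: "compatible_check (cyc3 1 2 3) shift1"
  by code_simp

lemma check_shift2: "compatible_check (cyc3 4 5 6) shift2"
  by code_simp


lemma permutes_7: "\<lbrakk>\<pi> \<in> carrier (alt_group d); d \<le> 7\<rbrakk> \<Longrightarrow> \<pi> permutes {1..7}"
  unfolding alt_group_carrier by (auto intro: permutes_subset)

text \<open>The permutations with compatible shifts form a group that contains \<open>(1 2 3)\<close> and the 7-cycle,
  and these two generate the alternating group of degree 7.\<close>

lemma exists_compatible:
  assumes "\<pi> \<in> carrier (alt_group 7)"
  shows "\<exists>\<phi>. compatible \<pi> \<phi>"
proof -
  interpret A: group "alt_group 7" by (rule alt_group_is_group)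
  define P where "P = {\<pi> \<in> carrier (alt_group 7). \<exists>\<phi>. compatible \<pi> \<phi>}"
  have P_comp: "g \<circ> h \<in> P" if "g \<in> P" "h \<in> P" for g h
    using that compatible_comp permutes_7[of h 7] alt_comp unfolding P_def by blast
  have P_inv: "inv' g \<in> P" if "g \<in> P" for g
    using that compatible_inverse permutes_7[of g 7] alt_group_inv_closed unfolding P_def by blast
  have P_bij: "bij g" if "g \<in> P" for g using that alt_bij unfolding P_def by blast
  have P_conj: "cyc3 (g a) (g b) (g c) \<in> P" if "cyc3 a b c \<in> P" "g \<in> P" for a b c g
    using P_comp[OF P_comp[OF that(2,1)] P_inv[OF that(2)]] cyc3_conj[OF P_bij[OF that(2)]] by simp
  have "rot7 \<in> carrier (alt_group 7)"
    unfolding rot7_def by (intro alt_comp cyc3_alt) auto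
  then have rot: "rot7 \<in> P" using compatible_checked[OF check_rot7] unfolding P_def by blast
  have "cyc3 1 2 3 \<in> carrier (alt_group 7)" by (intro cyc3_alt) auto
  then have c123: "cyc3 1 2 3 \<in> P" using compatible_checked[OF check_shift1] unfolding P_def by blast
  have r: "rot7 1 = 2" "rot7 2 = 3" "rot7 3 = 4" "rot7 4 = 5" "rot7 5 = 6" "rot7 6 = 7" "rot7 7 = 1"
    by (simp_all add: rot7_def cyc3_def)
  have c234: "cyc3 2 3 4 \<in> P" using P_conj[OF c123 rot] r by simp
  have c345: "cyc3 3 4 5 \<in> P" using P_conj[OF c234 rot] r by simp
  have c456: "cyc3 4 5 6 \<in> P" using P_conj[OF c345 rot] r by simp
  have c567: "cyc3 5 6 7 \<in> P" using P_conj[OF c456 rot] r by simp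
  have c124: "cyc3 1 2 4 \<in> P" using P_conj[OF c123 c345] by (simp add: cyc3_def)
  have c125: "cyc3 1 2 5 \<in> P" using P_conj[OF c124 c456] by (simp add: cyc3_def)
  have c126: "cyc3 1 2 6 \<in> P" using P_conj[OF c125 c567] by (simp add: cyc3_def)
  have c127: "cyc3 1 2 7 \<in> P" using P_conj[OF c126 c567] by (simp add: cyc3_def)
  have c12: "cyc3 1 2 k \<in> P" if k: "k \<in> {3..7}" for k
  proof -
    have "k \<in> {3, 4, 5, 6, 7}" using k by auto
    then show ?thesis using c123 c124 c125 c126 c127 by blast
  qed
  have c1k2: "cyc3 1 k 2 \<in> P" if k: "k \<in> {3..7}" for k
  proof -
    have "cyc3 1 2 k \<circ> cyc3 1 2 k = cyc3 1 k 2" using k by (auto simp: fun_eq_iff cyc3_def)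
    then show ?thesis using P_comp[OF c12[OF k] c12[OF k]] by simp
  qed
  have c1: "cyc3 1 a b \<in> P" if ab: "a \<noteq> b" "{a, b} \<subseteq> {2..7}" for a b
  proof -
    consider "a = 2" "b \<in> {3..7}" | "b = 2" "a \<in> {3..7}" | "a \<in> {3..7}" "b \<in> {3..7}"
      using ab by force
    then show ?thesis
    proof cases
      case 3
      \<comment> \<open>conjugating \<open>(1 2 a)\<close> by \<open>(1 b 2)\<close>\<close>
      have "cyc3 b 1 a \<in> P" using P_conj[OF c12[OF 3(1)] c1k2[OF 3(2)]] 3 ab(1) by (simp add: cyc3_def)
      then show ?thesis using cyc3_rotate[of b 1 a] 3 ab(1) by simp
    next
      case 1
      then show ?thesis using c12 by blast
    next
      case 2
      then show ?thesis using c1k2 by blast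
    qed
  qed
  \<comment> \<open>A rotation moves any 3-cycle to one through the point 1.\<close>
  have "\<forall>a b c. distinct [a, b, c] \<longrightarrow> {a, b, c} \<subseteq> {1..7} \<longrightarrow> a = n \<longrightarrow> cyc3 a b c \<in> P"
    if "1 \<le> n" "n \<le> 7" for n :: nat
    using that
  proof (induction n rule: dec_induct)
    case base
    show ?case
    proof (intro allI impI)
      fix a b c assume *: "distinct [a, b, c]" "{a, b, c} \<subseteq> {1..7}" "a = (1::nat)"
      then have "b \<noteq> c" "{b, c} \<subseteq> {2..7}" by auto
      from c1[OF this] show "cyc3 a b c \<in> P" using * by simp
    qed
  next
    case (step n)
    show ?case
    proof (intro allI impI)
      fix a b c assume *: "distinct [a, b, c]" "{a, b, c} \<subseteq> {1..7}" "a = Suc n"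
      have perm: "rot7 permutes {1..7}" using permutes_7[OF \<open>rot7 \<in> carrier _\<close>] by simp
      obtain a' b' c' where abc: "a = rot7 a'" "b = rot7 b'" "c = rot7 c'"
        using permutes_surj[OF perm] by (metis surjD)
      have d: "distinct [a', b', c']" using * abc by auto
      have s: "{a', b', c'} \<subseteq> {1..7}"
        using *(2) unfolding abc by (simp only: insert_subset permutes_in_image[OF perm])
      have "rot7 n = Suc n"
      proof -
        have "n \<in> {1, 2, 3, 4, 5, 6}" using step by auto
        then show ?thesis using r by auto
      qed
      then have "a' = n" using abc(1) *(3) permutes_inj[OF perm] by (metis injD)
      then have "cyc3 a' b' c' \<in> P" using step d s by simp
      then show "cyc3 a b c \<in> P" using P_conj[OF _ rot] abc by simp
    qed
  qed
  then have P3: "cyc3 a b c \<in> P" if "distinct [a, b, c]" "{a, b, c} \<subseteq> {1..7}" for a b c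
    using that by simp
  have three: "three_cycles 7 \<subseteq> P"
  proof
    fix g assume "g \<in> three_cycles 7"
    then obtain cs where cs: "g = cycle_of_list cs" "distinct cs" "length cs = 3" "set cs \<subseteq> {1..7}" by blast
    obtain a b c where abc: "cs = [a, b, c]" using stupid_lemma[OF cs(3)] by blast
    then show "g \<in> P" using P3[of a b c] cs by (simp add: cyc3_eq_transpose)
  qed
  have "subgroup P (alt_group 7)"
  proof (rule A.subgroupI)
    show "P \<subseteq> carrier (alt_group 7)" "P \<noteq> {}" using rot unfolding P_def by auto
    show "inv\<^bsub>alt_group 7\<^esub> g \<in> P" if "g \<in> P" for g
      using P_inv[OF that] that unfolding P_def by (simp add: alt_group_inv_equality)
    show "g \<otimes>\<^bsub>alt_group 7\<^esub> h \<in> P" if "g \<in> P" "h \<in> P" for g h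
      using P_comp[OF that] by (simp add: alt_group_mult)
  qed
  from A.generate_subgroup_incl[OF three this] have "carrier (alt_group 7) \<subseteq> P"
    unfolding alt_group_carrier_as_three_cycles .
  then show ?thesis using assms unfolding P_def by blast
qed

definition triple_cover :: "nat \<Rightarrow> ((nat \<Rightarrow> nat) \<times> (nat \<Rightarrow> nat \<Rightarrow> 3)) monoid" where
  "triple_cover d = \<lparr>carrier = {(\<pi>, \<phi>). \<pi> \<in> carrier (alt_group d) \<and> compatible \<pi> \<phi>},
     mult = (\<lambda>(\<pi>, \<phi>) (\<sigma>, \<psi>). (\<pi> \<circ> \<sigma>, \<lambda>i j. \<phi> (\<sigma> i) (\<sigma> j) + \<psi> i j)),
     one = (id, \<lambda>i j. 0)\<rparr>"

lemma triple_carrier: "(\<pi>, \<phi>) \<in> carrier (triple_cover d) \<longleftrightarrow> \<pi> \<in> carrier (alt_group d) \<and> compatible \<pi> \<phi>"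
  by (simp add: triple_cover_def)

lemma triple_mult:
  "(\<pi>, \<phi>) \<otimes>\<^bsub>triple_cover d\<^esub> (\<sigma>, \<psi>) = (\<pi> \<circ> \<sigma>, \<lambda>i j. \<phi> (\<sigma> i) (\<sigma> j) + \<psi> i j)"
  by (simp add: triple_cover_def)

lemma triple_one: "\<one>\<^bsub>triple_cover d\<^esub> = (id, \<lambda>i j. 0)"
  by (simp add: triple_cover_def)

lemma triple_group:
  assumes d: "d \<le> 7"
  shows "group (triple_cover d)"
proof (rule groupI)
  fix x y z
  assume "x \<in> carrier (triple_cover d)" "y \<in> carrier (triple_cover d)" "z \<in> carrier (triple_cover d)"
  moreover obtain \<pi> \<phi> \<sigma> \<psi> \<tau> \<chi> where *: "x = (\<pi>, \<phi>)" "y = (\<sigma>, \<psi>)" "z = (\<tau>, \<chi>)"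
    by (metis surj_pair)
  ultimately have x: "\<pi> \<in> carrier (alt_group d)" "compatible \<pi> \<phi>"
    and y: "\<sigma> \<in> carrier (alt_group d)" "compatible \<sigma> \<psi>" by (auto simp: triple_carrier)
  show "x \<otimes>\<^bsub>triple_cover d\<^esub> y \<in> carrier (triple_cover d)"
    unfolding * triple_mult triple_carrier
    using alt_comp[OF x(1) y(1)] compatible_comp[OF x(2) y(2) permutes_7[OF y(1) d]] by blast
  show "x \<otimes>\<^bsub>triple_cover d\<^esub> y \<otimes>\<^bsub>triple_cover d\<^esub> z = x \<otimes>\<^bsub>triple_cover d\<^esub> (y \<otimes>\<^bsub>triple_cover d\<^esub> z)"
    unfolding * triple_mult by (simp add: comp_assoc add.assoc)
  show "\<one>\<^bsub>triple_cover d\<^esub> \<otimes>\<^bsub>triple_cover d\<^esub> x = x"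
    unfolding * triple_one triple_mult by simp
  have "(inv' \<pi>, \<lambda>i j. - \<phi> (inv' \<pi> i) (inv' \<pi> j)) \<in> carrier (triple_cover d)"
    unfolding triple_carrier
    using alt_group_inv_closed[OF x(1)] compatible_inverse[OF x(2) permutes_7[OF x(1) d]] by blast
  moreover have "(inv' \<pi>, \<lambda>i j. - \<phi> (inv' \<pi> i) (inv' \<pi> j)) \<otimes>\<^bsub>triple_cover d\<^esub> x = \<one>\<^bsub>triple_cover d\<^esub>"
    unfolding * triple_mult triple_one using alt_bij[OF x(1)] by (simp add: bij_is_inj)
  ultimately show "\<exists>y\<in>carrier (triple_cover d). y \<otimes>\<^bsub>triple_cover d\<^esub> x = \<one>\<^bsub>triple_cover d\<^esub>" by blast
next
  show "\<one>\<^bsub>triple_cover d\<^esub> \<in> carrier (triple_cover d)"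
    unfolding triple_one triple_carrier
    by (simp add: alt_group_carrier permutes_id compatible_def)
qed

text \<open>Over the identity the shifts at disjoint duads agree, and any two duads of seven points have a
  common disjoint duad.\<close>

lemma triple_kernel:
  assumes "compatible id \<phi>"
  obtains c where "\<phi> = (\<lambda>i j. if i = j \<or> \<not> {i, j} \<subseteq> {1..7} then 0 else c)"
proof -
  have const: "\<phi> i j = \<phi> 1 2" if ij: "i \<noteq> j" "{i, j} \<subseteq> {1..7}" for i j
  proof -
    \<comment> \<open>Seven points leave a duad that is disjoint from two given ones.\<close>
    have "2 \<le> card ({1..7} - {i, j, 1, 2})"
    proof -
      have "card {i, j, 1, 2} \<le> 4" using card_length[of "[i, j, 1, 2]"] by simp
      then show ?thesis using ij by (subst card_Diff_subset) auto
    qed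
    from obtain_subset_with_card_n[OF this] obtain T where "T \<subseteq> {1..7} - {i, j, 1, 2}" "card T = 2"
      by blast
    then obtain k l where kl: "k \<noteq> l" "{k, l} \<subseteq> {1..7} - {i, j, 1, 2}" unfolding card_2_iff by blast
    have "\<phi> i j = \<phi> k l" "\<phi> 1 2 = \<phi> k l"
      using compatibleD(1)[OF assms, of i j k l] compatibleD(1)[OF assms, of 1 2 k l] ij kl by auto
    then show ?thesis by simp
  qed
  have "\<phi> i j = (if i = j \<or> \<not> {i, j} \<subseteq> {1..7} then 0 else \<phi> 1 2)" for i j
  proof (cases "i = j \<or> \<not> {i, j} \<subseteq> {1..7}")
    case True
    then show ?thesis unfolding if_P[OF True] by (rule compatibleD(2)[OF assms])
  next
    case False
    then show ?thesis unfolding if_not_P[OF False] using const[of i j] by blast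
  qed
  then have "\<phi> = (\<lambda>i j. if i = j \<or> \<not> {i, j} \<subseteq> {1..7} then 0 else \<phi> 1 2)" by blast
  then show ?thesis by (rule that)
qed

lemma triple_extension:
  assumes d: "d \<le> 7"
  shows "central_extension (triple_cover d) (alt_group d) fst"
proof -
  interpret A: group "alt_group d" by (rule alt_group_is_group)
  interpret T: group "triple_cover d" by (rule triple_group[OF d])
  have hom: "fst \<in> hom (triple_cover d) (alt_group d)"
    by (rule homI) (auto simp: triple_carrier triple_mult alt_group_mult)
  have "\<pi> \<in> fst ` carrier (triple_cover d)" if \<pi>: "\<pi> \<in> carrier (alt_group d)" for \<pi>
  proof -
    have "\<pi> \<in> carrier (alt_group 7)"
      using permutes_7[OF \<pi> d] \<pi> by (simp add: alt_group_carrier)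
    then obtain \<phi> where "compatible \<pi> \<phi>" using exists_compatible by blast
    then have "(\<pi>, \<phi>) \<in> carrier (triple_cover d)" using \<pi> by (simp add: triple_carrier)
    then show ?thesis by force
  qed
  then have "fst ` carrier (triple_cover d) = carrier (alt_group d)"
    using hom_carrier[OF hom] by blast
  moreover have "z \<otimes>\<^bsub>triple_cover d\<^esub> x = x \<otimes>\<^bsub>triple_cover d\<^esub> z"
    if z: "z \<in> carrier (triple_cover d)" "fst z = \<one>\<^bsub>alt_group d\<^esub>" and x: "x \<in> carrier (triple_cover d)" for z x
  proof -
    obtain \<phi> \<sigma> \<psi> where zx: "z = (id, \<phi>)" "x = (\<sigma>, \<psi>)"
      using z(2) by (metis alt_group_one prod.collapse)
    have \<sigma>: "\<sigma> permutes {1..7}" using x d permutes_7 unfolding zx triple_carrier by blast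
    have "compatible id \<phi>" using z(1) unfolding zx triple_carrier by blast
    then obtain c where c: "\<phi> = (\<lambda>i j. if i = j \<or> \<not> {i, j} \<subseteq> {1..7} then 0 else c)"
      by (rule triple_kernel)
    have "\<phi> (\<sigma> i) (\<sigma> j) = \<phi> i j" for i j unfolding c permutes_quadruple(3,4)[OF \<sigma>] ..
    then show ?thesis unfolding zx triple_mult by (simp add: add.commute)
  qed
  ultimately show ?thesis
    using T.is_group A.is_group hom unfolding central_extension_def central_extension_axioms_def by blast
qed

lemma triple_kernel_exponent:
  assumes d: "d \<le> 7" and z: "z \<in> carrier (triple_cover d)" "fst z = \<one>\<^bsub>alt_group d\<^esub>"
  shows "z [^]\<^bsub>triple_cover d\<^esub> (3::nat) = \<one>\<^bsub>triple_cover d\<^esub>"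
proof -
  interpret T: group "triple_cover d" by (rule triple_group[OF d])
  obtain \<phi> where \<phi>: "z = (id, \<phi>)" using z(2) by (metis alt_group_one prod.collapse)
  have "x + x + x = 0" for x :: 3
  proof -
    have "x + x + x = (1 + 1 + 1) * x" by (simp only: distrib_right mult_1_left)
    moreover have "(1 + 1 + 1 :: 3) = 3" by simp
    moreover have "(3 :: 3) = 0" by (simp flip: iszero_def)
    ultimately show ?thesis by (simp only: mult_zero_left)
  qed
  then show ?thesis using z(1) by (simp add: numeral_3_eq_3 \<phi> triple_mult triple_one)
qed

lemma triple_cyc3_lifts_not_commute:
  assumes "6 \<le> d" "d \<le> 7"
  shows "\<not> alt_extension.cyc3_lifts_commute (triple_cover d) fst"
proof
  interpret alt_extension "triple_cover d" d fst
    using triple_extension assms by (simp add: alt_extension_def alt_extension_axioms_def)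
  let ?lift = "\<lambda>f i j. if i = j \<or> \<not> {i, j} \<subseteq> {1..7} then 0 else (of_int (f i j) :: 3)"
  let ?x = "(cyc3 1 2 3, ?lift shift1)" and ?y = "(cyc3 4 5 6, ?lift shift2)"
  have x: "?x \<in> carrier (triple_cover d)" and y: "?y \<in> carrier (triple_cover d)"
    using d compatible_checked[OF check_shift1] compatible_checked[OF check_shift2]
    by (auto simp only: triple_carrier intro!: cyc3_alt) auto
  assume cyc3_lifts_commute
  then have "?x \<otimes>\<^bsub>triple_cover d\<^esub> ?y = ?y \<otimes>\<^bsub>triple_cover d\<^esub> ?x"
    using lifts_commute_iff[OF x y] unfolding cyc3_lifts_commute_def fst_conv by blast
  then have "snd (?x \<otimes>\<^bsub>triple_cover d\<^esub> ?y) 1 2 = snd (?y \<otimes>\<^bsub>triple_cover d\<^esub> ?x) 1 2"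
    by (rule arg_cong)
  then show False
    unfolding triple_mult snd_conv by (simp add: cyc3_def shift1_def shift2_def duad_table_def)
qed

section \<open>Cycle types and centralizers\<close>

definition nontrivial_orbits :: "('a \<Rightarrow> 'a) \<Rightarrow> 'a set set" where
  "nontrivial_orbits p = {orbit p x | x. p x \<noteq> x}"

lemma cycle_type_orbits1:
  assumes "cycle_type p = {#m#}"
  obtains Q where "nontrivial_orbits p = {Q}" "card Q = m"
proof -
  have "image_mset card (mset_set (nontrivial_orbits p)) = {#m#}"
    using assms by (simp add: cycle_type_def nontrivial_orbits_def)
  from msed_map_invR[OF this[unfolded add_mset_add_single[symmetric]]]
  obtain Q M where Q: "mset_set (nontrivial_orbits p) = add_mset Q M" "card Q = m" "image_mset card M = {#}"
    by blast
  then have eq: "mset_set (nontrivial_orbits p) = {#Q#}" by simp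
  then have "finite (nontrivial_orbits p)" by (metis add_mset_not_empty mset_set.infinite)
  then have "nontrivial_orbits p = {Q}" using arg_cong[OF eq, of set_mset] by simp
  then show ?thesis using that Q by blast
qed

lemma cycle_type_orbits2:
  assumes "cycle_type p = {#m, n#}"
  obtains Q R where "nontrivial_orbits p = {Q, R}" "Q \<noteq> R" "card Q = m" "card R = n"
proof -
  have "image_mset card (mset_set (nontrivial_orbits p)) = {#m, n#}"
    using assms by (simp add: cycle_type_def nontrivial_orbits_def)
  from msed_map_invR[OF this]
  obtain Q M where Q: "mset_set (nontrivial_orbits p) = add_mset Q M" "card Q = m" "image_mset card M = {#n#}"
    by blast
  from msed_map_invR[OF Q(3)]
  obtain R where R: "M = {#R#}" "card R = n" by auto
  have eq: "mset_set (nontrivial_orbits p) = {#Q, R#}" using Q R by simp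
  then have fin: "finite (nontrivial_orbits p)" by (metis add_mset_not_empty mset_set.infinite)
  then have "nontrivial_orbits p = {Q, R}" using arg_cong[OF eq, of set_mset] by simp
  moreover have "card (nontrivial_orbits p) = 2" using arg_cong[OF eq, of size] by simp
  ultimately have "nontrivial_orbits p = {Q, R}" "Q \<noteq> R" by auto
  then show ?thesis using that Q R by blast
qed

lemma cycle_type_orbits3:
  assumes "cycle_type p = {#l, m, n#}"
  obtains Q R S where "nontrivial_orbits p = {Q, R, S}" "distinct [Q, R, S]"
    "card Q = l" "card R = m" "card S = n"
proof -
  have "image_mset card (mset_set (nontrivial_orbits p)) = {#l, m, n#}"
    using assms by (simp add: cycle_type_def nontrivial_orbits_def)
  from msed_map_invR[OF this]
  obtain Q M where Q: "mset_set (nontrivial_orbits p) = add_mset Q M" "card Q = l" "image_mset card M = {#m, n#}"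
    by blast
  from msed_map_invR[OF Q(3)]
  obtain R M' where R: "M = add_mset R M'" "card R = m" "image_mset card M' = {#n#}" by blast
  from msed_map_invR[OF R(3)]
  obtain S where S: "M' = {#S#}" "card S = n" by auto
  have eq: "mset_set (nontrivial_orbits p) = {#Q, R, S#}" using Q R S by simp
  then have fin: "finite (nontrivial_orbits p)" by (metis add_mset_not_empty mset_set.infinite)
  then have "nontrivial_orbits p = {Q, R, S}" using arg_cong[OF eq, of set_mset] by simp
  moreover have "card (nontrivial_orbits p) = 3" using arg_cong[OF eq, of size] by simp
  ultimately have "nontrivial_orbits p = {Q, R, S}" "distinct [Q, R, S]"
    using card_distinct[of "[Q, R, S]"] by simp_all
  then show ?thesis using that Q R S by auto
qed

context
  fixes p :: "'a \<Rightarrow> 'a"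
  assumes perm: "permutation p"
begin

lemma orbit_eq: "y \<in> orbit p x \<Longrightarrow> orbit p y = orbit p x"
proof (intro equalityI subsetI)
  fix z assume y: "y \<in> orbit p x"
  show "z \<in> orbit p x" if "z \<in> orbit p y" using orbit_trans[OF that y] .
  have "x \<in> orbit p y" using orbit_swap[OF permutation_self_in_orbit[OF perm] y] .
  then show "z \<in> orbit p y" if "z \<in> orbit p x" using orbit_trans[OF that] by blast
qed

lemma orbit_in_nontrivial_orbits: "p y \<noteq> y \<Longrightarrow> orbit p y \<in> nontrivial_orbits p"
  unfolding nontrivial_orbits_def by blast

lemma nontrivial_orbit_eq:
  "\<lbrakk>Q \<in> nontrivial_orbits p; y \<in> Q\<rbrakk> \<Longrightarrow> Q = orbit p y \<and> p y \<noteq> y"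
proof -
  assume "Q \<in> nontrivial_orbits p" "y \<in> Q"
  then obtain x where x: "Q = orbit p x" "p x \<noteq> x" unfolding nontrivial_orbits_def by blast
  then have Q: "Q = orbit p y" using orbit_eq \<open>y \<in> Q\<close> by blast
  have "p y \<noteq> y"
  proof
    assume "p y = y"
    then have "orbit p y = {y}" using orbit_altdef_bounded[of 1 p y] by simp
    moreover have "x \<in> orbit p y" "p x \<in> orbit p y"
      using Q x orbit.base[of p x] permutation_self_in_orbit[OF perm, of x] by auto
    ultimately show False using x by simp
  qed
  then show ?thesis using Q by blast
qed

text \<open>Together with the next lemmas this turns a cycle type into an explicit product of cycles.\<close>

lemma fixed_outside_orbits: "y \<notin> \<Union>(nontrivial_orbits p) \<Longrightarrow> p y = y"
  using orbit_in_nontrivial_orbits permutation_self_in_orbit[OF perm] by blast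

lemma nontrivial_orbits_disjoint:
  "\<lbrakk>Q \<in> nontrivial_orbits p; R \<in> nontrivial_orbits p; Q \<noteq> R\<rbrakk> \<Longrightarrow> Q \<inter> R = {}"
  using nontrivial_orbit_eq by blast

lemma nontrivial_orbit_closed: "\<lbrakk>Q \<in> nontrivial_orbits p; y \<in> Q\<rbrakk> \<Longrightarrow> p y \<in> Q"
  using nontrivial_orbit_eq orbit.base by metis

lemma nontrivial_orbit2:
  assumes Q: "Q \<in> nontrivial_orbits p" "card Q = 2"
  obtains a b where "a \<noteq> b" "Q = {a, b}" "p a = b" "p b = a"
proof -
  obtain a b where ab: "Q = {a, b}" "a \<noteq> b" using Q(2) unfolding card_2_iff by blast
  have "p a \<in> Q" "p b \<in> Q" "p a \<noteq> a" "p b \<noteq> b"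
    using nontrivial_orbit_closed[OF Q(1)] nontrivial_orbit_eq[OF Q(1)] ab by auto
  then show ?thesis using that ab by blast
qed

lemma nontrivial_orbit3:
  assumes Q: "Q \<in> nontrivial_orbits p" "card Q = 3"
  obtains a b c where "distinct [a, b, c]" "Q = {a, b, c}" "p a = b" "p b = c" "p c = a"
proof -
  have inj: "p x = p y \<longleftrightarrow> x = y" for x y using permutation_bijective[OF perm] by (simp add: bij_is_inj inj_eq)
  obtain a where a: "a \<in> Q" using Q(2) by fastforce
  have b: "p a \<in> Q" "p a \<noteq> a" and c: "p (p a) \<in> Q" "p (p a) \<noteq> p a"
    using nontrivial_orbit_closed[OF Q(1)] nontrivial_orbit_eq[OF Q(1)] a by auto
  have "p (p a) \<noteq> a"
  proof
    assume "p (p a) = a"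
    then have "Q = {(p ^^ m) a | m. m < 2}"
      using nontrivial_orbit_eq[OF Q(1) a] orbit_altdef_bounded[of 2 p a] by (simp add: numeral_2_eq_2)
    also have "\<dots> = {a, p a}" by (auto simp: less_2_cases_iff intro: exI[of _ "0::nat"] exI[of _ "1::nat"])
    finally show False using Q(2) b by simp
  qed
  then have d: "distinct [a, p a, p (p a)]" using b c by auto
  have fin: "finite Q" using Q(2) card.infinite by fastforce
  have "card {a, p a, p (p a)} = 3" using d by simp
  then have Q3: "Q = {a, p a, p (p a)}"
    using card_seteq[OF fin, of "{a, p a, p (p a)}"] a b c Q(2) by auto
  have "p (p (p a)) \<in> Q" using nontrivial_orbit_closed[OF Q(1) c(1)] .
  then have "p (p (p a)) = a" using Q3 d inj by auto
  then show ?thesis using that[OF d Q3] by simp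
qed

end

lemma nontrivial_orbit_subset:
  assumes "p permutes S" "finite S" "Q \<in> nontrivial_orbits p"
  shows "Q \<subseteq> S"
proof
  fix y assume y: "y \<in> Q"
  have "permutation p" using assms permutation_permutes by blast
  then have "p y \<noteq> y" using nontrivial_orbit_eq[OF _ assms(3) y] by simp
  then show "y \<in> S" using assms(1) by (auto simp: permutes_def)
qed

lemma even_on_two_points:
  assumes w: "w permutes B" "evenperm w" and B: "finite B" "card B \<le> 2"
  shows "w = id"
proof (rule ccontr)
  assume "w \<noteq> id"
  then obtain e where e: "w e \<noteq> e" by (auto simp: fun_eq_iff)
  have inj: "\<And>x y. w x = w y \<longleftrightarrow> x = y" using permutes_inj[OF w(1)] by (simp add: inj_eq)
  have out: "\<And>x. x \<notin> B \<Longrightarrow> w x = x" using w(1) by (simp add: permutes_def)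
  have "e \<in> B" using e out by blast
  moreover have "w e \<in> B" using permutes_in_image[OF w(1)] \<open>e \<in> B\<close> by blast
  moreover have "card {e, w e} = 2" using e by simp
  ultimately have B2: "B = {e, w e}" using B by (metis card_seteq empty_subsetI insert_subset)
  have "w (w e) \<in> B" using permutes_in_image[OF w(1)] \<open>w e \<in> B\<close> by blast
  then have "w (w e) = e" using B2 inj e by auto
  then have "w x = transpose e (w e) x" for x
    using B2 out[of x] by (cases "x \<in> B") (auto simp: transpose_def)
  then have "w = transpose e (w e)" by blast
  then have "evenperm w \<longleftrightarrow> e = w e" by (metis evenperm_swap)
  then show False using w(2) e by simp
qed

context
  fixes p :: "nat \<Rightarrow> nat" and d :: nat
  assumes p: "p \<in> carrier (alt_group d)"
begin

lemma alt_permutation: "permutation p"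
  using p by (rule alt_group_carrier')

lemma alt_orbit_subset: "Q \<in> nontrivial_orbits p \<Longrightarrow> Q \<subseteq> {1..d}"
  using p nontrivial_orbit_subset[of p "{1..d}"] unfolding alt_group_carrier by simp

lemma type3_form:
  assumes "cycle_type p = {#3#}"
  obtains a b c where "distinct [a, b, c]" "{a, b, c} \<subseteq> {1..d}" "p = cyc3 a b c"
proof -
  obtain Q where Q: "nontrivial_orbits p = {Q}" "card Q = 3" using cycle_type_orbits1[OF assms] .
  obtain a b c where abc: "distinct [a, b, c]" "Q = {a, b, c}" "p a = b" "p b = c" "p c = a"
    using nontrivial_orbit3[OF alt_permutation, of Q] Q by blast
  have "p y = cyc3 a b c y" for y
    using abc Q fixed_outside_orbits[OF alt_permutation, of y] by (cases "y \<in> Q") (auto simp: cyc3_def)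
  then have "p = cyc3 a b c" by blast
  moreover have "{a, b, c} \<subseteq> {1..d}" using alt_orbit_subset[of Q] Q(1) abc(2) by simp
  ultimately show ?thesis using that[OF abc(1)] by simp
qed

lemma type33_form:
  assumes "cycle_type p = {#3, 3#}"
  obtains a b c e f k where "distinct [a, b, c, e, f, k]" "{a, b, c, e, f, k} \<subseteq> {1..d}"
    "p = cyc3 a b c \<circ> cyc3 e f k"
proof -
  obtain Q R where Q: "nontrivial_orbits p = {Q, R}" "Q \<noteq> R" "card Q = 3" "card R = 3"
    using cycle_type_orbits2[OF assms] .
  obtain a b c where abc: "distinct [a, b, c]" "Q = {a, b, c}" "p a = b" "p b = c" "p c = a"
    using nontrivial_orbit3[OF alt_permutation, of Q] Q by blast
  obtain e f k where efk: "distinct [e, f, k]" "R = {e, f, k}" "p e = f" "p f = k" "p k = e"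
    using nontrivial_orbit3[OF alt_permutation, of R] Q by blast
  have disj: "Q \<inter> R = {}" using nontrivial_orbits_disjoint[OF alt_permutation] Q by blast
  then have dist: "distinct [a, b, c, e, f, k]" using abc efk by auto
  have "p y = (cyc3 a b c \<circ> cyc3 e f k) y" for y
  proof (cases "y \<in> Q \<union> R")
    case True
    then consider "y = a" | "y = b" | "y = c" | "y = e" | "y = f" | "y = k"
      unfolding abc(2) efk(2) by blast
    then show ?thesis using dist by cases (auto simp: cyc3_def abc(3-5) efk(3-5))
  next
    case False
    then have "p y = y" using fixed_outside_orbits[OF alt_permutation, of y] Q by simp
    then show ?thesis using False unfolding abc(2) efk(2) by (simp add: cyc3_def)
  qed
  then have "p = cyc3 a b c \<circ> cyc3 e f k" by blast
  moreover have "{a, b, c, e, f, k} \<subseteq> {1..d}"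
    using alt_orbit_subset[of Q] alt_orbit_subset[of R] Q(1) abc(2) efk(2) by simp
  ultimately show ?thesis using that[OF dist] by simp
qed

lemma type22_form:
  assumes "cycle_type p = {#2, 2#}"
  obtains a b c e where "distinct [a, b, c, e]" "{a, b, c, e} \<subseteq> {1..d}"
    "p = transpose a b \<circ> transpose c e"
proof -
  obtain Q R where Q: "nontrivial_orbits p = {Q, R}" "Q \<noteq> R" "card Q = 2" "card R = 2"
    using cycle_type_orbits2[OF assms] .
  obtain a b where ab: "a \<noteq> b" "Q = {a, b}" "p a = b" "p b = a"
    using nontrivial_orbit2[OF alt_permutation, of Q] Q by blast
  obtain c e where ce: "c \<noteq> e" "R = {c, e}" "p c = e" "p e = c"
    using nontrivial_orbit2[OF alt_permutation, of R] Q by blast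
  have disj: "Q \<inter> R = {}" using nontrivial_orbits_disjoint[OF alt_permutation] Q by blast
  then have dist: "distinct [a, b, c, e]" using ab ce by auto
  have "p y = (transpose a b \<circ> transpose c e) y" for y
  proof (cases "y \<in> Q \<union> R")
    case True
    then consider "y = a" | "y = b" | "y = c" | "y = e" unfolding ab(2) ce(2) by blast
    then show ?thesis using dist by cases (auto simp: transpose_def ab(3,4) ce(3,4))
  next
    case False
    then have "p y = y" using fixed_outside_orbits[OF alt_permutation, of y] Q by simp
    then show ?thesis using False unfolding ab(2) ce(2) by (simp add: transpose_def)
  qed
  then have "p = transpose a b \<circ> transpose c e" by blast
  moreover have "{a, b, c, e} \<subseteq> {1..d}"
    using alt_orbit_subset[of Q] alt_orbit_subset[of R] Q(1) ab(2) ce(2) by simp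
  ultimately show ?thesis using that[OF dist] by simp
qed

lemma type223_form:
  assumes "cycle_type p = {#2, 2, 3#}"
  obtains a b c e x y z where "distinct [a, b, c, e, x, y, z]" "{a, b, c, e, x, y, z} \<subseteq> {1..d}"
    "p = (transpose a b \<circ> transpose c e) \<circ> cyc3 x y z"
proof -
  obtain Q R S where Q: "nontrivial_orbits p = {Q, R, S}" "distinct [Q, R, S]"
      "card Q = 2" "card R = 2" "card S = 3"
    using cycle_type_orbits3[OF assms] .
  obtain a b where ab: "a \<noteq> b" "Q = {a, b}" "p a = b" "p b = a"
    using nontrivial_orbit2[OF alt_permutation, of Q] Q by blast
  obtain c e where ce: "c \<noteq> e" "R = {c, e}" "p c = e" "p e = c"
    using nontrivial_orbit2[OF alt_permutation, of R] Q by blast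
  obtain x y z where xyz: "distinct [x, y, z]" "S = {x, y, z}" "p x = y" "p y = z" "p z = x"
    using nontrivial_orbit3[OF alt_permutation, of S] Q by blast
  have "Q \<inter> R = {}" "Q \<inter> S = {}" "R \<inter> S = {}"
    using nontrivial_orbits_disjoint[OF alt_permutation] Q by auto
  then have dist: "distinct [a, b, c, e, x, y, z]" using ab ce xyz by auto
  have "p v = ((transpose a b \<circ> transpose c e) \<circ> cyc3 x y z) v" for v
  proof (cases "v \<in> Q \<union> R \<union> S")
    case True
    then consider "v = a" | "v = b" | "v = c" | "v = e" | "v = x" | "v = y" | "v = z"
      unfolding ab(2) ce(2) xyz(2) by blast
    then show ?thesis using dist by cases (auto simp: transpose_def cyc3_def ab(3,4) ce(3,4) xyz(3-5))
  next
    case False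
    then have "p v = v" using fixed_outside_orbits[OF alt_permutation, of v] Q by simp
    then show ?thesis using False unfolding ab(2) ce(2) xyz(2) by (simp add: transpose_def cyc3_def)
  qed
  then have "p = (transpose a b \<circ> transpose c e) \<circ> cyc3 x y z" by blast
  moreover have "{a, b, c, e, x, y, z} \<subseteq> {1..d}"
    using alt_orbit_subset[of Q] alt_orbit_subset[of R] alt_orbit_subset[of S] Q(1) ab(2) ce(2) xyz(2) by simp
  ultimately show ?thesis using that[OF dist] by simp
qed

text \<open>A commuting \<open>h\<close> maps the orbit \<open>Q\<close>, the only one of its size, to itself and agrees on \<open>Q\<close> with
  a power of \<open>p\<close>. The quotient of \<open>h\<close> by this power is an even permutation that fixes \<open>Q\<close> and, if
  there is only one, the fixed point of \<open>p\<close>; the at most two remaining points leave only the identity.\<close>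

lemma centralizer_cyclic:
  assumes Q: "Q \<in> nontrivial_orbits p" and unique: "\<And>R. \<lbrakk>R \<in> nontrivial_orbits p; card R = card Q\<rbrakk> \<Longrightarrow> R = Q"
    and B: "\<And>y. \<lbrakk>y \<in> {1..d}; y \<notin> Q; y \<notin> B\<rbrakk> \<Longrightarrow> p y = y \<and> card ({y \<in> {1..d}. p y = y}) \<le> 1"
      "finite B" "card B \<le> 2"
    and h: "h \<in> carrier (alt_group d)" "p \<circ> h = h \<circ> p"
  shows "\<exists>n::nat. h = p [^]\<^bsub>alt_group d\<^esub> n"
proof -
  interpret A: group "alt_group d" by (rule alt_group_is_group)
  have pow: "p [^]\<^bsub>alt_group d\<^esub> n = p ^^ n" for n :: nat
    by (induction n) (simp_all add: alt_group_one alt_group_mult funpow_Suc_right del: funpow.simps(2))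
  have hp: "h (p x) = p (h x)" for x using h(2) by (metis comp_apply)
  have hpn: "h ((p ^^ n) x) = (p ^^ n) (h x)" for n x by (induction n) (simp_all add: hp)
  have injh: "h x = h y \<longleftrightarrow> x = y" for x y using alt_bij[OF h(1)] by (simp add: bij_is_inj inj_eq)
  obtain x where x: "x \<in> Q" using Q permutation_self_in_orbit[OF alt_permutation] unfolding nontrivial_orbits_def by blast
  have Qx: "Q = orbit p x" "p x \<noteq> x" using nontrivial_orbit_eq[OF alt_permutation Q x] by auto
  have "p (h x) \<noteq> h x" using hp[of x] injh Qx by metis
  then have "orbit p (h x) \<in> nontrivial_orbits p" by (rule orbit_in_nontrivial_orbits[OF alt_permutation])
  moreover have "orbit p (h x) = h ` orbit p x"
  proof -
    have "orbit p y = range (\<lambda>n. (p ^^ n) y)" for y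
      unfolding orbit_altdef_permutation[OF alt_permutation] by auto
    then show ?thesis by (simp add: image_image hpn)
  qed
  then have "card (orbit p (h x)) = card Q" using Qx injh by (simp add: card_image inj_on_def)
  ultimately have "orbit p (h x) = Q" by (rule unique)
  then have "h x \<in> orbit p x" using permutation_self_in_orbit[OF alt_permutation] Qx by blast
  then obtain n where n: "h x = (p ^^ n) x" unfolding orbit_altdef_permutation[OF alt_permutation] by blast
  define s where "s = p ^^ n"
  have s: "s \<in> carrier (alt_group d)" using A.nat_pow_closed[OF p, of n] unfolding pow s_def .
  have hs: "h y = s y" if "y \<in> Q" for y
  proof -
    obtain m where m: "y = (p ^^ m) x" using \<open>y \<in> Q\<close> Qx unfolding orbit_altdef_permutation[OF alt_permutation] by blast
    have "h y = (p ^^ m) ((p ^^ n) x)" unfolding m hpn n ..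
    also have "\<dots> = s y" unfolding m s_def by (metis add.commute comp_apply funpow_add)
    finally show ?thesis .
  qed
  have inv_s: "inv' s (s y) = y" "s (inv' s y) = y" for y
    using alt_bij[OF s] by (simp_all add: bij_is_inj bij_is_surj surj_f_inv_f)
  define w where "w = inv' s \<circ> h"
  have w: "w \<in> carrier (alt_group d)" unfolding w_def using s h alt_group_inv_closed alt_comp by blast
  have wQ: "w y = y" if "y \<in> Q" for y unfolding w_def using hs[OF that] inv_s by simp
  have sp: "s (p y) = p (s y)" for y unfolding s_def by (metis funpow_swap1)
  have wp: "w (p y) = p (w y)" for y
  proof -
    have "s (w (p y)) = s (p (w y))" unfolding sp unfolding w_def comp_apply inv_s by (rule hp)
    then show ?thesis by (metis inv_s(1))
  qed
  have wperm: "w permutes {1..d}" "evenperm w" using w by (auto simp: alt_group_carrier)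
  have "w y = y" if "y \<notin> B" for y
  proof (cases "y \<in> {1..d} \<and> y \<notin> Q")
    case True
    then have y: "p y = y" "card {y \<in> {1..d}. p y = y} \<le> 1" using B(1)[of y] that by auto
    \<comment> \<open>\<open>w\<close> permutes the fixed points of \<open>p\<close>, and there is only one.\<close>
    have "p (w y) = w y" using wp[of y] y by simp
    moreover have "w y \<in> {1..d}" using True permutes_in_image[OF wperm(1)] by blast
    ultimately have "{y, w y} \<subseteq> {y \<in> {1..d}. p y = y}" using True y by auto
    then have "card {y, w y} \<le> card {y \<in> {1..d}. p y = y}" by (intro card_mono) simp_all
    then have le: "card {y, w y} \<le> 1" using y(2) by (rule order_trans)
    show ?thesis
    proof (rule ccontr)
      assume "w y \<noteq> y"
      then have "card {y, w y} = 2" by simp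
      then show False using le by simp
    qed
  next
    case False
    then show ?thesis using wQ wperm(1) by (auto simp: permutes_def)
  qed
  moreover have "\<exists>!x. w x = y" for y using wperm(1) unfolding permutes_def by blast
  ultimately have "w permutes B" unfolding permutes_def by blast
  then have "w = id" using even_on_two_points wperm(2) B by blast
  then have "h y = s y" for y unfolding w_def by (metis comp_apply id_apply inv_s(2))
  then have "h = p [^]\<^bsub>alt_group d\<^esub> n" unfolding pow s_def by blast
  then show ?thesis by blast
qed

lemma type_I_centralizer:
  assumes d: "d \<le> 7" and type: "cycle_type p \<in> {{#5#}, {#2, 4#}} \<union> (if d = 7 then {{#7#}} else {})"
    and h: "h \<in> carrier (alt_group d)" "p \<circ> h = h \<circ> p"
  shows "\<exists>n::nat. h = p [^]\<^bsub>alt_group d\<^esub> n"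
proof -
  consider "cycle_type p = {#5#}" | "cycle_type p = {#7#}" "d = 7" | "cycle_type p = {#2, 4#}"
    using type by (auto split: if_splits)
  then show ?thesis
  proof cases
    case 1
    then obtain Q where Q: "nontrivial_orbits p = {Q}" "card Q = 5" using cycle_type_orbits1 by blast
    have "Q \<subseteq> {1..d}" using alt_orbit_subset Q by blast
    then have "card ({1..d} - Q) \<le> 2" using Q d by (simp add: card_Diff_subset finite_subset)
    then show ?thesis
      by (intro centralizer_cyclic[of Q "{1..d} - Q", OF _ _ _ _ _ h]) (use Q in auto)
  next
    case 2
    then obtain Q where Q: "nontrivial_orbits p = {Q}" "card Q = 7" using cycle_type_orbits1 by blast
    have "Q \<subseteq> {1..d}" using alt_orbit_subset Q by blast
    then have "card ({1..d} - Q) \<le> 2" using Q d by (simp add: card_Diff_subset finite_subset)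
    then show ?thesis
      by (intro centralizer_cyclic[of Q "{1..d} - Q", OF _ _ _ _ _ h]) (use Q in auto)
  next
    case 3
    obtain R Q where Q: "nontrivial_orbits p = {R, Q}" "R \<noteq> Q" "card R = 2" "card Q = 4"
      using cycle_type_orbits2[OF 3] .
    have sub: "Q \<subseteq> {1..d}" "R \<subseteq> {1..d}" using alt_orbit_subset Q by auto
    have "Q \<inter> R = {}" using nontrivial_orbits_disjoint[OF alt_permutation] Q by blast
    then have "card (Q \<union> R) = 6"
      using Q sub by (subst card_Un_disjoint) (auto intro: finite_subset)
    then have "card ({1..d} - (Q \<union> R)) \<le> 1" using sub d by (subst card_Diff_subset) (auto intro: finite_subset)
    moreover have "{y \<in> {1..d}. p y = y} \<subseteq> {1..d} - (Q \<union> R)"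
      using nontrivial_orbit_eq[OF alt_permutation] Q by blast
    ultimately have one: "card {y \<in> {1..d}. p y = y} \<le> 1"
      by (meson card_mono finite_Diff finite_atLeastAtMost order_trans)
    show ?thesis
    proof (rule centralizer_cyclic[of Q R, OF _ _ _ _ _ h])
      show "Q \<in> nontrivial_orbits p" "card R \<le> 2" using Q by auto
      show "finite R" using sub finite_subset by blast
      show "S = Q" if "S \<in> nontrivial_orbits p" "card S = card Q" for S using that Q by auto
      show "p y = y \<and> card {y \<in> {1..d}. p y = y} \<le> 1" if "y \<in> {1..d}" "y \<notin> Q" "y \<notin> R" for y
        using that one fixed_outside_orbits[OF alt_permutation, of y] Q by auto
    qed
  qed
qed

end

section \<open>The ambiguity index of the alternating groups of degree 6 and 7\<close>

lemma cyc3_commute: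
  assumes "distinct [a, b, c, e, f, k]"
  shows "cyc3 a b c \<circ> cyc3 e f k = cyc3 e f k \<circ> cyc3 a b c"
  using assms by (intro ext) (auto simp: cyc3_def)

lemma transposes_commute:
  assumes "distinct [a, b, c, e]"
  shows "(transpose a b \<circ> transpose c e) \<circ> (transpose a c \<circ> transpose b e) =
    (transpose a c \<circ> transpose b e) \<circ> (transpose a b \<circ> transpose c e)"
  using assms by (intro ext) (auto simp: transpose_def)

lemma transposes_cyc3_commute:
  assumes "distinct [a, b, c, e, x, y, z]"
  shows "(transpose a b \<circ> transpose c e) \<circ> cyc3 x y z = cyc3 x y z \<circ> (transpose a b \<circ> transpose c e)"
proof -
  let ?t = "transpose a b \<circ> transpose c e"
  have bij: "bij ?t" by (simp add: bij_comp)
  have "?t x = x" "?t y = y" "?t z = z" using assms by (auto simp: transpose_def)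
  then have "?t \<circ> cyc3 x y z \<circ> inv' ?t = cyc3 x y z" using cyc3_conj[OF bij, of x y z] by simp
  then have "cyc3 x y z \<circ> ?t = ?t \<circ> cyc3 x y z \<circ> (inv' ?t \<circ> ?t)" by (metis comp_assoc)
  then show ?thesis using inv_o_cancel[OF bij_is_inj[OF bij]] by simp
qed

lemma commuting_product_powers:
  fixes s t :: "'a \<Rightarrow> 'a"
  assumes "t \<circ> s = s \<circ> t" "s \<circ> s \<circ> s = id"
  shows "t \<circ> t = id \<Longrightarrow> (t \<circ> s) \<circ> (t \<circ> s) \<circ> (t \<circ> s) = t"
    and "t \<circ> t = id \<Longrightarrow> (t \<circ> s) \<circ> (t \<circ> s) \<circ> (t \<circ> s) \<circ> (t \<circ> s) = s"
    and "t \<circ> t \<circ> t = id \<Longrightarrow> (t \<circ> s) \<circ> (t \<circ> s) \<circ> (t \<circ> s) = id"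
proof -
  have *: "s (t v) = t (s v)" "s (s (s v)) = v" for v
    using assms by (metis comp_apply, metis comp_apply id_apply)
  show "(t \<circ> s) \<circ> (t \<circ> s) \<circ> (t \<circ> s) = t" if "t \<circ> t = id"
  proof -
    have "t (t v) = v" for v using that by (metis comp_apply id_apply)
    then show ?thesis by (intro ext) (simp add: *)
  qed
  show "(t \<circ> s) \<circ> (t \<circ> s) \<circ> (t \<circ> s) \<circ> (t \<circ> s) = s" if "t \<circ> t = id"
  proof -
    have "t (t v) = v" for v using that by (metis comp_apply id_apply)
    then show ?thesis by (intro ext) (simp add: *)
  qed
  show "(t \<circ> s) \<circ> (t \<circ> s) \<circ> (t \<circ> s) = id" if "t \<circ> t \<circ> t = id"
  proof -
    have "t (t (t v)) = v" for v using that by (metis comp_apply id_apply)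
    then show ?thesis by (intro ext) (simp add: *)
  qed
qed

lemma transposes_square: "distinct [a, b, c, e] \<Longrightarrow> (transpose a b \<circ> transpose c e) \<circ> (transpose a b \<circ> transpose c e) = id"
  by (intro ext) (auto simp: transpose_def)

lemma alt_pow2: "g [^]\<^bsub>alt_group d\<^esub> (2::nat) = g \<circ> g"
  by (simp add: numeral_2_eq_2 alt_group_mult alt_group_one)

lemma alt_pow3: "g [^]\<^bsub>alt_group d\<^esub> (3::nat) = g \<circ> g \<circ> g"
  by (simp add: numeral_3_eq_3 alt_group_mult alt_group_one comp_assoc)

lemma cyc3_cube_comp: "distinct [a, b, c] \<Longrightarrow> cyc3 a b c \<circ> cyc3 a b c \<circ> cyc3 a b c = id"
  using cyc3_cubed[of a b c] by (simp add: alt_pow3 alt_group_one)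

lemma alt_pow_commute:
  assumes "t \<circ> s = s \<circ> t"
  shows "t \<circ> s [^]\<^bsub>alt_group d\<^esub> (n::nat) = s [^]\<^bsub>alt_group d\<^esub> n \<circ> t"
proof (induction n)
  case 0
  show ?case by (simp add: alt_group_one)
next
  case (Suc n)
  have "t \<circ> (s [^]\<^bsub>alt_group d\<^esub> n \<circ> s) = s [^]\<^bsub>alt_group d\<^esub> n \<circ> (t \<circ> s)"
    unfolding comp_assoc[symmetric] Suc ..
  then show ?case unfolding assms by (simp add: alt_group_mult fun_eq_iff)
qed

lemma commute_with_factor:
  assumes "h = n \<circ> w" "t \<circ> h = h \<circ> t" "t \<circ> n = n \<circ> t"
  shows "n \<circ> (t \<circ> w) = n \<circ> (w \<circ> t)"
  using assms by (metis comp_assoc)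

context alt_extension
begin

text \<open>The centralizer of \<open>(a b c)\<close> contains a disjoint 3-cycle, and the centralizer of
  \<open>(a b c)(e f k)\<close> contains \<open>(a b c)\<close>.\<close>

lemma cyc3_lifts_commute_if_type_II:
  assumes g: "g \<in> carrier A" "cycle_type g \<in> {{#3#}, {#3, 3#}}"
    and comm: "\<And>h. \<lbrakk>h \<in> carrier A; g \<otimes>\<^bsub>A\<^esub> h = h \<otimes>\<^bsub>A\<^esub> g\<rbrakk> \<Longrightarrow> lifts_commute K p g h"
  shows cyc3_lifts_commute
proof -
  have transfer: cyc3_lifts_commute if "distinct [a, b, c, e, f, k]" "{a, b, c, e, f, k} \<subseteq> {1..d}"
    "lifts_commute K p (cyc3 a b c) (cyc3 e f k)" for a b c e f k
    unfolding cyc3_lifts_commute_def using d by (intro comm_cyc3_transfer[OF that(1,2) _ _ that(3)]) auto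
  consider "cycle_type g = {#3#}" | "cycle_type g = {#3, 3#}" using g(2) by blast
  then show ?thesis
  proof cases
    case 1
    obtain a b c where abc: "distinct [a, b, c]" "{a, b, c} \<subseteq> {1..d}" "g = cyc3 a b c"
      using type3_form[OF g(1) 1] .
    have "3 \<le> card ({1..d} - {a, b, c})" using abc d by (simp add: card_Diff_subset)
    from obtain_subset_with_card_n[OF this] obtain T where T: "T \<subseteq> {1..d} - {a, b, c}" "card T = 3"
      by blast
    then obtain e f k where efk: "T = {e, f, k}" "distinct [e, f, k]" by (auto simp: card_3_iff)
    then have dist: "distinct [a, b, c, e, f, k]" "{a, b, c, e, f, k} \<subseteq> {1..d}" using T abc by auto
    have "cyc3 e f k \<in> carrier A" using efk T by (intro cyc3_alt) auto
    then have "lifts_commute K p (cyc3 a b c) (cyc3 e f k)"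
      using comm cyc3_commute[OF dist(1)] unfolding abc(3) alt_group_mult by blast
    then show ?thesis by (rule transfer[OF dist])
  next
    case 2
    obtain a b c e f k where *: "distinct [a, b, c, e, f, k]" "{a, b, c, e, f, k} \<subseteq> {1..d}"
      "g = cyc3 a b c \<circ> cyc3 e f k"
      using type33_form[OF g(1) 2] .
    have t: "cyc3 a b c \<in> carrier A" "cyc3 e f k \<in> carrier A" using * by (auto intro!: cyc3_alt)
    have "g \<otimes>\<^bsub>A\<^esub> cyc3 a b c = cyc3 a b c \<otimes>\<^bsub>A\<^esub> g"
      unfolding *(3) alt_group_mult by (metis comp_assoc cyc3_commute[OF *(1)])
    from lifts_commute_sym[OF comm[OF t(1) this]] have 1: "lifts_commute K p (cyc3 a b c) g" .
    have "lifts_commute K p (cyc3 a b c) (cyc3 a b c)" using lifts_commute_refl_pow[OF t(1), of 1] t by simp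
    then have "lifts_commute K p (cyc3 a b c) (inv\<^bsub>A\<^esub> cyc3 a b c \<otimes>\<^bsub>A\<^esub> g)"
      using 1 t g(1) by (intro lifts_commute_mult lifts_commute_inv) auto
    moreover have "inv\<^bsub>A\<^esub> cyc3 a b c \<otimes>\<^bsub>A\<^esub> g = cyc3 e f k"
      using G.mult_inv_cancel(2)[OF t] by (simp add: *(3) alt_group_mult)
    ultimately have "lifts_commute K p (cyc3 a b c) (cyc3 e f k)" by simp
    then show ?thesis by (rule transfer[OF *(1,2)])
  qed
qed

text \<open>The centralizer of \<open>(a b)(c e)\<close>, and of \<open>(a b)(c e)(x y z)\<close>, contains \<open>(a c)(b e)\<close>; in the second case
  pass to the cube.\<close>

lemma klein_lifts_commute_if_type_III:
  assumes g: "g \<in> carrier A" "cycle_type g \<in> {{#2, 2#}, {#2, 2, 3#}}"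
    and comm: "\<And>h. \<lbrakk>h \<in> carrier A; g \<otimes>\<^bsub>A\<^esub> h = h \<otimes>\<^bsub>A\<^esub> g\<rbrakk> \<Longrightarrow> lifts_commute K p g h"
  shows klein_lifts_commute
proof -
  have transfer: klein_lifts_commute if "distinct [a, b, c, e]" "{a, b, c, e} \<subseteq> {1..d}"
    "lifts_commute K p (transpose a b \<circ> transpose c e) (transpose a c \<circ> transpose b e)" for a b c e
    unfolding klein_lifts_commute_def using d by (intro comm_transposes_transfer[OF that(1,2) _ _ that(3)]) auto
  consider "cycle_type g = {#2, 2#}" | "cycle_type g = {#2, 2, 3#}" using g(2) by blast
  then show ?thesis
  proof cases
    case 1
    obtain a b c e where *: "distinct [a, b, c, e]" "{a, b, c, e} \<subseteq> {1..d}"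
      "g = transpose a b \<circ> transpose c e"
      using type22_form[OF g(1) 1] .
    have "transpose a c \<circ> transpose b e \<in> carrier A" using * by (intro transpose_comp_alt) auto
    then have "lifts_commute K p g (transpose a c \<circ> transpose b e)"
      using comm transposes_commute[OF *(1)] unfolding *(3) alt_group_mult by blast
    then show ?thesis using transfer[OF *(1,2)] *(3) by simp
  next
    case 2
    obtain a b c e x y z where *: "distinct [a, b, c, e, x, y, z]" "{a, b, c, e, x, y, z} \<subseteq> {1..d}"
      "g = (transpose a b \<circ> transpose c e) \<circ> cyc3 x y z"
      using type223_form[OF g(1) 2] .
    let ?t = "transpose a b \<circ> transpose c e" and ?h = "transpose a c \<circ> transpose b e"
    have dist: "distinct [a, b, c, e]" "{a, b, c, e} \<subseteq> {1..d}" "distinct [a, c, b, e, x, y, z]"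
      "distinct [x, y, z]" using * by auto
    have h: "?h \<in> carrier A" using dist by (intro transpose_comp_alt) auto
    have "?t \<circ> cyc3 x y z \<circ> ?h = ?h \<circ> (?t \<circ> cyc3 x y z)"
    proof -
      have "?t \<circ> cyc3 x y z \<circ> ?h = ?t \<circ> ?h \<circ> cyc3 x y z"
        using transposes_cyc3_commute[OF dist(3)] by (metis comp_assoc)
      also have "\<dots> = ?h \<circ> ?t \<circ> cyc3 x y z" using transposes_commute[OF dist(1)] by simp
      finally show ?thesis by (simp add: comp_assoc)
    qed
    then have "lifts_commute K p g ?h" using comm[OF h] unfolding *(3) alt_group_mult by blast
    then have "lifts_commute K p ?h (g [^]\<^bsub>A\<^esub> (3::nat))"
      by (rule lifts_commute_pow[OF h g(1) lifts_commute_sym])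
    moreover have "g [^]\<^bsub>A\<^esub> (3::nat) = ?t"
      unfolding alt_pow3 *(3) using dist
      by (intro commuting_product_powers(1) transposes_cyc3_commute cyc3_cube_comp transposes_square *(1))
    ultimately have "lifts_commute K p ?h ?t" by simp
    then have "lifts_commute K p ?t ?h" by (rule lifts_commute_sym)
    then show ?thesis by (rule transfer[OF dist(1,2)])
  qed
qed

lemma type_I_lifts:
  assumes g: "g \<in> carrier A" "cycle_type g \<in> {{#5#}, {#2, 4#}} \<union> (if d = 7 then {{#7#}} else {})"
    and h: "h \<in> carrier A" "g \<otimes>\<^bsub>A\<^esub> h = h \<otimes>\<^bsub>A\<^esub> g"
  shows "lifts_commute K p g h"
proof -
  obtain n :: nat where "h = g [^]\<^bsub>A\<^esub> n"
    using type_I_centralizer[OF g(1) d(2) g(2) h(1)] h(2) unfolding alt_group_mult by blast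
  then show ?thesis using lifts_commute_refl_pow[OF g(1)] by simp
qed

text \<open>If \<open>v = 1\<close>, commutators in the kernel are powers of \<open>u\<close> and have order at most 2, while a commutator
  with a lift of an element of order 3 has order 1 or 3.\<close>

lemma type_II_lifts:
  assumes cyc3_lifts_commute: cyc3_lifts_commute and g: "g \<in> carrier A" "cycle_type g \<in> {{#3#}, {#3, 3#}}"
    and h: "h \<in> carrier A" "g \<otimes>\<^bsub>A\<^esub> h = h \<otimes>\<^bsub>A\<^esub> g"
  shows "lifts_commute K p g h"
proof (rule lifts_commute_no_torsion[OF g(1) h, of 3])
  show "g [^]\<^bsub>A\<^esub> (3::nat) = \<one>\<^bsub>A\<^esub>"
  proof -
    consider "cycle_type g = {#3#}" | "cycle_type g = {#3, 3#}" using g(2) by blast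
    then show ?thesis
    proof cases
      case 1
      obtain a b c where abc: "distinct [a, b, c]" "g = cyc3 a b c" using type3_form[OF g(1) 1] by metis
      show ?thesis unfolding abc(2) by (rule cyc3_cubed[OF abc(1)])
    next
      case 2
      obtain a b c e f k where *: "distinct [a, b, c, e, f, k]" "g = cyc3 a b c \<circ> cyc3 e f k"
        using type33_form[OF g(1) 2] by metis
      show ?thesis
        unfolding alt_pow3 *(2) alt_group_one using *(1)
        by (intro commuting_product_powers(3) cyc3_commute cyc3_cube_comp) auto
    qed
  qed
next
  fix x y assume xy: "x \<in> carrier K" "y \<in> carrier K" and c: "p (commutator x y) = \<one>\<^bsub>A\<^esub>" "commutator x y [^] (3::nat) = \<one>"
  obtain u v where uv: "u \<in> carrier K" "v \<in> carrier K" "u \<otimes> v = v \<otimes> u" "u [^] (2::nat) = \<one>" "v [^] (3::nat) = \<one>" "u = \<one> \<longleftrightarrow> klein_lifts_commute" "v = \<one> \<longleftrightarrow> cyc3_lifts_commute"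
    "kernel K A p \<inter> derived K (carrier K) = {u [^] i \<otimes> v [^] j | i j. i < (2::nat) \<and> j < (3::nat)}"
    by (rule kernel_inter_derived)
  have "commutator x y \<in> derived K (carrier K)"
    using xy unfolding derived_def commutator_def by (blast intro: generate.incl)
  then have "commutator x y \<in> {u [^] i \<otimes> v [^] j | i j. i < (2::nat) \<and> j < (3::nat)}"
    using c(1) xy unfolding uv(8)[symmetric] by (simp add: kernel_def)
  then obtain i j :: nat where "commutator x y = u [^] i \<otimes> v [^] j" by blast
  then have c_u: "commutator x y = u [^] i" using uv(1,7) cyc3_lifts_commute by simp
  have "(u [^] i) [^] (2::nat) = (u [^] (2::nat)) [^] i" using uv(1) by (simp add: nat_pow_pow mult.commute)
  then have "commutator x y [^] (2::nat) = \<one>" using uv(4) c_u by simp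
  moreover have "coprime (3::nat) 2" by simp
  ultimately show "commutator x y = \<one>" using coprime_pow_one[of "commutator x y" 3 2] xy c(2) by simp
qed

text \<open>In a kernel of exponent 3 involutions impose nothing. For \<open>g = (a b)(c e)(x y z)\<close> this leaves the
  3-cycle \<open>(x y z)\<close>: modulo its powers, an element that commutes with \<open>g\<close> is an even permutation of the
  other four points commuting with \<open>(a b)(c e)\<close>, hence an involution or trivial, and 2 is coprime to 3.\<close>

lemma type_III_lifts:
  assumes exponent: "\<And>z. \<lbrakk>z \<in> carrier K; p z = \<one>\<^bsub>A\<^esub>\<rbrakk> \<Longrightarrow> z [^] (3::nat) = \<one>"
    and g: "g \<in> carrier A" "cycle_type g \<in> {{#2, 2#}} \<union> (if d = 7 then {{#2, 2, 3#}} else {})"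
    and h: "h \<in> carrier A" "g \<otimes>\<^bsub>A\<^esub> h = h \<otimes>\<^bsub>A\<^esub> g"
  shows "lifts_commute K p g h"
proof -
  have involution: "lifts_commute K p t k"
    if "t \<in> carrier A" "k \<in> carrier A" "t \<circ> k = k \<circ> t" "t \<circ> t = id" for t k
  proof (rule lifts_commute_no_torsion[of t k 2])
    fix x y assume xy: "x \<in> carrier K" "y \<in> carrier K" "p (commutator x y) = \<one>\<^bsub>A\<^esub>" "commutator x y [^] (2::nat) = \<one>"
    have "coprime (2::nat) 3" by simp
    then show "commutator x y = \<one>"
      using coprime_pow_one[of "commutator x y" 2 3] xy exponent[OF _ xy(3)] by simp
  qed (use that in \<open>simp_all add: alt_pow2 alt_group_mult alt_group_one\<close>)
  consider "cycle_type g = {#2, 2#}" | "cycle_type g = {#2, 2, 3#}" "d = 7"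
    using g(2) by (auto split: if_splits)
  then show ?thesis
  proof cases
    case 1
    obtain a b c e where *: "distinct [a, b, c, e]" "g = transpose a b \<circ> transpose c e"
      using type22_form[OF g(1) 1] by metis
    have "g \<circ> g = id" unfolding *(2) by (rule transposes_square[OF *(1)])
    then show ?thesis using involution[OF g(1) h(1)] h(2) by (simp add: alt_group_mult)
  next
    case 2
    obtain a b c e x y z where *: "distinct [a, b, c, e, x, y, z]" "{a, b, c, e, x, y, z} \<subseteq> {1..d}"
      "g = (transpose a b \<circ> transpose c e) \<circ> cyc3 x y z"
      using type223_form[OF g(1) 2(1)] .
    let ?t = "transpose a b \<circ> transpose c e" and ?s = "cyc3 x y z"
    have t: "?t \<in> carrier A" using * by (intro transpose_comp_alt) auto
    have dist: "distinct [x, y, z]" "{x, y, z} \<subseteq> {1..d}" "distinct [a, b, c, e]" using * by auto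
    have s: "?s \<in> carrier A" by (rule cyc3_alt[OF dist(1,2)])
    have gh: "g \<circ> h = h \<circ> g" using h(2) by (simp add: alt_group_mult)
    have ts: "?t \<circ> ?s = ?s \<circ> ?t" by (rule transposes_cyc3_commute[OF *(1)])
    have t_g: "?t = g \<circ> g \<circ> g" and s_g: "?s = g \<circ> g \<circ> g \<circ> g"
      using commuting_product_powers(1,2)[OF ts cyc3_cube_comp[OF dist(1)] transposes_square[OF dist(3)]]
      unfolding *(3) by simp_all
    have th: "?t \<circ> h = h \<circ> ?t" unfolding t_g by (metis comp_assoc gh)
    have sh: "?s \<circ> h = h \<circ> ?s" unfolding s_g by (metis comp_assoc gh)
    have 1: "lifts_commute K p ?t h" by (rule involution[OF t h(1) th transposes_square[OF dist(3)]])
    obtain n w where w: "h = ?s [^]\<^bsub>A\<^esub> (n::nat) \<circ> w" "w \<in> carrier A" "w x = x" "w y = y" "w z = z"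
      "w \<circ> w = id \<or> (\<exists>i j k. distinct [x, y, z, i, j, k] \<and> {i, j, k} \<subseteq> {1..d} \<and> w = cyc3 i j k)"
      using centralizer_cyc3[OF dist(1,2) d(2) h(1) sh[symmetric]] by metis
    have tw: "?t \<circ> w = w \<circ> ?t"
    proof -
      let ?n = "?s [^]\<^bsub>A\<^esub> n"
      have n: "?n \<in> carrier A" using s by simp
      have "?n \<otimes>\<^bsub>A\<^esub> (?t \<otimes>\<^bsub>A\<^esub> w) = ?n \<otimes>\<^bsub>A\<^esub> (w \<otimes>\<^bsub>A\<^esub> ?t)"
        unfolding alt_group_mult by (rule commute_with_factor[OF w(1) th alt_pow_commute[OF ts]])
      then have "?t \<otimes>\<^bsub>A\<^esub> w = w \<otimes>\<^bsub>A\<^esub> ?t" using n t w(2) by simp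
      then show ?thesis by (simp add: alt_group_mult)
    qed
    have "w \<circ> w = id"
    proof (rule ccontr)
      assume "w \<circ> w \<noteq> id"
      then obtain i j k where ijk: "distinct [x, y, z, i, j, k]" "{i, j, k} \<subseteq> {1..d}" "w = cyc3 i j k"
        using w(6) by blast
      \<comment> \<open>A 3-cycle on four points fixes exactly one of them, so it commutes with no
        double transposition of these points.\<close>
      have "card {a, b, c, e, x, y, z} = 7" using *(1) by simp
      then have all: "{a, b, c, e, x, y, z} = {1..d}" using *(2) 2 card_seteq[of "{1..d}" "{a, b, c, e, x, y, z}"] by simp
      have "\<not> {a, b, c, e} \<subseteq> {i, j, k}"
      proof
        assume "{a, b, c, e} \<subseteq> {i, j, k}"
        then have "card {a, b, c, e} \<le> card {i, j, k}" by (intro card_mono) auto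
        moreover have "card {i, j, k} \<le> 3" using card_length[of "[i, j, k]"] by simp
        ultimately show False using dist(3) by simp
      qed
      then obtain q where q: "q \<in> {a, b, c, e}" "q \<notin> {i, j, k}" by blast
      have "{i, j, k} \<inter> {x, y, z} = {}" using ijk(1) by auto
      then have ijk': "{i, j, k} \<subseteq> {a, b, c, e}" using ijk(2) unfolding all[symmetric] by blast
      have "w (?t q) = ?t q"
      proof -
        have "w q = q" using q unfolding ijk(3) by (simp add: cyc3_def)
        then show ?thesis using tw by (metis comp_apply)
      qed
      moreover have "?t q \<in> {a, b, c, e}" "?t q \<noteq> q" using q(1) dist(3) by (auto simp: transpose_def)
      moreover have "{a, b, c, e} = {q, i, j, k}"
      proof -
        have "card {q, i, j, k} = 4" using q(2) ijk(1) by auto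
        then show ?thesis using card_seteq[of "{a, b, c, e}" "{q, i, j, k}"] q(1) ijk' dist(3) by auto
      qed
      ultimately have "?t q \<in> {i, j, k}" "w (?t q) = ?t q" by auto
      then show False using ijk(1) unfolding ijk(3) by (auto simp: cyc3_def split: if_splits)
    qed
    have "w \<otimes>\<^bsub>A\<^esub> ?s \<otimes>\<^bsub>A\<^esub> inv\<^bsub>A\<^esub> w = ?s" using w by (simp add: alt_conj_cyc3)
    then have sw: "?s \<otimes>\<^bsub>A\<^esub> w = w \<otimes>\<^bsub>A\<^esub> ?s" using w(2) s by (metis G.inv_solve_right' G.m_closed)
    have "lifts_commute K p w ?s"
      using involution[OF w(2) s _ \<open>w \<circ> w = id\<close>] sw by (simp add: alt_group_mult)
    then have "lifts_commute K p ?s w" by (rule lifts_commute_sym)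
    then have "lifts_commute K p ?s (?s [^]\<^bsub>A\<^esub> n \<otimes>\<^bsub>A\<^esub> w)"
      by (rule lifts_commute_mult[OF s G.nat_pow_closed[OF s] w(2) lifts_commute_refl_pow[OF s]])
    then have 2: "lifts_commute K p ?s h" using w(1) by (simp add: alt_group_mult)
    have "lifts_commute K p h (?t \<otimes>\<^bsub>A\<^esub> ?s)"
      by (rule lifts_commute_mult[OF h(1) t s lifts_commute_sym[OF 1] lifts_commute_sym[OF 2]])
    then have "lifts_commute K p h g" by (simp add: *(3) alt_group_mult)
    then show ?thesis by (rule lifts_commute_sym)
  qed
qed

end


lemma alt_class_type:
  assumes "g \<in> \<Union>(alt_classes_of_type d T)"
  shows "cycle_type g \<in> T"
  using assms by (auto simp: alt_classes_of_type_def)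

lemma alt_class_has_element:
  assumes "C \<in> alt_classes_of_type d T"
  obtains g where "g \<in> C" "g \<in> carrier (alt_group d)" "cycle_type g \<in> T"
proof -
  interpret A: group "alt_group d" by (rule alt_group_is_group)
  obtain x where x: "x \<in> carrier (alt_group d)" "C = conj_class (alt_group d) x"
    using assms by (auto simp: alt_classes_of_type_def conj_classes_def)
  have "\<one>\<^bsub>alt_group d\<^esub> \<otimes>\<^bsub>alt_group d\<^esub> x \<otimes>\<^bsub>alt_group d\<^esub> inv\<^bsub>alt_group d\<^esub> \<one>\<^bsub>alt_group d\<^esub> \<in> C"
    unfolding x(2) conj_class_def by blast
  then have "x \<in> C" using x(1) by simp
  then show ?thesis using that x(1) assms by (simp add: alt_classes_of_type_def)
qed

theorem proposition7:
  fixes d :: nat and E :: "(nat \<Rightarrow> nat) set"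
  assumes "d \<in> {6, 7}" and "equipment (alt_group d) E"
  shows "(E \<subseteq> \<Union>(classes_I d) \<longrightarrow> ambiguity_index (alt_group d) E = 6) \<and>
    (E \<subseteq> \<Union>(classes_I d \<union> classes_II d) \<and> (\<exists>C\<in>classes_II d. C \<subseteq> E) \<longrightarrow>
       ambiguity_index (alt_group d) E = 2) \<and>
    (E \<subseteq> \<Union>(classes_I d \<union> classes_III d) \<and> (\<exists>C\<in>classes_III d. C \<subseteq> E) \<longrightarrow>
       ambiguity_index (alt_group d) E = 3) \<and>
    ((\<exists>C\<in>classes_II d. C \<subseteq> E) \<and> (\<exists>C\<in>classes_III d. C \<subseteq> E) \<longrightarrow>
       ambiguity_index (alt_group d) E = 1)"
proof -
  let ?A = "alt_group d"
  have d: "6 \<le> d" "d \<le> 7" using assms(1) by auto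
  interpret Eq: equipped_group ?A E
    using assms(2) alt_group_is_group by (simp add: equipped_group_def equipped_group_axioms_def)
  interpret K: alt_extension "tilde_group ?A E" d "beta ?A"
    using Eq.b.central_extension_axioms d by (simp add: alt_extension_def alt_extension_axioms_def)
  interpret S: alt_extension "spin d" d fst by (rule spin_alt_extension[OF d])
  interpret T: alt_extension "triple_cover d" d fst
    using triple_extension d by (simp add: alt_extension_def alt_extension_axioms_def)
  have index: "ambiguity_index ?A E = (if K.klein_lifts_commute then 1 else 2) * (if K.cyc3_lifts_commute then 1 else 3)"
    unfolding ambiguity_index_def by (rule K.card_kernel_inter_derived)
  have in_A: "transpose 1 2 \<circ> transpose 3 4 \<in> carrier ?A" "transpose 1 3 \<circ> transpose 2 4 \<in> carrier ?A"
    "cyc3 1 2 3 \<in> carrier ?A" "cyc3 4 5 6 \<in> carrier ?A"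
    using d by (auto intro!: transpose_comp_alt cyc3_alt)
  have type_I: "cycle_type g \<in> {{#5#}, {#2, 4#}} \<union> (if d = 7 then {{#7#}} else {})"
    if "g \<in> \<Union>(classes_I d)" for g
    using alt_class_type that unfolding classes_I_def .
  have type_II: "cycle_type g \<in> {{#3#}, {#3, 3#}}" if "g \<in> \<Union>(classes_II d)" for g
    using alt_class_type that unfolding classes_II_def .
  have type_III: "cycle_type g \<in> {{#2, 2#}} \<union> (if d = 7 then {{#2, 2, 3#}} else {})"
    if "g \<in> \<Union>(classes_III d)" for g
    using alt_class_type that unfolding classes_III_def .
  have cyc3_lifts_commute: K.cyc3_lifts_commute if ex: "\<exists>C\<in>classes_II d. C \<subseteq> E"
  proof -
    obtain C where C: "C \<in> classes_II d" "C \<subseteq> E" using ex by blast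
    obtain g where g: "g \<in> C" "g \<in> carrier ?A" "cycle_type g \<in> {{#3#}, {#3, 3#}}"
      by (rule alt_class_has_element[OF C(1)[unfolded classes_II_def]])
    then have "g \<in> E" using C(2) by blast
    then show ?thesis using K.cyc3_lifts_commute_if_type_II[OF g(2,3)] Eq.tilde_lifts_commute by blast
  qed
  have klein_lifts_commute: K.klein_lifts_commute if ex: "\<exists>C\<in>classes_III d. C \<subseteq> E"
  proof -
    obtain C where C: "C \<in> classes_III d" "C \<subseteq> E" using ex by blast
    obtain g where g: "g \<in> C" "g \<in> carrier ?A"
      "cycle_type g \<in> {{#2, 2#}} \<union> (if d = 7 then {{#2, 2, 3#}} else {})"
      by (rule alt_class_has_element[OF C(1)[unfolded classes_III_def]])
    then have "g \<in> E" "cycle_type g \<in> {{#2, 2#}, {#2, 2, 3#}}" using C(2) by (auto split: if_splits)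
    then show ?thesis using K.klein_lifts_commute_if_type_III[OF g(2)] Eq.tilde_lifts_commute by blast
  qed
  have not_U: "\<not> K.klein_lifts_commute" if E: "E \<subseteq> \<Union>(classes_I d \<union> classes_II d)"
  proof
    have comm: "lifts_commute (spin d) fst g h"
      if g: "g \<in> E" and h: "h \<in> carrier ?A" "g \<otimes>\<^bsub>?A\<^esub> h = h \<otimes>\<^bsub>?A\<^esub> g" for g h
    proof -
      have gA: "g \<in> carrier ?A" using g Eq.sub by blast
      consider "g \<in> \<Union>(classes_I d)" | "g \<in> \<Union>(classes_II d)" using E g by blast
      then show ?thesis
      proof cases
        case 1
        then show ?thesis using S.type_I_lifts[OF gA type_I h] by blast
      next
        case 2
        then show ?thesis using S.type_II_lifts[OF spin_cyc3_lifts_commute[OF d] gA type_II h] by blast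
      qed
    qed
    assume K.klein_lifts_commute
    then have S.klein_lifts_commute
      using Eq.lifts_commute_transfer[OF spin_extension comm in_A(1,2)] unfolding K.klein_lifts_commute_def S.klein_lifts_commute_def by blast
    then show False using spin_klein_lifts_not_commute[OF d] by blast
  qed
  have not_V: "\<not> K.cyc3_lifts_commute" if E: "E \<subseteq> \<Union>(classes_I d \<union> classes_III d)"
  proof
    have comm: "lifts_commute (triple_cover d) fst g h"
      if g: "g \<in> E" and h: "h \<in> carrier ?A" "g \<otimes>\<^bsub>?A\<^esub> h = h \<otimes>\<^bsub>?A\<^esub> g" for g h
    proof -
      have gA: "g \<in> carrier ?A" using g Eq.sub by blast
      consider "g \<in> \<Union>(classes_I d)" | "g \<in> \<Union>(classes_III d)" using E g by blast
      then show ?thesis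
      proof cases
        case 1
        then show ?thesis using T.type_I_lifts[OF gA type_I h] by blast
      next
        case 2
        then show ?thesis
          using T.type_III_lifts[OF triple_kernel_exponent[OF d(2)] gA type_III h] by blast
      qed
    qed
    assume K.cyc3_lifts_commute
    then have T.cyc3_lifts_commute
      using Eq.lifts_commute_transfer[OF triple_extension[OF d(2)] comm in_A(3,4)]
      unfolding K.cyc3_lifts_commute_def T.cyc3_lifts_commute_def by blast
    then show False using triple_cyc3_lifts_not_commute[OF d] by blast
  qed
  have both: "E \<subseteq> \<Union>(classes_I d \<union> classes_II d)" "E \<subseteq> \<Union>(classes_I d \<union> classes_III d)"
    if "E \<subseteq> \<Union>(classes_I d)"
    using that by auto
  show ?thesis
  proof (intro conjI impI)
    assume "E \<subseteq> \<Union>(classes_I d)"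
    then show "ambiguity_index ?A E = 6" using index not_U not_V both by simp
  next
    assume "E \<subseteq> \<Union>(classes_I d \<union> classes_II d) \<and> (\<exists>C\<in>classes_II d. C \<subseteq> E)"
    then show "ambiguity_index ?A E = 2" using index not_U cyc3_lifts_commute by presburger
  next
    assume "E \<subseteq> \<Union>(classes_I d \<union> classes_III d) \<and> (\<exists>C\<in>classes_III d. C \<subseteq> E)"
    then show "ambiguity_index ?A E = 3" using index not_V klein_lifts_commute by presburger
  next
    assume "(\<exists>C\<in>classes_II d. C \<subseteq> E) \<and> (\<exists>C\<in>classes_III d. C \<subseteq> E)"
    then show "ambiguity_index ?A E = 1" using index klein_lifts_commute cyc3_lifts_commute by presburger
  qed
qed

end
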